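(* Let $I=(a_-,a_+)$ be a bounded open interval, $p\in[1,\infty)$, $w\in L^1(I)$ a stable weight, $m\ge1$ an integer, and $u\in H^{m,p}_{\mu_w}$. Let $\Delta k\ge1$ be the smallest positive integer such that $a_-\notin\bar I_{cr}^{\,\Delta k-1,p}(w)$, or $\Delta k=\infty$ if $a_-\in\bar I_{cr}^{\,\alpha,p}(w)$ for every $\alpha\ge0$. Set $\bar k:=\max\{m-\Delta k,-1\}\in\{-1,0,\dots,m-1\}$ and choose any $m$ numbers $v_0^-,\dots,v_{m-1}^-\in\mathbb{R}$ such that (i) for indices $0\le k\le\bar k$ (if any), $\mathrm{Tr}^k u\,(a_-)=v_k^-$; (ii) for indices $\bar k+1\le k\le m-1$ (if any), $v_k^-$ is an arbitrary real number. Then for every $\varepsilon>0$ there exist a function $u_\varepsilon\in\mathcal{D}(\mathbb{R})$ and $\delta=\delta(\varepsilon)>0$ such that $$\|u-u_\varepsilon\|_{H^{m,p}_{\mu_w}}<\varepsilon,$$ while $$D^ku_\varepsilon(a_-)=v_k^-\quad\text{for }k\in\{0,\dots,m-1\},\qquad D^mu_\varepsilon(x)=0\quad\text{for every }x\in B(a_-,\delta)\cap I.$$ The analogous statement holds independently for the other boundary point $a_+$ and boundary values $v_0^+,\dots,v_{m-1}^+\in\mathbb{R}$ (where $\Delta k$ and $\bar k$ are defined with $a_+$ in place of $a_-$, and may differ, and where $\mathrm{Tr}^k u\,(a_+)=v_k^+$ is required for $0\le k\le\bar k$ while $v_k^+$ is arbitrary for $\bar k+1\le k\le m-1$). Moreover,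 for such $v_k^-$ and $v_k^+$ and every $\varepsilon>0$, the function $u_\varepsilon\in\mathcal{D}(\mathbb{R})$ with $\|u-u_\varepsilon\|_{H^{m,p}_{\mu_w}}<\varepsilon$ and $\delta=\delta(\varepsilon)>0$ may be chosen such that simultaneously $D^ku_\varepsilon(a_-)=v_k^-$ and $D^ku_\varepsilon(a_+)=v_k^+$ for $k\in\{0,\dots,m-1\}$, and $D^mu_\varepsilon(x)=0$ for every $x\in\big(B(a_-,\delta)\cup B(a_+,\delta)\big)\cap I$.
   Context: A weight is a non-negative function $w\in L^1(I)$. $\mathcal{L}^1$ is Lebesgue measure, $\mu_w:=w\,\mathcal{L}^1$ restricted to $I$, and $L^p_{\mu_w}$ is the Lebesgue space with norm $(\int_I w|u|^p\,dx)^{1/p}$. $p'=p/(p-1)$ is the Hölder conjugate ($p'=\infty$ if $p=1$). Convention: $\alpha/0=0$ if $\alpha=0$ and $\alpha/0=\infty$ if $\alpha>0$. $\mathcal{D}(\mathbb{R})$ denotes smooth compactly supported functions on $\mathbb{R}$ (they need not vanish at $a_\pm$). Critical set of order $\alpha\in[0,\infty)$: for $p\in(1,\infty)$, $$\bar I_{cr}^{\,\alpha,p}(w):=\Big\{x_0\in\bar I:\ \forall\varepsilon>0\ \int_{\bar I\cap B(x_0,\varepsilon)}\Big(\frac{|x-x_0|^\alpha}{(w(x))^{1/p}}\Big)^{p'}dx=\infty\Big\},$$ and for $p=1$, $\bar I_{cr}^{\,\alpha,1}(w):=\{x_0\in\bar I:\ \forall\varepsilon>0\ \ \mathcal{L}^1\text{-}\mathrm{ess\,sup}\{|x-x_0|^\alpha/w(x):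 x\in\bar I\cap B(x_0,\varepsilon)\}=\infty\}$. The right-sided and left-sided critical sets $\bar I_{cr,+}^{\,\alpha,p}(w)$ and $\bar I_{cr,-}^{\,\alpha,p}(w)$ are defined in the same way with $B(x_0,\varepsilon)$ replaced by $B_+(x_0,\varepsilon):=(x_0,x_0+\varepsilon)$ and $B_-(x_0,\varepsilon):=(x_0-\varepsilon,x_0)$, respectively. Stability (for the given $p$): a point $x_0\in\bar I_{cr,+}^{\,0,p}(w)$ (resp. $x_0\in\bar I_{cr,-}^{\,0,p}(w)$) is right-sided (resp. left-sided) stable if there is $r>0$ such that $w$ has an a.e. equal representative which, on $B_+(x_0,r)\cap I$ (resp. $B_-(x_0,r)\cap I$), does not decrease with the distance $|x-x_0|$. A critical point $x_0\in\bar I_{cr}^{\,0,p}(w)$ is stable if it is right-sided stable or left-sided stable. The weight $w$ is stable if every $x_0\in\bar I_{cr}^{\,0,p}(w)$ is stable. Stable weights satisfy $\mu_w(\bar I_{cr}^{\,0,p}(w))=0$, which makes the following definition meaningful. For an integer $m\ge1$ let $H^{m,p}_{\mu_w}$ be the set of $u\in L^p_{\mu_w}$ for which there exist $u_h\in\mathcal{D}(\mathbb{R})$ and $v_1,\dots,v_m\in L^p_{\mu_w}$ with $u_h\to u$ and $D^ku_h\to v_k$ in $L^p_{\mu_w}$, $k=1,\dots,m$ (classical derivatives). The $v_k$ are uniquely determined by $u$ and are denoted $D^k_{\mu_w}u$, with $D^0_{\mu_w}u:=u$. The norm is $\|u\|_{H^{m,p}_{\mu_w}}=(\sum_{k=0}^m\|D^k_{\mu_w}u\|^p_{L^p_{\mu_w}})^{1/p}$.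 Traces: for $u\in\mathcal{D}(\mathbb{R})$, $\mathrm{Tr}^ku\,(a_\pm):=D^ku(a_\pm)$. If $a_\pm\notin\bar I_{cr}^{\,m-\bar k-1,p}(w)$ with $\bar k\in\{0,\dots,m-1\}$, then for each $k\in\{0,\dots,\bar k\}$ the functional $u\mapsto\mathrm{Tr}^ku\,(a_\pm)$ extends continuously (uniquely, by density of $\mathcal D(\mathbb R)$) to $H^{m,p}_{\mu_w}$; the extension is denoted by the same symbol. *)

theory Defs
  imports "HOL-Analysis.Analysis" "HOL-Probability.Essential_Supremum" "HOL-Library.Extended_Nat"
begin

text \<open>
  Throughout, \<open>a < b\<close> are the endpoints of the bounded open interval \<open>I = {a<..<b}\<close>,
  \<open>p \<ge> 1\<close> is the exponent and \<open>w\<close> is a weight on \<open>I\<close>.  Elements of Lebesgue spaces are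
  represented by functions \<open>real \<Rightarrow> real\<close>; their values outside \<open>I\<close> are irrelevant.
\<close>

definition weight :: "real \<Rightarrow> real \<Rightarrow> (real \<Rightarrow> real) \<Rightarrow> bool" where
  "weight a b w \<longleftrightarrow>
     integrable (lebesgue_on {a<..<b}) w \<and> (AE x in lebesgue_on {a<..<b}. 0 \<le> w x)"

definition mu :: "real \<Rightarrow> real \<Rightarrow> (real \<Rightarrow> real) \<Rightarrow> real measure" where
  "mu a b w = density (lebesgue_on {a<..<b}) (\<lambda>x. ennreal (w x))"

definition Lp :: "real \<Rightarrow> real \<Rightarrow> real \<Rightarrow> (real \<Rightarrow> real) \<Rightarrow> (real \<Rightarrow> real) set" where
  "Lp a b p w =
     {f. f \<in> borel_measurable (mu a b w) \<and> integrable (mu a b w) (\<lambda>x. \<bar>f x\<bar> powr p)}"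

text \<open>
  The Bochner integral of a non-integrable function is \<open>0\<close>, so this is the norm only on
  \<open>Lp a b p w\<close>.  It is applied to differences of members of \<open>Lp a b p w\<close>, which contains
  all derivatives of test functions because these are bounded and \<open>w\<close> is integrable.
\<close>

definition Lp_norm :: "real \<Rightarrow> real \<Rightarrow> real \<Rightarrow> (real \<Rightarrow> real) \<Rightarrow> (real \<Rightarrow> real) \<Rightarrow> real" where
  "Lp_norm a b p w f = (\<integral>x. \<bar>f x\<bar> powr p \<partial>mu a b w) powr (1 / p)"

definition test_functions :: "(real \<Rightarrow> real) set" where
  "test_functions =
     {\<phi>. (\<forall>n x. ((deriv ^^ n) \<phi>) field_differentiable (at x)) \<and> compact (closure {x. \<phi> x \<noteq> 0})}"


subsection \<open>Critical sets\<close>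

definition ennreal_powr :: "ennreal \<Rightarrow> real \<Rightarrow> ennreal" where
  "ennreal_powr t q = (if t = \<infinity> then \<infinity> else ennreal (enn2real t powr q))"

text \<open>
  Division on \<^typ>\<open>ennreal\<close> satisfies \<open>0 / 0 = 0\<close> and \<open>t / 0 = \<infinity>\<close> for \<open>t > 0\<close>, which is the
  convention required here.  (That \<open>0 powr 0 = 0\<close> affects only the single point \<open>x = x0\<close>.)
\<close>

definition crit_infinite ::
  "real \<Rightarrow> real \<Rightarrow> real \<Rightarrow> (real \<Rightarrow> real) \<Rightarrow> real \<Rightarrow> real \<Rightarrow> real set \<Rightarrow> bool" where
  "crit_infinite a b p w \<alpha> x0 B \<longleftrightarrow>
     (if p = 1 then
        esssup (lebesgue_on ({a..b} \<inter> B))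
          (\<lambda>x. ennreal (\<bar>x - x0\<bar> powr \<alpha>) / ennreal (w x)) = \<infinity>
      else
        (\<integral>\<^sup>+x. ennreal_powr (ennreal (\<bar>x - x0\<bar> powr \<alpha>) / ennreal (w x powr (1 / p))) (p / (p - 1))
           \<partial>lebesgue_on ({a..b} \<inter> B)) = \<infinity>)"

definition crit :: "real \<Rightarrow> real \<Rightarrow> real \<Rightarrow> (real \<Rightarrow> real) \<Rightarrow> real \<Rightarrow> real set" where
  "crit a b p w \<alpha> = {x0 \<in> {a..b}. \<forall>\<epsilon>>0. crit_infinite a b p w \<alpha> x0 (ball x0 \<epsilon>)}"

definition crit_right :: "real \<Rightarrow> real \<Rightarrow> real \<Rightarrow> (real \<Rightarrow> real) \<Rightarrow> real \<Rightarrow> real set" where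
  "crit_right a b p w \<alpha> = {x0 \<in> {a..b}. \<forall>\<epsilon>>0. crit_infinite a b p w \<alpha> x0 {x0<..<x0 + \<epsilon>}}"

definition crit_left :: "real \<Rightarrow> real \<Rightarrow> real \<Rightarrow> (real \<Rightarrow> real) \<Rightarrow> real \<Rightarrow> real set" where
  "crit_left a b p w \<alpha> = {x0 \<in> {a..b}. \<forall>\<epsilon>>0. crit_infinite a b p w \<alpha> x0 {x0 - \<epsilon><..<x0}}"


subsection \<open>Stable weights\<close>

definition nondecreasing_rep_on ::
  "real \<Rightarrow> real \<Rightarrow> (real \<Rightarrow> real) \<Rightarrow> real \<Rightarrow> real set \<Rightarrow> bool" where
  "nondecreasing_rep_on a b w x0 B \<longleftrightarrow>
     (\<exists>w'. (AE x in lebesgue_on {a<..<b}. w' x = w x) \<and>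
           (\<forall>x\<in>B \<inter> {a<..<b}. \<forall>y\<in>B \<inter> {a<..<b}. \<bar>x - x0\<bar> \<le> \<bar>y - x0\<bar> \<longrightarrow> w' x \<le> w' y))"

definition right_stable :: "real \<Rightarrow> real \<Rightarrow> real \<Rightarrow> (real \<Rightarrow> real) \<Rightarrow> real \<Rightarrow> bool" where
  "right_stable a b p w x0 \<longleftrightarrow>
     x0 \<in> crit_right a b p w 0 \<and> (\<exists>r>0. nondecreasing_rep_on a b w x0 {x0<..<x0 + r})"

definition left_stable :: "real \<Rightarrow> real \<Rightarrow> real \<Rightarrow> (real \<Rightarrow> real) \<Rightarrow> real \<Rightarrow> bool" where
  "left_stable a b p w x0 \<longleftrightarrow>
     x0 \<in> crit_left a b p w 0 \<and> (\<exists>r>0. nondecreasing_rep_on a b w x0 {x0 - r<..<x0})"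

definition stable_weight :: "real \<Rightarrow> real \<Rightarrow> real \<Rightarrow> (real \<Rightarrow> real) \<Rightarrow> bool" where
  "stable_weight a b p w \<longleftrightarrow>
     weight a b w \<and>
     (\<forall>x0\<in>crit a b p w 0. right_stable a b p w x0 \<or> left_stable a b p w x0)"


subsection \<open>Weighted Sobolev spaces\<close>

text \<open>
  \<open>is_derivs a b p w m u v\<close>: the family \<open>v 0 = u, v 1, \<dots>, v m\<close> is the \<open>Lp\<close>-limit of the
  derivatives of order \<open>0, \<dots>, m\<close> of a single sequence of test functions.
\<close>

definition is_derivs ::
  "real \<Rightarrow> real \<Rightarrow> real \<Rightarrow> (real \<Rightarrow> real) \<Rightarrow> nat \<Rightarrow> (real \<Rightarrow> real) \<Rightarrow> (nat \<Rightarrow> real \<Rightarrow> real) \<Rightarrow> bool" where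
  "is_derivs a b p w m u v \<longleftrightarrow>
     v 0 = u \<and> (\<forall>k\<le>m. v k \<in> Lp a b p w) \<and>
     (\<exists>\<phi>. (\<forall>h::nat. \<phi> h \<in> test_functions) \<and>
          (\<forall>k\<le>m. (\<lambda>h. Lp_norm a b p w (\<lambda>x. (deriv ^^ k) (\<phi> h) x - v k x)) \<longlonglongrightarrow> 0))"

definition H_space :: "real \<Rightarrow> real \<Rightarrow> real \<Rightarrow> (real \<Rightarrow> real) \<Rightarrow> nat \<Rightarrow> (real \<Rightarrow> real) set" where
  "H_space a b p w m = {u. \<exists>v. is_derivs a b p w m u v}"

text \<open>
  For a stable weight the derivatives are unique up to \<open>mu\<close>-null sets; the choice operator
  picks representatives.
\<close>

definition D_mu ::
  "real \<Rightarrow> real \<Rightarrow> real \<Rightarrow> (real \<Rightarrow> real) \<Rightarrow> nat \<Rightarrow> nat \<Rightarrow> (real \<Rightarrow> real) \<Rightarrow> real \<Rightarrow> real" where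
  "D_mu a b p w m k u = (SOME v. is_derivs a b p w m u v) k"

definition H_norm ::
  "real \<Rightarrow> real \<Rightarrow> real \<Rightarrow> (real \<Rightarrow> real) \<Rightarrow> nat \<Rightarrow> (real \<Rightarrow> real) \<Rightarrow> real" where
  "H_norm a b p w m u = (\<Sum>k\<le>m. Lp_norm a b p w (D_mu a b p w m k u) powr p) powr (1 / p)"


subsection \<open>Traces\<close>

text \<open>
  A continuous extension to \<open>H_space\<close> of the functional \<open>\<phi> \<mapsto> D\<^sup>k \<phi> (c)\<close> on test functions.
  When one exists, density of the test functions determines its values on \<open>H_space\<close>;
  the values elsewhere are arbitrary.
\<close>

definition is_trace ::
  "real \<Rightarrow> real \<Rightarrow> real \<Rightarrow> (real \<Rightarrow> real) \<Rightarrow> nat \<Rightarrow> nat \<Rightarrow> real \<Rightarrow> ((real \<Rightarrow> real) \<Rightarrow> real) \<Rightarrow> bool" where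
  "is_trace a b p w m k c T \<longleftrightarrow>
     (\<forall>\<phi>\<in>test_functions. T \<phi> = (deriv ^^ k) \<phi> c) \<and>
     (\<forall>u\<in>H_space a b p w m. \<forall>f. (\<forall>n::nat. f n \<in> H_space a b p w m) \<longrightarrow>
        (\<lambda>n. H_norm a b p w m (\<lambda>x. f n x - u x)) \<longlonglongrightarrow> 0 \<longrightarrow> (\<lambda>n. T (f n)) \<longlonglongrightarrow> T u)"

definition Tr ::
  "real \<Rightarrow> real \<Rightarrow> real \<Rightarrow> (real \<Rightarrow> real) \<Rightarrow> nat \<Rightarrow> nat \<Rightarrow> (real \<Rightarrow> real) \<Rightarrow> real \<Rightarrow> real" where
  "Tr a b p w m k u c = (SOME T. is_trace a b p w m k c T) u"

definition Delta_k :: "real \<Rightarrow> real \<Rightarrow> real \<Rightarrow> (real \<Rightarrow> real) \<Rightarrow> real \<Rightarrow> enat" where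
  "Delta_k a b p w c =
     (if \<forall>\<alpha>\<ge>0. c \<in> crit a b p w \<alpha> then \<infinity>
      else enat (LEAST d. 1 \<le> d \<and> c \<notin> crit a b p w (real d - 1)))"

definition kbar :: "real \<Rightarrow> real \<Rightarrow> real \<Rightarrow> (real \<Rightarrow> real) \<Rightarrow> nat \<Rightarrow> real \<Rightarrow> int" where
  "kbar a b p w m c =
     (case Delta_k a b p w c of enat d \<Rightarrow> max (int m - int d) (- 1) | \<infinity> \<Rightarrow> - 1)"

definition compatible ::
  "real \<Rightarrow> real \<Rightarrow> real \<Rightarrow> (real \<Rightarrow> real) \<Rightarrow> nat \<Rightarrow> (real \<Rightarrow> real) \<Rightarrow> real \<Rightarrow> (nat \<Rightarrow> real) \<Rightarrow> bool" where
  "compatible a b p w m u c v \<longleftrightarrow>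
     (\<forall>k<m. int k \<le> kbar a b p w m c \<longrightarrow> Tr a b p w m k u c = v k)"

end

theory Submission
  imports Defs
begin

text \<open>
  The condition \<open>D\<^sup>m u\<^sub>\<epsilon> = 0\<close> near an endpoint \<open>c\<close> and the prescribed values \<open>D\<^sup>k u\<^sub>\<epsilon> (c) = v\<^sub>k\<close> are
  imposed on a test function \<open>\<phi>\<close> that is already close to \<open>u\<close>, by adding functions supported near
  \<open>c\<close>.  Such functions are \<open>m\<close>-fold primitives of smooth functions \<open>g\<close> that vanish on the inner side,
  so that \<open>D\<^sup>k (c)\<close> is, up to sign, the moment of \<open>g\<close> of order \<open>m - k - 1\<close> about \<open>c\<close>
  (\<open>endpoint_primitive\<close>).

  Whether the value of \<open>D\<^sup>k\<close> at \<open>c\<close> can be changed at no cost depends on whether \<open>c\<close> is critical of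
  order \<open>m - k - 1\<close>, which by monotonicity of the critical sets in the order is the same as
  \<open>k > kbar\<close> (\<open>le_kbar_iff\<close>).

  If \<open>c\<close> is not critical of this order, Young's inequality bounds the \<open>L\<^sup>1\<close> norm with weight
  \<open>\<bar>x - c\<bar> ^ (m - k - 1)\<close> by the norm of \<open>L\<^sup>p\<close> with weight \<open>w\<close> (\<open>noncritical_bound\<close>), and a Taylor
  expansion averaged over its base point bounds \<open>D\<^sup>k \<phi> (c)\<close> by these norms (\<open>trace_bound\<close>).
  Hence the trace exists, \<open>D\<^sup>k \<phi> (c)\<close> is close to \<open>v\<^sub>k\<close> as soon as \<open>\<phi>\<close> is close to \<open>u\<close>
  (\<open>trace_limit_endpoint\<close>), and the small difference is removed by a small multiple of a fixed
  function.

  If \<open>c\<close> is critical of this order, the extremal functions of Hoelder's inequality, truncated,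
  have moment \<open>1\<close> and arbitrarily small norm, and they are supported arbitrarily close to \<open>c\<close>
  (\<open>critical_concentration\<close>).  They are replaced by smooth functions.  Stability makes the weight
  increase away from \<open>c\<close>, and therefore the norms of the \<open>m\<close>-fold primitive and of its derivatives are
  controlled by the norm of \<open>g\<close> (\<open>weighted_primitive\<close>).  The side effects on the other derivatives at
  \<open>c\<close> are removed by an induction on the order (\<open>small_corrector\<close>).

  To make sense of the norm on the space, the weak derivatives must be unique.  Around a noncritical
  point convergence in the weighted space implies convergence in \<open>L\<^sup>1\<close>, so the limit of the
  derivatives of a null sequence vanishes there.  Next to a critical point, on the side where the
  weight is monotone, the weight is either zero or bounded below.  A set that every one of its points
  sees as null on one side is null (\<open>negligible_one_sided\<close>, \<open>limit_of_derivatives_unique\<close>).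
\<close>

section \<open>Smooth functions on the line\<close>

definition smooth :: "(real \<Rightarrow> real) \<Rightarrow> bool" where
  "smooth f \<longleftrightarrow> (\<forall>n x. ((deriv ^^ n) f) field_differentiable (at x))"

text \<open>
  Iterated derivatives are rarely computable in closed form. It suffices to place the function in a
  class of differentiable functions that is closed under differentiation.
\<close>

lemma smooth_coinduct:
  assumes "f \<in> S"
    and diff: "\<And>f x. f \<in> S \<Longrightarrow> f field_differentiable (at x)"
    and deriv: "\<And>f. f \<in> S \<Longrightarrow> deriv f \<in> S"
  shows "smooth f"
proof -
  have "(deriv ^^ n) f \<in> S" for n
    by (induction n) (auto intro: assms(1) deriv)
  then show ?thesis
    unfolding smooth_def using diff by blast
qed

lemma smooth_DERIV:
  assumes "smooth f"
  shows "((deriv ^^ n) f has_real_derivative (deriv ^^ Suc n) f x) (at x)"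
  using assms unfolding smooth_def by (simp add: DERIV_deriv_iff_field_differentiable)

lemma smooth_DERIV_0:
  assumes "smooth f"
  shows "(f has_real_derivative deriv f x) (at x)"
  using smooth_DERIV[OF assms, of 0] by simp

lemma smooth_iter_deriv:
  assumes "smooth f"
  shows "smooth ((deriv ^^ n) f)"
  using assms unfolding smooth_def by (metis funpow_add comp_apply)

lemma smooth_deriv: "smooth f \<Longrightarrow> smooth (deriv f)"
  using smooth_iter_deriv[of f 1] by simp

lemma smooth_continuous_on: "smooth f \<Longrightarrow> continuous_on S f"
  by (meson smooth_DERIV_0 DERIV_isCont continuous_at_imp_continuous_on)

lemma smooth_if_smooth_derivative:
  assumes "\<And>x. (f has_real_derivative f' x) (at x)" and "smooth f'"
  shows "smooth f"
proof (rule smooth_coinduct[where S = "insert f {g. smooth g}"])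
  show "g field_differentiable at x" if "g \<in> insert f {g. smooth g}" for g x
    using that assms(1) smooth_DERIV_0 by (auto simp: field_differentiable_def)
  have "deriv f = f'"
    using assms(1) by (auto intro!: ext DERIV_imp_deriv)
  then show "deriv g \<in> insert f {g. smooth g}" if "g \<in> insert f {g. smooth g}" for g
    using that assms(2) smooth_deriv by auto
qed auto

lemma smooth_polynomial:
  assumes "real_polynomial_function f"
  shows "smooth f"
proof (rule smooth_coinduct[where S = "Collect real_polynomial_function"])
  fix g :: "real \<Rightarrow> real" and x :: real
  assume "g \<in> Collect real_polynomial_function"
  then obtain g' where g': "real_polynomial_function g'" "\<And>x. (g has_real_derivative g' x) (at x)"
    using has_real_derivative_polynomial_function by blast
  show "g field_differentiable at x"
    using g'(2) by (auto simp: field_differentiable_def)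
  have "deriv g = g'"
    using g'(2) by (auto intro!: ext DERIV_imp_deriv)
  then show "deriv g \<in> Collect real_polynomial_function"
    using g'(1) by simp
qed (use assms in auto)

lemma smooth_const: "smooth (\<lambda>x. c)"
  by (rule smooth_polynomial) (auto intro: real_polynomial_function.intros)

lemma smooth_power_shift: "smooth (\<lambda>x. (x - c) ^ n)"
  by (intro smooth_polynomial real_polynomial_function_power real_polynomial_function_diff
      real_polynomial_function.intros bounded_linear_ident)

text \<open>
  The products of smooth functions do not form a class that is closed under differentiation,
  but their finite sums do.
\<close>

inductive_set sums_of_products :: "(real \<Rightarrow> real) set" where
  product: "smooth f \<Longrightarrow> smooth g \<Longrightarrow> (\<lambda>x. f x * g x) \<in> sums_of_products"
| sum: "f \<in> sums_of_products \<Longrightarrow> g \<in> sums_of_products \<Longrightarrow> (\<lambda>x. f x + g x) \<in> sums_of_products"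

lemma sums_of_products_deriv:
  assumes "h \<in> sums_of_products"
  shows "\<exists>h' \<in> sums_of_products. \<forall>x. (h has_real_derivative h' x) (at x)"
  using assms
proof induction
  case (product f g)
  have der: "\<forall>x. ((\<lambda>x. f x * g x) has_real_derivative deriv f x * g x + f x * deriv g x) (at x)"
    using product by (auto intro!: derivative_eq_intros smooth_DERIV_0)
  have mem: "(\<lambda>x. deriv f x * g x + f x * deriv g x) \<in> sums_of_products"
    by (rule sums_of_products.sum; rule sums_of_products.product) (use product smooth_deriv in auto)
  show ?case
    by (rule bexI[OF _ mem]) (rule der)
next
  case (sum f g)
  then obtain f' g' where "f' \<in> sums_of_products" "g' \<in> sums_of_products"
    "\<And>x. (f has_real_derivative f' x) (at x)" "\<And>x. (g has_real_derivative g' x) (at x)"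
    by blast
  then show ?case
    by (intro bexI[OF _ sums_of_products.sum[of f' g']] allI DERIV_add)
qed

lemma smooth_sums_of_products:
  assumes "h \<in> sums_of_products"
  shows "smooth h"
proof (rule smooth_coinduct[OF assms])
  fix g x assume "g \<in> sums_of_products"
  from sums_of_products_deriv[OF this] obtain g' where
    g': "g' \<in> sums_of_products" "\<And>x. (g has_real_derivative g' x) (at x)"
    by blast
  show "g field_differentiable at x"
    using g'(2) by (auto simp: field_differentiable_def)
  have "deriv g = g'"
    using g'(2) by (auto intro!: ext DERIV_imp_deriv)
  then show "deriv g \<in> sums_of_products"
    using g'(1) by simp
qed

lemma smooth_mult: "smooth f \<Longrightarrow> smooth g \<Longrightarrow> smooth (\<lambda>x. f x * g x)"
  by (rule smooth_sums_of_products[OF sums_of_products.product])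

lemma smooth_add:
  assumes "smooth f" "smooth g"
  shows "smooth (\<lambda>x. f x + g x)"
proof -
  have "(\<lambda>x. 1 * f x + 1 * g x) \<in> sums_of_products"
    by (intro sums_of_products.sum sums_of_products.product assms smooth_const)
  then show ?thesis
    using smooth_sums_of_products by simp
qed

lemma smooth_cmult: "smooth f \<Longrightarrow> smooth (\<lambda>x. c * f x)"
  by (intro smooth_mult smooth_const)

lemma smooth_diff: "smooth f \<Longrightarrow> smooth g \<Longrightarrow> smooth (\<lambda>x. f x - g x)"
  using smooth_add[of f "\<lambda>x. (- 1) * g x"] smooth_cmult[of g "- 1"] by simp

lemma smooth_sum: "(\<And>i. i \<in> A \<Longrightarrow> smooth (f i)) \<Longrightarrow> smooth (\<lambda>x. \<Sum>i\<in>A. f i x)"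
  by (induction A rule: infinite_finite_induct) (auto intro: smooth_const smooth_add)

lemma deriv_iter_add:
  assumes "smooth f" "smooth g"
  shows "(deriv ^^ n) (\<lambda>x. f x + g x) = (\<lambda>x. (deriv ^^ n) f x + (deriv ^^ n) g x)"
proof (induction n)
  case (Suc n)
  have "((\<lambda>x. (deriv ^^ n) f x + (deriv ^^ n) g x) has_real_derivative
      (deriv ^^ Suc n) f x + (deriv ^^ Suc n) g x) (at x)" for x
    by (intro DERIV_add smooth_DERIV assms)
  then show ?case
    using Suc.IH by (auto intro!: ext DERIV_imp_deriv)
qed simp

lemma deriv_iter_cmult:
  assumes "smooth f"
  shows "(deriv ^^ n) (\<lambda>x. c * f x) = (\<lambda>x. c * (deriv ^^ n) f x)"
proof (induction n)
  case (Suc n)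
  have "((\<lambda>x. c * (deriv ^^ n) f x) has_real_derivative c * (deriv ^^ Suc n) f x) (at x)" for x
    by (intro DERIV_cmult smooth_DERIV assms)
  then show ?case
    using Suc.IH by (auto intro!: ext DERIV_imp_deriv)
qed simp

lemma deriv_iter_diff:
  assumes "smooth f" "smooth g"
  shows "(deriv ^^ n) (\<lambda>x. f x - g x) = (\<lambda>x. (deriv ^^ n) f x - (deriv ^^ n) g x)"
  using deriv_iter_add[OF assms(1) smooth_cmult[OF assms(2), of "- 1"], of n]
    deriv_iter_cmult[OF assms(2), of n "- 1"] by simp

lemma deriv_iter_const: "(deriv ^^ n) (\<lambda>x. c) = (\<lambda>x. if n = 0 then c else 0)"
  by (induction n) auto

lemma deriv_iter_sum:
  assumes "\<And>i. i \<in> A \<Longrightarrow> smooth (f i)"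
  shows "(deriv ^^ n) (\<lambda>x. \<Sum>i\<in>A. f i x) = (\<lambda>x. \<Sum>i\<in>A. (deriv ^^ n) (f i) x)"
  using assms
proof (induction A rule: infinite_finite_induct)
  case (insert i A)
  then show ?case
    by (simp add: deriv_iter_add smooth_sum)
qed (auto simp: deriv_iter_const)

lemma deriv_iter_reflect:
  assumes "smooth f"
  shows "(deriv ^^ n) (\<lambda>x. f (- x)) = (\<lambda>x. (- 1) ^ n * (deriv ^^ n) f (- x))"
proof (induction n)
  case (Suc n)
  have "((\<lambda>x. (deriv ^^ n) f (- x)) has_real_derivative - (deriv ^^ Suc n) f (- x)) (at x)" for x
    using DERIV_mirror[of "(deriv ^^ n) f" "(deriv ^^ Suc n) f (- x)" x] smooth_DERIV[OF assms, of n "- x"]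
    by simp
  then have "((\<lambda>x. (- 1) ^ n * (deriv ^^ n) f (- x)) has_real_derivative
      (- 1) ^ n * - (deriv ^^ Suc n) f (- x)) (at x)" for x
    by (intro DERIV_cmult)
  then show ?case
    using Suc.IH by (auto intro!: ext DERIV_imp_deriv)
qed simp

lemma smooth_reflect:
  assumes "smooth f"
  shows "smooth (\<lambda>x. f (- x))"
proof (rule smooth_coinduct[where S = "{\<lambda>x. c * g (- x) | c g. smooth g}"])
  show "(\<lambda>x. f (- x)) \<in> {\<lambda>x. c * g (- x) | c g. smooth g}"
    using assms by (auto intro!: exI[of _ 1])
  fix h :: "real \<Rightarrow> real" and x :: real
  assume "h \<in> {\<lambda>x. c * g (- x) | c g. smooth g}"
  then obtain c g where g: "smooth g" and h: "h = (\<lambda>x. c * g (- x))"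
    by auto
  have *: "(h has_real_derivative - c * deriv g (- x)) (at x)" for x
    unfolding h using DERIV_cmult[OF DERIV_mirror[THEN iffD1, OF smooth_DERIV_0[OF g, of "- x"]], of c]
    by simp
  then show "h field_differentiable at x"
    by (auto simp: field_differentiable_def)
  have "deriv h = (\<lambda>x. - c * deriv g (- x))"
    using * by (auto intro!: ext DERIV_imp_deriv)
  then show "deriv h \<in> {\<lambda>x. c * g (- x) | c g. smooth g}"
    using smooth_deriv[OF g] by blast
qed

text \<open>
  A product with a cutoff is locally equal to its other factor or to zero, except in the transition
  region, where its derivatives are never computed. This lemma therefore replaces the product rule for
  higher derivatives.
\<close>

lemma deriv_iter_cong_open:
  assumes "open S" and "\<And>x. x \<in> S \<Longrightarrow> f x = g x" and "x \<in> S"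
  shows "(deriv ^^ n) f x = (deriv ^^ n) g x"
  using assms(3)
proof (induction n arbitrary: x)
  case (Suc n)
  have "eventually (\<lambda>y. (deriv ^^ n) f y = (deriv ^^ n) g y) (nhds x)"
    using Suc assms(1) by (auto simp: eventually_nhds)
  then show ?case
    by (simp add: deriv_cong_ev)
qed (simp add: assms)

lemma deriv_iter_power_shift:
  "(deriv ^^ n) (\<lambda>x. (x - c) ^ k / fact k) = (\<lambda>x. if n \<le> k then (x - c) ^ (k - n) / fact (k - n) else (0::real))"
proof (induction n)
  case (Suc n)
  show ?case
  proof (cases "n < k")
    case True
    then obtain d where d: "k - n = Suc d" "k - Suc n = d"
      by (metis Suc_diff_Suc)
    have "((\<lambda>x. (x - c) ^ Suc d / fact (Suc d)) has_real_derivative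
        (real (Suc d) * (x - c) ^ d) / fact (Suc d)) (at x)" for x :: real
      using DERIV_power[OF DERIV_diff[OF DERIV_ident DERIV_const[of c]], of "Suc d" x]
      by (intro DERIV_cdivide) simp
    then have "((\<lambda>x. (x - c) ^ Suc d / fact (Suc d)) has_real_derivative (x - c) ^ d / fact d) (at x)" for x :: real
      by (simp del: of_nat_Suc power_Suc)
    then have "deriv (\<lambda>x. (x - c) ^ Suc d / fact (Suc d)) = (\<lambda>x::real. (x - c) ^ d / fact d)"
      by (auto intro!: ext DERIV_imp_deriv)
    with True d show ?thesis
      by (simp add: Suc.IH)
  next
    case False
    then have "(deriv ^^ n) (\<lambda>x. (x - c) ^ k / fact k) = (\<lambda>x. if n = k then 1 else 0)"
      using Suc.IH by auto
    with False show ?thesis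
      by (auto simp: deriv_iter_const)
  qed
qed simp

section \<open>Cutoff functions\<close>

text \<open>
  For the constant polynomial \<open>1\<close> this is the function \<open>exp (- 1 / x)\<close>, flat at \<open>0\<close>. The polynomial factors make
  the family closed under differentiation.
\<close>

definition flat :: "real poly \<Rightarrow> real \<Rightarrow> real" where
  "flat q x = (if 0 < x then poly q (1 / x) * exp (- 1 / x) else 0)"

lemma poly_times_exp_tendsto_0:
  "((\<lambda>y. poly q y * exp (- y)) \<longlongrightarrow> 0) (at_top :: real filter)"
proof -
  have "((\<lambda>y. \<Sum>i\<le>degree q. coeff q i * (y ^ i / exp y)) \<longlongrightarrow> (\<Sum>i\<le>degree q. coeff q i * 0)) (at_top :: real filter)"
    by (intro tendsto_intros tendsto_power_div_exp_0)
  then show ?thesis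
    by (simp add: poly_altdef sum_distrib_right exp_minus divide_inverse mult.assoc)
qed

lemma flat_DERIV:
  "(flat q has_real_derivative flat ([:0, 0, 1:] * (q - pderiv q)) x) (at x)"
proof (cases x "0 :: real" rule: linorder_cases)
  case less
  have "((\<lambda>x. 0) has_real_derivative 0) (at x)"
    by simp
  then have "(flat q has_real_derivative 0) (at x)"
    by (rule has_field_derivative_transform_within_open[where S = "{..<0}"])
      (use less in \<open>auto simp: flat_def\<close>)
  then show ?thesis
    using less by (simp add: flat_def)
next
  case greater
  have "((\<lambda>x. poly q (1 / x) * exp (- 1 / x)) has_real_derivative
      poly (pderiv q) (1 / x) * (- 1 / x\<^sup>2) * exp (- 1 / x) + poly q (1 / x) * (exp (- 1 / x) * (1 / x\<^sup>2))) (at x)"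
    by (rule derivative_eq_intros DERIV_chain2[OF poly_DERIV] refl | use greater in \<open>simp add: field_simps power2_eq_square\<close>)+
  moreover have "poly (pderiv q) (1 / x) * (- 1 / x\<^sup>2) * exp (- 1 / x) + poly q (1 / x) * (exp (- 1 / x) * (1 / x\<^sup>2))
      = flat ([:0, 0, 1:] * (q - pderiv q)) x"
    using greater by (simp add: flat_def field_simps power2_eq_square)
  ultimately have "((\<lambda>x. poly q (1 / x) * exp (- 1 / x)) has_real_derivative flat ([:0, 0, 1:] * (q - pderiv q)) x) (at x)"
    by simp
  then show ?thesis
    by (rule has_field_derivative_transform_within_open[where S = "{0<..}"])
      (use greater in \<open>auto simp: flat_def\<close>)
next
  case equal
  have "((\<lambda>y. poly (pCons 0 q) (inverse y) * exp (- inverse y)) \<longlongrightarrow> 0) (at_right (0::real))"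
    by (rule filterlim_compose[OF poly_times_exp_tendsto_0 filterlim_inverse_at_top_right])
  then have right: "((\<lambda>y. (flat q y - flat q 0) / (y - 0)) \<longlongrightarrow> 0) (at_right (0::real))"
    by (rule tendsto_cong[THEN iffD1, rotated])
      (auto simp: eventually_at_filter flat_def field_simps)
  have left: "((\<lambda>y. (flat q y - flat q 0) / (y - 0)) \<longlongrightarrow> 0) (at_left (0::real))"
    by (rule tendsto_eventually) (auto simp: eventually_at_filter flat_def)
  have "(flat q has_real_derivative 0) (at 0)"
    unfolding has_field_derivative_iff using left right by (rule filterlim_split_at)
  then show ?thesis
    using equal by (simp add: flat_def)
qed

lemma smooth_flat: "smooth (flat q)"
proof (rule smooth_coinduct[where S = "range flat"])
  show "f field_differentiable at x" if "f \<in> range flat" for f x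
    using that flat_DERIV by (auto simp: field_differentiable_def)
  have "deriv (flat q) = flat ([:0, 0, 1:] * (q - pderiv q))" for q
    using flat_DERIV by (auto intro!: ext DERIV_imp_deriv)
  then show "deriv f \<in> range flat" if "f \<in> range flat" for f
    using that by auto
qed auto

lemma smooth_shift:
  assumes "smooth f"
  shows "smooth (\<lambda>x. f (x + c))"
proof (rule smooth_coinduct[where S = "{\<lambda>x. g (x + c) | g. smooth g}"])
  show "(\<lambda>x. f (x + c)) \<in> {\<lambda>x. g (x + c) | g. smooth g}"
    using assms by auto
  fix h :: "real \<Rightarrow> real" and x :: real
  assume "h \<in> {\<lambda>x. g (x + c) | g. smooth g}"
  then obtain g where g: "smooth g" and h: "h = (\<lambda>x. g (x + c))"
    by auto
  have *: "(h has_real_derivative deriv g (x + c)) (at x)" for x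
    unfolding h using smooth_DERIV_0[OF g, of "x + c"] DERIV_shift by blast
  then show "h field_differentiable at x"
    by (auto simp: field_differentiable_def)
  have "deriv h = (\<lambda>x. deriv g (x + c))"
    using * by (auto intro!: ext DERIV_imp_deriv)
  then show "deriv h \<in> {\<lambda>x. g (x + c) | g. smooth g}"
    using smooth_deriv[OF g] by blast
qed

lemma antiderivative_exists:
  assumes "continuous_on UNIV (f :: real \<Rightarrow> real)"
  obtains F where "\<And>x. (F has_real_derivative f x) (at x)"
proof -
  have "\<exists>F. \<forall>x::real. - \<infinity> < ereal x \<longrightarrow> ereal x < \<infinity> \<longrightarrow> (F has_vector_derivative f x) (at x)"
    using assms by (intro einterval_antiderivative) (auto simp: continuous_on_eq_continuous_at)
  then show ?thesis
    using that by (auto simp: has_real_derivative_iff_has_vector_derivative)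
qed

text \<open>
  The product of two flat functions, one at each end of an interval, is a bump; its normalised
  primitive is a smooth step.
\<close>

lemma smooth_step_exists:
  assumes "c < (d :: real)"
  obtains s where "smooth s" "\<And>x. x \<le> c \<Longrightarrow> s x = 1" "\<And>x. d \<le> x \<Longrightarrow> s x = 0"
    "\<And>x. 0 \<le> s x" "\<And>x. s x \<le> 1"
proof -
  define B where "B = (\<lambda>x. flat 1 (x + (- c)) * flat 1 (- x + d))"
  have smB: "smooth B"
    unfolding B_def by (intro smooth_mult smooth_shift smooth_reflect[OF smooth_shift] smooth_flat)
  have B0: "B x = 0" if "x \<le> c \<or> d \<le> x" for x
    using that by (auto simp: B_def flat_def)
  have Bpos: "0 < B x" if "c < x" "x < d" for x
    using that by (simp add: B_def flat_def)
  have Bnn: "0 \<le> B x" for x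
    by (simp add: B_def flat_def)
  obtain F where F: "\<And>x. (F has_real_derivative B x) (at x)"
    using antiderivative_exists smooth_continuous_on[OF smB] by metis
  have mono: "F x \<le> F y" if "x \<le> y" for x y
    using DERIV_nonneg_imp_nondecreasing[OF that, of F] F Bnn by blast
  have left: "F x = F c" if "x \<le> c" for x
    using that F B0 DERIV_nonpos_imp_nonincreasing[OF that, of F] mono[OF that] by force
  have right: "F x = F d" if "d \<le> x" for x
    using that F B0 DERIV_nonpos_imp_nonincreasing[OF that, of F] mono[OF that] by force
  have less: "F c < F d"
  proof (rule DERIV_pos_imp_increasing_open[OF assms])
    show "\<exists>y. (F has_real_derivative y) (at x) \<and> 0 < y" if "c < x" "x < d" for x
      using F Bpos that by blast
    show "continuous_on {c..d} F"
      using F by (meson DERIV_isCont continuous_at_imp_continuous_on)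
  qed
  show ?thesis
  proof
    have "smooth F"
      using F smB by (rule smooth_if_smooth_derivative)
    then show "smooth (\<lambda>x. (1 / (F d - F c)) * (F d - F x))"
      by (intro smooth_cmult smooth_diff smooth_const)
    fix x
    show "(1 / (F d - F c)) * (F d - F x) = 1" if "x \<le> c"
      using less left[OF that] by simp
    show "(1 / (F d - F c)) * (F d - F x) = 0" if "d \<le> x"
      using right[OF that] by simp
    have "F c \<le> F x" "F x \<le> F d"
      using mono left right by (metis linear)+
    then show "0 \<le> (1 / (F d - F c)) * (F d - F x)" "(1 / (F d - F c)) * (F d - F x) \<le> 1"
      using less by (simp_all add: divide_simps)
  qed
qed

lemma test_functions_iff:
  "\<phi> \<in> test_functions \<longleftrightarrow> smooth \<phi> \<and> (\<exists>B. \<forall>x. B < \<bar>x\<bar> \<longrightarrow> \<phi> x = 0)"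
proof -
  have "compact (closure {x. \<phi> x \<noteq> 0}) \<longleftrightarrow> (\<exists>B. \<forall>x. B < \<bar>x\<bar> \<longrightarrow> \<phi> x = 0)"
    by (auto simp: compact_closure bounded_iff not_less[symmetric])
  then show ?thesis
    by (simp add: test_functions_def smooth_def)
qed

lemma test_smooth: "\<phi> \<in> test_functions \<Longrightarrow> smooth \<phi>"
  by (simp add: test_functions_iff)

lemma test_mult:
  assumes "smooth f" "g \<in> test_functions"
  shows "(\<lambda>x. f x * g x) \<in> test_functions"
  using assms by (force simp: test_functions_iff intro: smooth_mult)

lemma test_cmult: "g \<in> test_functions \<Longrightarrow> (\<lambda>x. c * g x) \<in> test_functions"
  by (intro test_mult smooth_const)

lemma test_zero: "(\<lambda>x. 0) \<in> test_functions"
  by (simp add: test_functions_iff smooth_const)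

lemma test_add:
  assumes "f \<in> test_functions" "g \<in> test_functions"
  shows "(\<lambda>x. f x + g x) \<in> test_functions"
proof -
  from assms obtain A B where "smooth f" "smooth g"
    "\<And>x. A < \<bar>x\<bar> \<Longrightarrow> f x = 0" "\<And>x. B < \<bar>x\<bar> \<Longrightarrow> g x = 0"
    unfolding test_functions_iff by blast
  then show ?thesis
    by (auto simp: test_functions_iff intro!: smooth_add exI[of _ "max A B"])
qed

lemma test_diff:
  assumes "f \<in> test_functions" "g \<in> test_functions"
  shows "(\<lambda>x. f x - g x) \<in> test_functions"
  using test_add[OF assms(1) test_cmult[OF assms(2), of "- 1"]] by simp

lemma test_sum: "(\<And>i. i \<in> A \<Longrightarrow> f i \<in> test_functions) \<Longrightarrow> (\<lambda>x. \<Sum>i\<in>A. f i x) \<in> test_functions"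
  by (induction A rule: infinite_finite_induct) (auto intro: test_zero test_add)

lemma test_reflect:
  assumes "f \<in> test_functions"
  shows "(\<lambda>x. f (- x)) \<in> test_functions"
proof -
  from assms obtain A where "smooth f" "\<And>x. A < \<bar>x\<bar> \<Longrightarrow> f x = 0"
    unfolding test_functions_iff by blast
  then show ?thesis
    by (auto simp: test_functions_iff intro!: smooth_reflect exI[of _ A])
qed

lemma cutoff_exists:
  assumes "r < (R :: real)"
  obtains \<kappa> where "\<kappa> \<in> test_functions" "\<And>x. \<bar>x - c\<bar> \<le> r \<Longrightarrow> \<kappa> x = 1"
    "\<And>x. R \<le> \<bar>x - c\<bar> \<Longrightarrow> \<kappa> x = 0" "\<And>x. 0 \<le> \<kappa> x" "\<And>x. \<kappa> x \<le> 1"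
proof -
  obtain s where s: "smooth s" "\<And>x. x \<le> r \<Longrightarrow> s x = 1" "\<And>x. R \<le> x \<Longrightarrow> s x = 0"
    "\<And>x. 0 \<le> s x" "\<And>x. s x \<le> 1"
    using smooth_step_exists[OF assms] by metis
  define \<kappa> where "\<kappa> = (\<lambda>x. s (x + (- c)) * s (- x + c))"
  show ?thesis
  proof
    have zero: "\<kappa> x = 0" if "R \<le> \<bar>x - c\<bar>" for x
      using that s(3)[of "x - c"] s(3)[of "c - x"] by (auto simp: \<kappa>_def abs_if split: if_splits)
    have "smooth \<kappa>"
      unfolding \<kappa>_def by (intro smooth_mult smooth_shift smooth_reflect[OF smooth_shift] s)
    moreover have "\<forall>x. \<bar>R\<bar> + \<bar>c\<bar> < \<bar>x\<bar> \<longrightarrow> \<kappa> x = 0"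
      using zero by auto
    ultimately show "\<kappa> \<in> test_functions"
      unfolding test_functions_iff by blast
    fix x
    show "\<kappa> x = 0" if "R \<le> \<bar>x - c\<bar>"
      using that by (rule zero)
    show "\<kappa> x = 1" if "\<bar>x - c\<bar> \<le> r"
      using that s(2) by (simp add: \<kappa>_def)
    show "0 \<le> \<kappa> x" "\<kappa> x \<le> 1"
      using s(4,5) by (auto simp: \<kappa>_def intro!: mult_nonneg_nonneg mult_le_one)
  qed
qed

section \<open>Taylor expansions at the endpoints\<close>

lemma taylor_integral:
  assumes "smooth f" "y \<le> x" "k < m"
  shows "((\<lambda>t. (x - t) ^ (m - k - 1) / fact (m - k - 1) * (deriv ^^ m) f t) has_integral
    (deriv ^^ k) f x - (\<Sum>i<m - k. (x - y) ^ i / fact i * (deriv ^^ (k + i)) f y)) {y..x}"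
proof -
  have "((deriv ^^ (k + j)) f has_vector_derivative (deriv ^^ (k + Suc j)) f t) (at t within {y..x})" for j t
    using smooth_DERIV[OF assms(1), of "k + j" t]
    by (auto simp: has_real_derivative_iff_has_vector_derivative intro: has_vector_derivative_at_within)
  from Taylor_has_integral[of "m - k" "\<lambda>j. (deriv ^^ (k + j)) f" "(deriv ^^ k) f" y x, OF _ _ this assms(2)]
  show ?thesis
    using assms(3) by simp
qed

text \<open>
  Each primitive is the one that starts from \<open>0\<close> at \<open>d\<close>, so that all primitives inherit the vanishing
  of \<open>g\<close> to the left of \<open>d\<close>.
\<close>

lemma iterated_primitive:
  assumes "smooth g" "\<And>x. x \<le> d \<Longrightarrow> g x = 0"
  shows "\<exists>\<zeta>. smooth \<zeta> \<and> (deriv ^^ m) \<zeta> = g \<and> (\<forall>k. \<forall>x\<le>d. (deriv ^^ k) \<zeta> x = 0)"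
proof (induction m)
  case 0
  have "(deriv ^^ k) g x = 0" if "x \<le> d" for k x
  proof -
    have "(deriv ^^ k) g y = 0" if "y < d" for y
      using deriv_iter_cong_open[of "{..<d}" g "\<lambda>_. 0" y k] that assms(2)
      by (simp add: deriv_iter_const split: if_splits)
    moreover have "isCont ((deriv ^^ k) g) d"
      using smooth_DERIV[OF assms(1)] DERIV_isCont by blast
    then have "((deriv ^^ k) g \<longlongrightarrow> (deriv ^^ k) g d) (at_left d)"
      by (simp add: isCont_def filterlim_at_split)
    moreover have "((deriv ^^ k) g \<longlongrightarrow> 0) (at_left d)"
      by (rule tendsto_eventually) (auto simp: eventually_at_filter calculation(1))
    ultimately show ?thesis
      using that tendsto_unique[OF trivial_limit_at_left_real] by (metis less_eq_real_def)
  qed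
  then show ?case
    using assms(1) by auto
next
  case (Suc m)
  then obtain \<zeta> where \<zeta>: "smooth \<zeta>" "(deriv ^^ m) \<zeta> = g" "\<And>k x. x \<le> d \<Longrightarrow> (deriv ^^ k) \<zeta> x = 0"
    by auto
  obtain F where F: "\<And>x. (F has_real_derivative \<zeta> x) (at x)"
    using antiderivative_exists smooth_continuous_on[OF \<zeta>(1)] by metis
  define G where "G = (\<lambda>x. F x - F d)"
  have G: "(G has_real_derivative \<zeta> x) (at x)" for x
    unfolding G_def using F by (auto intro!: derivative_eq_intros)
  then have dG: "deriv G = \<zeta>"
    by (auto intro!: ext DERIV_imp_deriv)
  have iter: "(deriv ^^ Suc k) G = (deriv ^^ k) \<zeta>" for k
    by (simp only: funpow_Suc_right comp_apply dG)
  have "G x = 0" if "x \<le> d" for x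
    using DERIV_nonpos_imp_nonincreasing[OF that, of F] DERIV_nonneg_imp_nondecreasing[OF that, of F]
      F \<zeta>(3)[of _ 0] unfolding G_def by force
  then have "(deriv ^^ k) G x = 0" if "x \<le> d" for k x
    using that \<zeta>(3) iter by (cases k) auto
  moreover have "smooth G"
    using G \<zeta>(1) by (rule smooth_if_smooth_derivative)
  ultimately show ?case
    using iter[of m] \<zeta>(2) by auto
qed

text \<open>
  Used when \<open>c\<close> is an endpoint of the interval \<open>S\<close> and \<open>x\<close> is in \<open>S\<close>; this is then the interval from \<open>x\<close>
  to the other endpoint of \<open>S\<close>, and one statement covers both endpoints.
\<close>

definition beyond :: "real \<Rightarrow> real \<Rightarrow> real set \<Rightarrow> real set" where
  "beyond c x S = {t \<in> S. \<bar>x - c\<bar> \<le> \<bar>t - c\<bar>}"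

text \<open>
  The primitives start from the inner side of the support of \<open>g\<close>, where they vanish, so Taylor's formula
  reduces to its remainder. To the right of \<open>b\<close> the result is not compactly supported, and it is cut
  off outside \<open>{a..b}\<close>.
\<close>

lemma endpoint_primitive_right:
  fixes a b :: real
  assumes "a < b" "\<rho> \<le> b - a" "smooth g" "\<And>x. \<rho> \<le> \<bar>x - b\<bar> \<Longrightarrow> g x = 0"
  obtains \<zeta> where "\<zeta> \<in> test_functions"
    and "\<And>x. x \<in> {a..b} \<Longrightarrow> (deriv ^^ m) \<zeta> x = g x"
    and "\<And>k x. x \<in> {a..b} \<Longrightarrow> \<rho> \<le> \<bar>x - b\<bar> \<Longrightarrow> (deriv ^^ k) \<zeta> x = 0"
    and "\<And>k x. k < m \<Longrightarrow> x \<in> {a..b} \<Longrightarrow>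
      ((\<lambda>t. \<bar>t - x\<bar> ^ (m - k - 1) / fact (m - k - 1) * g t) has_integral (deriv ^^ k) \<zeta> x) (beyond b x {a..b})"
proof -
  have g0: "g x = 0" if "x \<le> b - \<rho>" for x
    using assms(4)[of x] that by simp
  obtain G where G: "smooth G" "(deriv ^^ m) G = g" "\<And>k x. x \<le> b - \<rho> \<Longrightarrow> (deriv ^^ k) G x = 0"
    using iterated_primitive[OF assms(3) g0] by blast
  obtain \<kappa> where \<kappa>: "\<kappa> \<in> test_functions" "\<And>x. \<bar>x - a\<bar> \<le> b - a + 1 \<Longrightarrow> \<kappa> x = 1"
    by (rule cutoff_exists[of "b - a + 1" "b - a + 2" a]) auto
  define \<zeta> where "\<zeta> = (\<lambda>x. G x * \<kappa> x)"
  have eq: "(deriv ^^ k) \<zeta> x = (deriv ^^ k) G x" if "x \<in> {a..b}" for k x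
    by (rule deriv_iter_cong_open[where S = "{a - 1<..<b + 1}"])
      (use that \<kappa>(2) in \<open>auto simp: \<zeta>_def abs_le_iff\<close>)
  show thesis
  proof
    show "\<zeta> \<in> test_functions"
      unfolding \<zeta>_def using G(1) \<kappa>(1) by (rule test_mult)
    show "(deriv ^^ m) \<zeta> x = g x" if "x \<in> {a..b}" for x
      using eq[OF that] G(2) by simp
    show "(deriv ^^ k) \<zeta> x = 0" if "x \<in> {a..b}" "\<rho> \<le> \<bar>x - b\<bar>" for k x
      using eq[OF that(1)] G(3) that by simp
    fix k x
    assume k: "k < m" and x: "x \<in> {a..b}"
    have "((\<lambda>t. (x - t) ^ (m - k - 1) / fact (m - k - 1) * g t) has_integral (deriv ^^ k) G x) {a..x}"
      using taylor_integral[OF G(1) _ k, of a x] x G(2,3) assms(2) by simp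
    moreover have "beyond b x {a..b} = {a..x}"
      using x by (auto simp: beyond_def)
    ultimately show "((\<lambda>t. \<bar>t - x\<bar> ^ (m - k - 1) / fact (m - k - 1) * g t) has_integral (deriv ^^ k) \<zeta> x) (beyond b x {a..b})"
      unfolding eq[OF x] by (auto intro: has_integral_eq[rotated] simp: abs_minus_commute)
  qed
qed

text \<open>
  The left endpoint is reflected to the right one. The reflection multiplies the derivatives by
  signs, which accounts for \<open>s\<close>.
\<close>

lemma endpoint_primitive:
  fixes a b :: real
  assumes "a < b" "c = a \<or> c = b" "\<rho> \<le> b - a" "smooth g" "\<And>x. \<rho> \<le> \<bar>x - c\<bar> \<Longrightarrow> g x = 0"
  obtains \<zeta> where "\<zeta> \<in> test_functions"
    and "\<And>x. x \<in> {a..b} \<Longrightarrow> (deriv ^^ m) \<zeta> x = g x"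
    and "\<And>k x. x \<in> {a..b} \<Longrightarrow> \<rho> \<le> \<bar>x - c\<bar> \<Longrightarrow> (deriv ^^ k) \<zeta> x = 0"
    and "\<And>k x. k < m \<Longrightarrow> x \<in> {a..b} \<Longrightarrow> \<exists>s\<in>{1, -1}.
      ((\<lambda>t. \<bar>t - x\<bar> ^ (m - k - 1) / fact (m - k - 1) * g t) has_integral s * (deriv ^^ k) \<zeta> x) (beyond c x {a..b})"
proof (cases "c = b")
  case True
  have g0: "g x = 0" if "\<rho> \<le> \<bar>x - b\<bar>" for x
    using assms(5) True that by simp
  show thesis
  proof (rule endpoint_primitive_right[OF assms(1,3,4) g0])
    fix \<zeta>
    assume \<zeta>: "\<zeta> \<in> test_functions" "\<And>x. x \<in> {a..b} \<Longrightarrow> (deriv ^^ m) \<zeta> x = g x"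
      "\<And>k x. x \<in> {a..b} \<Longrightarrow> \<rho> \<le> \<bar>x - b\<bar> \<Longrightarrow> (deriv ^^ k) \<zeta> x = 0"
      "\<And>k x. k < m \<Longrightarrow> x \<in> {a..b} \<Longrightarrow>
        ((\<lambda>t. \<bar>t - x\<bar> ^ (m - k - 1) / fact (m - k - 1) * g t) has_integral (deriv ^^ k) \<zeta> x) (beyond b x {a..b})"
    show thesis
    proof (rule that[OF \<zeta>(1,2)])
      show "(deriv ^^ k) \<zeta> x = 0" if "x \<in> {a..b}" "\<rho> \<le> \<bar>x - c\<bar>" for k x
        using \<zeta>(3) that True by simp
      show "\<exists>s\<in>{1, -1}. ((\<lambda>t. \<bar>t - x\<bar> ^ (m - k - 1) / fact (m - k - 1) * g t)
          has_integral s * (deriv ^^ k) \<zeta> x) (beyond c x {a..b})" if "k < m" "x \<in> {a..b}" for k x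
        using \<zeta>(4)[OF that] True by (intro bexI[of _ 1]) auto
    qed
  qed
next
  case False
  then have c: "c = a"
    using assms(2) by blast
  have g0: "g (- x) = 0" if "\<rho> \<le> \<bar>x - (- a)\<bar>" for x
    using assms(5)[of "- x"] that c by (simp add: abs_minus_commute algebra_simps)
  obtain \<zeta> where \<zeta>: "\<zeta> \<in> test_functions"
    "\<And>x. x \<in> {-b..-a} \<Longrightarrow> (deriv ^^ m) \<zeta> x = g (- x)"
    "\<And>k x. x \<in> {-b..-a} \<Longrightarrow> \<rho> \<le> \<bar>x - (- a)\<bar> \<Longrightarrow> (deriv ^^ k) \<zeta> x = 0"
    "\<And>k x. k < m \<Longrightarrow> x \<in> {-b..-a} \<Longrightarrow>
      ((\<lambda>t. \<bar>t - x\<bar> ^ (m - k - 1) / fact (m - k - 1) * g (- t)) has_integral (deriv ^^ k) \<zeta> x) (beyond (- a) x {-b..-a})"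
    by (rule endpoint_primitive_right[of "- b" "- a" \<rho> "\<lambda>x. g (- x)" m])
      (use assms(1,3) smooth_reflect[OF assms(4)] g0 in auto)
  define \<eta> where "\<eta> = (\<lambda>x. (- 1) ^ m * \<zeta> (- x))"
  have eq: "(deriv ^^ k) \<eta> x = (- 1) ^ m * ((- 1) ^ k * (deriv ^^ k) \<zeta> (- x))" for k x
    unfolding \<eta>_def using test_smooth[OF \<zeta>(1)]
    by (simp add: deriv_iter_cmult smooth_reflect deriv_iter_reflect)
  show thesis
  proof
    show "\<eta> \<in> test_functions"
      unfolding \<eta>_def by (intro test_cmult test_reflect \<zeta>(1))
    show "(deriv ^^ m) \<eta> x = g x" if "x \<in> {a..b}" for x
      using \<zeta>(2)[of "- x"] that by (simp add: eq flip: power_add mult.assoc)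
    show "(deriv ^^ k) \<eta> x = 0" if "x \<in> {a..b}" "\<rho> \<le> \<bar>x - c\<bar>" for k x
      using \<zeta>(3)[of "- x" k] that c by (simp add: eq abs_minus_commute)
    fix k x
    assume k: "k < m" and x: "x \<in> {a..b}"
    have bey: "beyond (- a) (- x) {-b..-a} = {-b..- x}" "beyond c x {a..b} = {x..b}"
      using x c by (auto simp: beyond_def)
    have "((\<lambda>t. \<bar>t + x\<bar> ^ (m - k - 1) / fact (m - k - 1) * g (- t)) has_integral (deriv ^^ k) \<zeta> (- x)) {-b..- x}"
      using \<zeta>(4)[of k "- x"] k x bey by simp
    then have "((\<lambda>t. \<bar>(- t) + x\<bar> ^ (m - k - 1) / fact (m - k - 1) * g t) has_integral (deriv ^^ k) \<zeta> (- x)) {x..b}"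
      using has_integral_reflect_real[of "\<lambda>t. \<bar>(- t) + x\<bar> ^ (m - k - 1) / fact (m - k - 1) * g t" _ b x] by simp
    then have *: "((\<lambda>t. \<bar>t - x\<bar> ^ (m - k - 1) / fact (m - k - 1) * g t) has_integral (deriv ^^ k) \<zeta> (- x)) (beyond c x {a..b})"
      unfolding bey by (simp add: abs_minus_commute)
    have "(- 1) ^ (m + k) \<in> {1, - 1 :: real}"
      by (cases "even (m + k)") auto
    moreover have "(deriv ^^ k) \<zeta> (- x) = (- 1) ^ (m + k) * (deriv ^^ k) \<eta> x"
      by (simp only: eq mult.assoc[symmetric] power_add[symmetric])
        (simp add: minus_one_power_iff)
    ultimately show "\<exists>s\<in>{1, -1}.
      ((\<lambda>t. \<bar>t - x\<bar> ^ (m - k - 1) / fact (m - k - 1) * g t) has_integral s * (deriv ^^ k) \<eta> x) (beyond c x {a..b})"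
      using * by (intro bexI[of _ "(- 1) ^ (m + k)"]) auto
  qed
qed

text \<open>
  The derivative at \<open>b\<close> is expanded around a point \<open>y\<close> to the left of \<open>b\<close> and averaged over \<open>y\<close> with the
  weight \<open>\<bar>b - y\<bar> ^ (m - k - 1)\<close>, which is the weight of the remainder term.
\<close>

lemma endpoint_derivative_bound_right:
  assumes "k < m" "0 < \<epsilon>"
  obtains C where "0 \<le> C" "\<And>\<phi>. smooth \<phi> \<Longrightarrow> \<bar>(deriv ^^ k) \<phi> b\<bar> \<le>
    C * (\<Sum>j\<le>m. integral {b - \<epsilon>..b} (\<lambda>t. \<bar>t - b\<bar> ^ (m - k - 1) * \<bar>(deriv ^^ j) \<phi> t\<bar>))"
proof -
  define n where "n = m - k"
  have n: "0 < n" "k + n = m" "k + n - k = n" "k < k + n"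
    using assms(1) by (auto simp: n_def)
  let ?S = "{b - \<epsilon>..b}"
  let ?J = "\<lambda>f. integral ?S (\<lambda>t. \<bar>t - b\<bar> ^ (n - 1) * \<bar>f t\<bar>)"
  define A where "A = (1 + \<epsilon>) ^ n"
  have A: "\<epsilon> ^ i \<le> A" if "i \<le> n" for i
    unfolding A_def using assms(2) by (meson power_increasing[of i n "1 + \<epsilon>"] power_mono[of \<epsilon> "1 + \<epsilon>" i] that
        order_trans le_add_same_cancel1 less_imp_le le_add_same_cancel2 zero_le_one)
  have A0: "0 < A"
    unfolding A_def using assms(2) by simp
  define K where "K = integral ?S (\<lambda>t. \<bar>t - b\<bar> ^ (n - 1))"
  have Kint: "((\<lambda>t. \<bar>t - b\<bar> ^ (n - 1)) has_integral K) ?S"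
    unfolding K_def by (intro integrable_integral integrable_continuous_interval continuous_intros)
  have "((\<lambda>t. (b - t) ^ (n - 1)) has_integral ((- ((b - b) ^ n) / n) - (- ((b - (b - \<epsilon>)) ^ n) / n))) ?S"
    by (rule fundamental_theorem_of_calculus)
      (use n(1) assms(2) in \<open>auto intro!: derivative_eq_intros simp: has_real_derivative_iff_has_vector_derivative[symmetric]\<close>)
  then have "((\<lambda>t. \<bar>t - b\<bar> ^ (n - 1)) has_integral ((- ((b - b) ^ n) / n) - (- ((b - (b - \<epsilon>)) ^ n) / n))) ?S"
    by (rule has_integral_eq[rotated]) (auto simp: abs_minus_commute)
  then have "K = \<epsilon> ^ n / n"
    using Kint n(1) by (auto dest: has_integral_unique)
  then have K0: "0 < K"
    using n(1) assms(2) by simp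
  have bound: "\<bar>(deriv ^^ k) \<phi> b\<bar> \<le> ((A + K) / K) * (\<Sum>j\<le>m. ?J ((deriv ^^ j) \<phi>))" if \<phi>: "smooth \<phi>" for \<phi>
  proof -
    have cont: "continuous_on S ((deriv ^^ j) \<phi>)" for j S
      by (intro smooth_continuous_on smooth_iter_deriv \<phi>)
    have Jint: "(\<lambda>t. \<bar>t - b\<bar> ^ (n - 1) * \<bar>(deriv ^^ j) \<phi> t\<bar>) integrable_on S" if "S = {s..t}" for j S s t
      unfolding that by (intro integrable_continuous_interval continuous_intros cont)
    have J0: "0 \<le> ?J ((deriv ^^ j) \<phi>)" for j
      by (intro integral_nonneg Jint[OF refl]) auto
    let ?R = "?J ((deriv ^^ m) \<phi>)"
    have point: "\<bar>(deriv ^^ k) \<phi> b\<bar> \<le> (\<Sum>i<n. A * \<bar>(deriv ^^ (k + i)) \<phi> y\<bar>) + ?R" if y: "y \<in> ?S" for y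
    proof -
      let ?P = "\<Sum>i<n. (b - y) ^ i / fact i * (deriv ^^ (k + i)) \<phi> y"
      let ?q = "\<lambda>t. (b - t) ^ (n - 1) / fact (n - 1) * (deriv ^^ m) \<phi> t"
      have I: "(?q has_integral (deriv ^^ k) \<phi> b - ?P) {y..b}"
        using taylor_integral[OF \<phi>, of y b k m] y assms(1) by (simp add: n_def)
      have "norm (integral {y..b} ?q) \<le> integral {y..b} (\<lambda>t. \<bar>t - b\<bar> ^ (n - 1) * \<bar>(deriv ^^ m) \<phi> t\<bar>)"
      proof (rule integral_norm_bound_integral[OF has_integral_integrable[OF I] Jint[OF refl]])
        fix t assume t: "t \<in> {y..b}"
        have "\<bar>b - t\<bar> ^ (n - 1) / fact (n - 1) \<le> \<bar>b - t\<bar> ^ (n - 1)"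
          using divide_left_mono[of 1 "fact (n - 1)" "\<bar>b - t\<bar> ^ (n - 1)"] by simp
        then show "norm (?q t) \<le> \<bar>t - b\<bar> ^ (n - 1) * \<bar>(deriv ^^ m) \<phi> t\<bar>"
          by (simp add: abs_mult power_abs abs_minus_commute mult_right_mono flip: times_divide_eq_left)
      qed
      also have "\<dots> \<le> ?R"
        by (intro integral_subset_le Jint[OF refl]) (use y in auto)
      finally have "\<bar>(deriv ^^ k) \<phi> b - ?P\<bar> \<le> ?R"
        unfolding integral_unique[OF I] by simp
      moreover have "\<bar>?P\<bar> \<le> (\<Sum>i<n. A * \<bar>(deriv ^^ (k + i)) \<phi> y\<bar>)"
      proof (rule order_trans[OF sum_abs sum_mono])
        fix i assume "i \<in> {..<n}"
        then have "(b - y) ^ i \<le> A"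
          using A[of i] power_mono[of "b - y" \<epsilon> i] y by auto
        then have "(b - y) ^ i / fact i \<le> A"
          using y divide_left_mono[of 1 "fact i" "(b - y) ^ i"] by simp
        then show "\<bar>(b - y) ^ i / fact i * (deriv ^^ (k + i)) \<phi> y\<bar> \<le> A * \<bar>(deriv ^^ (k + i)) \<phi> y\<bar>"
          using y by (simp add: abs_mult mult_right_mono flip: times_divide_eq_left)
      qed
      ultimately show ?thesis
        by linarith
    qed
    have "K * \<bar>(deriv ^^ k) \<phi> b\<bar> = integral ?S (\<lambda>t. \<bar>t - b\<bar> ^ (n - 1) * \<bar>(deriv ^^ k) \<phi> b\<bar>)"
      using Kint by (simp add: K_def)
    also have "\<dots> \<le> integral ?S (\<lambda>t. (\<Sum>i<n. A * (\<bar>t - b\<bar> ^ (n - 1) * \<bar>(deriv ^^ (k + i)) \<phi> t\<bar>)) + \<bar>t - b\<bar> ^ (n - 1) * ?R)"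
    proof (rule integral_le)
      show "(\<lambda>t. \<bar>t - b\<bar> ^ (n - 1) * \<bar>(deriv ^^ k) \<phi> b\<bar>) integrable_on ?S"
        by (intro integrable_continuous_interval continuous_intros)
      show "(\<lambda>t. (\<Sum>i<n. A * (\<bar>t - b\<bar> ^ (n - 1) * \<bar>(deriv ^^ (k + i)) \<phi> t\<bar>)) + \<bar>t - b\<bar> ^ (n - 1) * ?R) integrable_on ?S"
        by (intro integrable_continuous_interval continuous_intros cont)
      show "\<bar>t - b\<bar> ^ (n - 1) * \<bar>(deriv ^^ k) \<phi> b\<bar> \<le>
          (\<Sum>i<n. A * (\<bar>t - b\<bar> ^ (n - 1) * \<bar>(deriv ^^ (k + i)) \<phi> t\<bar>)) + \<bar>t - b\<bar> ^ (n - 1) * ?R" if "t \<in> ?S" for t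
        using mult_left_mono[OF point[OF that], of "\<bar>t - b\<bar> ^ (n - 1)"]
        by (simp add: distrib_left sum_distrib_left mult_ac)
    qed
    also have "\<dots> = (\<Sum>i<n. A * ?J ((deriv ^^ (k + i)) \<phi>)) + K * ?R"
    proof (rule integral_unique[OF has_integral_add[OF has_integral_sum]])
      show "((\<lambda>t. \<bar>t - b\<bar> ^ (n - 1) * ?R) has_integral K * ?R) ?S"
        using Kint by (rule has_integral_mult_left)
      show "((\<lambda>t. A * (\<bar>t - b\<bar> ^ (n - 1) * \<bar>(deriv ^^ (k + i)) \<phi> t\<bar>)) has_integral A * ?J ((deriv ^^ (k + i)) \<phi>)) ?S" for i
        by (intro has_integral_mult_right integrable_integral Jint[OF refl])
    qed simp
    also have "(\<Sum>i<n. A * ?J ((deriv ^^ (k + i)) \<phi>)) = A * (\<Sum>j\<in>{k..<m}. ?J ((deriv ^^ j) \<phi>))"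
      unfolding sum_distrib_left[symmetric] using n(2)
      by (subst sum.atLeastLessThan_shift_0) (simp add: n_def lessThan_atLeast0 add.commute)
    also have "(\<Sum>j\<in>{k..<m}. ?J ((deriv ^^ j) \<phi>)) \<le> (\<Sum>j\<le>m. ?J ((deriv ^^ j) \<phi>))"
      by (intro sum_mono2) (use J0 in auto)
    also have "?R \<le> (\<Sum>j\<le>m. ?J ((deriv ^^ j) \<phi>))"
      by (rule member_le_sum) (use J0 in auto)
    finally have "K * \<bar>(deriv ^^ k) \<phi> b\<bar> \<le> (A + K) * (\<Sum>j\<le>m. ?J ((deriv ^^ j) \<phi>))"
      using A0 K0 by (simp add: mult_left_mono distrib_right)
    then show ?thesis
      using K0 by (simp add: field_simps)
  qed
  show thesis
    using that[of "(A + K) / K"] bound A0 K0 by (simp add: n_def)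
qed

lemma endpoint_derivative_bound:
  fixes a b :: real
  assumes "k < m" "0 < \<epsilon>" "\<epsilon> \<le> b - a" "c = a \<or> c = b"
  obtains C where "0 \<le> C" "\<And>\<phi>. smooth \<phi> \<Longrightarrow> \<bar>(deriv ^^ k) \<phi> c\<bar> \<le>
    C * (\<Sum>j\<le>m. integral ({a..b} \<inter> cball c \<epsilon>) (\<lambda>t. \<bar>t - c\<bar> ^ (m - k - 1) * \<bar>(deriv ^^ j) \<phi> t\<bar>))"
proof (cases "c = b")
  case True
  then have "{a..b} \<inter> cball c \<epsilon> = {b - \<epsilon>..b}"
    using assms by (auto simp: dist_real_def)
  with True show ?thesis
    using endpoint_derivative_bound_right[OF assms(1,2), of b] that by auto
next
  case False
  then have c: "c = a"
    using assms by blast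
  then have S: "{a..b} \<inter> cball c \<epsilon> = {a..a + \<epsilon>}"
    using assms by (auto simp: dist_real_def)
  obtain C where C: "0 \<le> C" "\<And>\<phi>. smooth \<phi> \<Longrightarrow> \<bar>(deriv ^^ k) \<phi> (- a)\<bar> \<le>
      C * (\<Sum>j\<le>m. integral {- a - \<epsilon>..- a} (\<lambda>t. \<bar>t - (- a)\<bar> ^ (m - k - 1) * \<bar>(deriv ^^ j) \<phi> t\<bar>))"
    by (rule endpoint_derivative_bound_right[OF assms(1,2), of "- a"]) auto
  show ?thesis
  proof
    show "0 \<le> C"
      by (rule C)
    fix \<phi> :: "real \<Rightarrow> real"
    assume \<phi>: "smooth \<phi>"
    have R: "integral {- a - \<epsilon>..- a} (\<lambda>t. \<bar>t - (- a)\<bar> ^ (m - k - 1) * \<bar>(deriv ^^ j) (\<lambda>x. \<phi> (- x)) t\<bar>) =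
      integral {a..a + \<epsilon>} (\<lambda>t. \<bar>t - a\<bar> ^ (m - k - 1) * \<bar>(deriv ^^ j) \<phi> t\<bar>)" for j
    proof -
      have "(\<lambda>t. \<bar>t - (- a)\<bar> ^ (m - k - 1) * \<bar>(deriv ^^ j) (\<lambda>x. \<phi> (- x)) t\<bar>) =
          (\<lambda>t. \<bar>(- t) - a\<bar> ^ (m - k - 1) * \<bar>(deriv ^^ j) \<phi> (- t)\<bar>)"
      proof
        fix t :: real
        have "\<bar>t - (- a)\<bar> = \<bar>(- t) - a\<bar>"
          by arith
        then show "\<bar>t - (- a)\<bar> ^ (m - k - 1) * \<bar>(deriv ^^ j) (\<lambda>x. \<phi> (- x)) t\<bar> =
            \<bar>(- t) - a\<bar> ^ (m - k - 1) * \<bar>(deriv ^^ j) \<phi> (- t)\<bar>"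
          by (simp only: deriv_iter_reflect[OF \<phi>] abs_mult power_abs[symmetric]) (simp add: power_abs)
      qed
      moreover have "- a - \<epsilon> = - (a + \<epsilon>)"
        by simp
      ultimately show ?thesis
        using Henstock_Kurzweil_Integration.integral_reflect_real[of "a + \<epsilon>" a "\<lambda>t. \<bar>t - a\<bar> ^ (m - k - 1) * \<bar>(deriv ^^ j) \<phi> t\<bar>"]
        by (simp only:)
    qed
    have "\<bar>(deriv ^^ k) \<phi> c\<bar> = \<bar>(deriv ^^ k) (\<lambda>x. \<phi> (- x)) (- a)\<bar>"
      by (simp add: deriv_iter_reflect[OF \<phi>] abs_mult power_abs c)
    then show "\<bar>(deriv ^^ k) \<phi> c\<bar> \<le>
        C * (\<Sum>j\<le>m. integral ({a..b} \<inter> cball c \<epsilon>) (\<lambda>t. \<bar>t - c\<bar> ^ (m - k - 1) * \<bar>(deriv ^^ j) \<phi> t\<bar>))"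
      using C(2)[OF smooth_reflect[OF \<phi>]] unfolding R S by (simp only: c)
  qed
qed

section \<open>Weighted Lebesgue spaces\<close>

lemma powr_convex_combination:
  fixes p l x y :: real
  assumes "1 \<le> p" "0 < l" "l < 1" "0 \<le> x" "0 \<le> y"
  shows "(l * x + (1 - l) * y) powr p \<le> l * x powr p + (1 - l) * y powr p"
proof -
  have scale: "(t * z) powr p \<le> t * z powr p" if "0 < t" "t < 1" "0 \<le> z" for t z :: real
  proof -
    have "t powr p \<le> t powr 1"
      using that assms(1) by (intro powr_mono') auto
    then show ?thesis
      using that by (simp add: powr_mult mult_right_mono)
  qed
  consider "x = 0" | "y = 0" | "0 < x" "0 < y"
    using assms by linarith
  then show ?thesis
  proof cases
    case 1
    then show ?thesis
      using scale[of "1 - l" y] assms by simp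
  next
    case 2
    then show ?thesis
      using scale[of l x] assms by simp
  next
    case 3
    then show ?thesis
      using convex_onD[OF powr_convex[OF assms(1)], of "1 - l" x y] assms by simp
  qed
qed

text \<open>
  Convexity with the weights \<open>A / (A + B)\<close> and \<open>B / (A + B)\<close>. With upper bounds of the two norms for \<open>A\<close>
  and \<open>B\<close>, integration gives Minkowski's inequality.
\<close>

lemma powr_sum_le:
  fixes p A B x y :: real
  assumes "1 \<le> p" "0 < A" "0 < B" "0 \<le> x" "0 \<le> y"
  shows "(x + y) powr p \<le> (A + B) powr p * (A / (A + B) * (x powr p / A powr p) + B / (A + B) * (y powr p / B powr p))"
proof -
  have "(A / (A + B) * (x / A) + (1 - A / (A + B)) * (y / B)) powr p \<le>
      A / (A + B) * (x / A) powr p + (1 - A / (A + B)) * (y / B) powr p"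
    using assms by (intro powr_convex_combination) auto
  also have "1 - A / (A + B) = B / (A + B)"
    using assms by (simp add: field_simps)
  finally have "(A / (A + B) * (x / A) + B / (A + B) * (y / B)) powr p \<le>
      A / (A + B) * (x powr p / A powr p) + B / (A + B) * (y powr p / B powr p)"
    using assms by (simp add: powr_divide)
  moreover have "x + y = (A + B) * (A / (A + B) * (x / A) + B / (A + B) * (y / B))"
  proof -
    have "A + B \<noteq> 0"
      using assms by simp
    then show ?thesis
      using assms by (simp add: distrib_left)
  qed
  moreover have "0 \<le> A / (A + B) * (x / A) + B / (A + B) * (y / B)"
    using assms by simp
  ultimately show ?thesis
    using assms by (simp add: powr_mult mult_left_mono)
qed

locale weighted_interval =
  fixes a b p :: real and w :: "real \<Rightarrow> real"
  assumes ab: "a < b" and p1: "1 \<le> p" and weight: "weight a b w"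
begin

abbreviation "I \<equiv> {a<..<b}"
abbreviation "M \<equiv> lebesgue_on {a<..<b}"
abbreviation "\<mu> \<equiv> mu a b w"
abbreviation "L \<equiv> Lp a b p w"
abbreviation "N \<equiv> Lp_norm a b p w"

lemma w_integrable: "integrable M w"
  using weight by (simp add: weight_def)

lemma w_measurable [measurable]: "w \<in> borel_measurable M"
  using w_integrable by (rule borel_measurable_integrable)

lemma w_nonneg: "AE x in M. 0 \<le> w x"
  using weight by (simp add: weight_def)

lemma sets_mu [simp, measurable_cong]: "sets \<mu> = sets M"
  by (simp add: mu_def)

lemma space_mu [simp]: "space \<mu> = I"
  by (simp add: mu_def)

lemma borel_measurable_mu: "borel_measurable \<mu> = borel_measurable M"
  by (rule measurable_cong_sets) auto

lemma nn_integral_mu: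
  assumes "f \<in> borel_measurable M"
  shows "(\<integral>\<^sup>+x. f x \<partial>\<mu>) = (\<integral>\<^sup>+x. ennreal (w x) * f x \<partial>M)"
  unfolding mu_def using assms by (intro nn_integral_density) auto

lemma AE_mu: "(AE x in \<mu>. P x) \<longleftrightarrow> (AE x in M. 0 < w x \<longrightarrow> P x)"
  unfolding mu_def by (subst AE_density) auto

lemma AE_mu_I: "AE x in M. P x \<Longrightarrow> AE x in \<mu>. P x"
  by (auto simp: AE_mu)

lemma finite_measure_mu: "finite_measure \<mu>"
proof
  have "emeasure \<mu> (space \<mu>) = (\<integral>\<^sup>+x. ennreal (w x) \<partial>M)"
    using nn_integral_mu[of "\<lambda>_. 1"] by simp
  also have "\<dots> = ennreal (integral\<^sup>L M w)"
    by (intro nn_integral_eq_integral w_integrable w_nonneg)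
  finally show "emeasure \<mu> (space \<mu>) \<noteq> \<infinity>"
    by simp
qed

sublocale mu: finite_measure \<mu>
  by (rule finite_measure_mu)

lemma L_iff: "f \<in> L \<longleftrightarrow> f \<in> borel_measurable M \<and> integrable \<mu> (\<lambda>x. \<bar>f x\<bar> powr p)"
  by (simp add: Lp_def borel_measurable_mu)

lemma L_measurable: "f \<in> L \<Longrightarrow> f \<in> borel_measurable M"
  by (simp add: L_iff)

lemma L_integrable: "f \<in> L \<Longrightarrow> integrable \<mu> (\<lambda>x. \<bar>f x\<bar> powr p)"
  by (simp add: L_iff)

lemma L_bound:
  assumes "g \<in> L" "f \<in> borel_measurable M" "AE x in \<mu>. \<bar>f x\<bar> \<le> \<bar>g x\<bar>"
  shows "f \<in> L"
  unfolding L_iff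
proof
  have [measurable]: "f \<in> borel_measurable \<mu>"
    using assms(2) borel_measurable_mu by simp
  show "integrable \<mu> (\<lambda>x. \<bar>f x\<bar> powr p)"
    by (rule Bochner_Integration.integrable_bound[OF L_integrable[OF assms(1)]])
      (use assms(3) p1 in \<open>auto intro!: powr_mono2 elim!: eventually_mono\<close>)
qed fact

lemma N_nonneg: "0 \<le> N f"
  by (simp add: Lp_norm_def)

lemma N_powr: "N f powr p = (\<integral>x. \<bar>f x\<bar> powr p \<partial>\<mu>)"
  using p1 by (simp add: Lp_norm_def powr_powr)

lemma N_le_iff:
  assumes "0 \<le> A"
  shows "N f \<le> A \<longleftrightarrow> (\<integral>x. \<bar>f x\<bar> powr p \<partial>\<mu>) \<le> A powr p"
  unfolding N_powr[symmetric]
proof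
  show "N f powr p \<le> A powr p" if "N f \<le> A"
    using that p1 N_nonneg by (intro powr_mono2) auto
  show "N f \<le> A" if "N f powr p \<le> A powr p"
    using that powr_less_mono2[of p A "N f"] p1 assms by (meson less_le_trans not_le zero_less_one)
qed

lemma nn_integral_N:
  assumes "f \<in> L"
  shows "(\<integral>\<^sup>+x. ennreal (w x * \<bar>f x\<bar> powr p) \<partial>M) = ennreal (N f powr p)"
proof -
  have [measurable]: "f \<in> borel_measurable M"
    using assms by (rule L_measurable)
  have "(\<integral>\<^sup>+x. ennreal (w x * \<bar>f x\<bar> powr p) \<partial>M) = (\<integral>\<^sup>+x. ennreal (w x) * ennreal (\<bar>f x\<bar> powr p) \<partial>M)"
    by (intro nn_integral_cong_AE) (use w_nonneg in \<open>auto elim!: eventually_mono simp: ennreal_mult''\<close>)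
  also have "\<dots> = (\<integral>\<^sup>+x. ennreal (\<bar>f x\<bar> powr p) \<partial>\<mu>)"
    by (simp add: nn_integral_mu)
  also have "\<dots> = ennreal (N f powr p)"
    unfolding N_powr by (intro nn_integral_eq_integral L_integrable assms) auto
  finally show ?thesis .
qed

lemma N_cong: "(\<And>x. x \<in> I \<Longrightarrow> \<bar>f x\<bar> = \<bar>g x\<bar>) \<Longrightarrow> N f = N g"
  unfolding Lp_norm_def
  by (intro arg_cong[where f = "\<lambda>x. x powr _"] Bochner_Integration.integral_cong) auto

lemma L_cmult: "f \<in> L \<Longrightarrow> (\<lambda>x. c * f x) \<in> L"
  by (auto simp: L_iff abs_mult powr_mult)

lemma N_cmult: "N (\<lambda>x. c * f x) = \<bar>c\<bar> * N f"
  using p1 by (simp add: Lp_norm_def abs_mult powr_mult powr_powr)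

text \<open>
  The norms are replaced by strictly larger numbers \<open>A\<close> and \<open>B\<close>, which are positive even when a norm
  is zero.
\<close>

lemma Minkowski:
  assumes f: "f \<in> L" and g: "g \<in> L"
  shows L_add: "(\<lambda>x. f x + g x) \<in> L" and N_triangle: "N (\<lambda>x. f x + g x) \<le> N f + N g"
proof -
  have [measurable]: "f \<in> borel_measurable M" "g \<in> borel_measurable M"
    using f g by (auto intro: L_measurable)
  then have [measurable]: "f \<in> borel_measurable \<mu>" "g \<in> borel_measurable \<mu>"
    by (auto simp: borel_measurable_mu)
  define R where "R = (\<lambda>A B x. (A + B) powr p * (A / (A + B) * (\<bar>f x\<bar> powr p / A powr p) + B / (A + B) * (\<bar>g x\<bar> powr p / B powr p)))"
  have le: "\<bar>f x + g x\<bar> powr p \<le> R A B x" if "0 < A" "0 < B" for A B x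
  proof -
    have "\<bar>f x + g x\<bar> powr p \<le> (\<bar>f x\<bar> + \<bar>g x\<bar>) powr p"
      using p1 by (intro powr_mono2) auto
    also have "\<dots> \<le> R A B x"
      unfolding R_def using that p1 by (intro powr_sum_le) auto
    finally show ?thesis .
  qed
  have Rint: "integrable \<mu> (R A B)" for A B
    unfolding R_def using L_integrable[OF f] L_integrable[OF g] by auto
  have int: "integrable \<mu> (\<lambda>x. \<bar>f x + g x\<bar> powr p)"
    by (rule Bochner_Integration.integrable_bound[OF Rint[of 1 1]])
      (use le[of 1 1] in \<open>auto intro!: AE_I2 order_trans[OF le abs_ge_self]\<close>)
  then show "(\<lambda>x. f x + g x) \<in> L"
    by (simp add: L_iff)
  have bound: "N (\<lambda>x. f x + g x) \<le> A + B" if A: "N f < A" and B: "N g < B" for A B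
  proof -
    have pos: "0 < A" "0 < B"
      using that N_nonneg[of f] N_nonneg[of g] by linarith+
    have "(\<integral>x. \<bar>f x + g x\<bar> powr p \<partial>\<mu>) \<le> (\<integral>x. R A B x \<partial>\<mu>)"
      by (intro integral_mono int Rint le pos)
    also have "\<dots> = (A + B) powr p * (A / (A + B) * (N f powr p / A powr p) + B / (A + B) * (N g powr p / B powr p))"
      unfolding R_def N_powr using L_integrable[OF f] L_integrable[OF g] by simp
    also have "\<dots> \<le> (A + B) powr p * (A / (A + B) * 1 + B / (A + B) * 1)"
      using pos A B p1 N_nonneg by (intro mult_left_mono add_mono) (auto simp: divide_le_eq powr_mono2)
    also have "A / (A + B) * 1 + B / (A + B) * 1 = 1"
      using pos by (simp flip: add_divide_distrib)
    finally show ?thesis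
      using pos by (subst N_le_iff) auto
  qed
  show "N (\<lambda>x. f x + g x) \<le> N f + N g"
  proof (rule field_le_epsilon)
    fix e :: real
    assume "0 < e"
    then show "N (\<lambda>x. f x + g x) \<le> N f + N g + e"
      using bound[of "N f + e / 2" "N g + e / 2"] by simp
  qed
qed

lemma L_uminus: "f \<in> L \<Longrightarrow> (\<lambda>x. - f x) \<in> L"
  using L_cmult[of f "- 1"] by simp

lemma N_uminus: "N (\<lambda>x. - f x) = N f"
  by (rule N_cong) simp

lemma N_diff_commute: "N (\<lambda>x. f x - g x) = N (\<lambda>x. g x - f x)"
  by (rule N_cong) simp

lemma L_diff: "f \<in> L \<Longrightarrow> g \<in> L \<Longrightarrow> (\<lambda>x. f x - g x) \<in> L"
  using L_add[OF _ L_uminus, of f g] by simp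

lemma N_triangle_diff: "f \<in> L \<Longrightarrow> g \<in> L \<Longrightarrow> N (\<lambda>x. f x - g x) \<le> N f + N g"
  using N_triangle[OF _ L_uminus, of f g] by (simp add: N_uminus)

lemma N_triangle3:
  assumes "f \<in> L" "g \<in> L" "h \<in> L"
  shows "N (\<lambda>x. f x - h x) \<le> N (\<lambda>x. f x - g x) + N (\<lambda>x. g x - h x)"
  using N_triangle[OF L_diff[OF assms(1,2)] L_diff[OF assms(2,3)]] by simp

lemma L_const: "(\<lambda>x. c) \<in> L"
  by (simp add: L_iff)

lemma L_bounded:
  assumes "f \<in> borel_measurable M" "\<And>x. x \<in> I \<Longrightarrow> \<bar>f x\<bar> \<le> B"
  shows "f \<in> L"
  by (rule L_bound[OF L_const[of B] assms(1)]) (use assms(2) in \<open>force intro: AE_I2\<close>)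

lemma N_zero: "N (\<lambda>x. 0) = 0"
  by (simp add: Lp_norm_def)

lemma N_sum_le:
  assumes "\<And>i. i \<in> A \<Longrightarrow> f i \<in> L"
  shows "(\<lambda>x. \<Sum>i\<in>A. f i x) \<in> L \<and> N (\<lambda>x. \<Sum>i\<in>A. f i x) \<le> (\<Sum>i\<in>A. N (f i))"
  using assms
proof (induction A rule: infinite_finite_induct)
  case (insert i A)
  then have "N (\<lambda>x. f i x + (\<Sum>i\<in>A. f i x)) \<le> N (f i) + N (\<lambda>x. \<Sum>i\<in>A. f i x)"
    by (intro N_triangle) auto
  with insert show ?case
    by (auto intro!: L_add)
qed (auto simp: L_const N_zero)

lemma N_eq_0_iff:
  assumes "f \<in> L"
  shows "N f = 0 \<longleftrightarrow> (AE x in M. 0 < w x \<longrightarrow> f x = 0)"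
proof -
  have "N f = 0 \<longleftrightarrow> (\<integral>x. \<bar>f x\<bar> powr p \<partial>\<mu>) = 0"
    by (simp add: Lp_norm_def)
  also have "\<dots> \<longleftrightarrow> (AE x in \<mu>. \<bar>f x\<bar> powr p = 0)"
    by (intro integral_nonneg_eq_0_iff_AE L_integrable assms) auto
  finally show ?thesis
    by (simp add: AE_mu)
qed

lemma N_bounded_support:
  assumes f: "f \<in> borel_measurable M" and B: "\<And>x. x \<in> I \<Longrightarrow> \<bar>f x\<bar> \<le> B" "0 \<le> B"
    and S: "S \<in> sets M" "\<And>x. x \<in> I - S \<Longrightarrow> f x = 0"
  shows "N f \<le> B * (measure \<mu> S) powr (1 / p)"
proof -
  have [measurable]: "S \<in> sets \<mu>"
    using S by simp
  have "(\<integral>x. \<bar>f x\<bar> powr p \<partial>\<mu>) \<le> (\<integral>x. B powr p * indicator S x \<partial>\<mu>)"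
  proof (rule integral_mono)
    show "integrable \<mu> (\<lambda>x. \<bar>f x\<bar> powr p)"
      using L_bounded[OF f B(1)] by (rule L_integrable)
    show "integrable \<mu> (\<lambda>x. B powr p * indicator S x)"
      by (intro integrable_mult_right integrable_real_indicator) (auto simp: S less_top[symmetric])
    show "\<bar>f x\<bar> powr p \<le> B powr p * indicator S x" if "x \<in> space \<mu>" for x
      using that B S(2)[of x] p1 by (auto simp: indicator_def intro!: powr_mono2)
  qed
  also have "\<dots> = B powr p * measure \<mu> S"
    using S sets.sets_into_space[OF S(1)] by (simp add: Int_absorb2)
  finally have "N f \<le> (B powr p * measure \<mu> S) powr (1 / p)"
    unfolding Lp_norm_def using p1 by (intro powr_mono2) auto
  then show ?thesis
    using p1 B(2) by (simp add: powr_mult powr_powr)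
qed

lemma smooth_L:
  assumes "smooth f"
  shows "f \<in> L"
proof -
  obtain B where "\<And>x. x \<in> {a..b} \<Longrightarrow> \<bar>f x\<bar> \<le> B"
    using compact_imp_bounded[OF compact_continuous_image[OF smooth_continuous_on[OF assms] compact_Icc]]
    unfolding bounded_iff by fastforce
  moreover have "f \<in> borel_measurable M"
    by (intro continuous_imp_measurable_on_sets_lebesgue smooth_continuous_on assms) auto
  ultimately show ?thesis
    by (intro L_bounded[of _ B]) auto
qed

lemma test_L: "\<phi> \<in> test_functions \<Longrightarrow> (deriv ^^ k) \<phi> \<in> L"
  by (intro smooth_L smooth_iter_deriv test_smooth)

section \<open>Critical points\<close>

text \<open>
  Homogeneity. Dividing \<open>f\<close> by numbers \<open>t\<close> slightly larger than \<open>N f\<close> covers functions of norm zero too.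
\<close>

lemma bound_by_scaling:
  assumes unit: "\<And>f. f \<in> L \<Longrightarrow> N f \<le> 1 \<Longrightarrow> (\<integral>\<^sup>+x. ennreal (q x * \<bar>f x\<bar>) \<partial>M) \<le> ennreal K"
    and q [measurable]: "q \<in> borel_measurable M" and q0: "\<And>x. 0 \<le> q x" and K: "0 \<le> K" and f: "f \<in> L"
  shows "(\<integral>\<^sup>+x. ennreal (q x * \<bar>f x\<bar>) \<partial>M) \<le> ennreal (K * N f)"
proof -
  have [measurable]: "f \<in> borel_measurable M"
    using f by (rule L_measurable)
  let ?J = "\<integral>\<^sup>+x. ennreal (q x * \<bar>f x\<bar>) \<partial>M"
  have le: "?J \<le> ennreal (K * t)" if t: "N f < t" for t
  proof -
    have t0: "0 < t"
      using t N_nonneg[of f] by linarith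
    have "N (\<lambda>x. (1 / t) * f x) \<le> 1"
      using t0 t unfolding N_cmult by (simp add: divide_le_eq)
    then have "(\<integral>\<^sup>+x. ennreal (q x * \<bar>(1 / t) * f x\<bar>) \<partial>M) \<le> ennreal K"
      by (intro unit L_cmult f)
    then have "ennreal t * (\<integral>\<^sup>+x. ennreal (q x * \<bar>(1 / t) * f x\<bar>) \<partial>M) \<le> ennreal t * ennreal K"
      by (intro mult_left_mono) auto
    also have "ennreal t * (\<integral>\<^sup>+x. ennreal (q x * \<bar>(1 / t) * f x\<bar>) \<partial>M) =
        (\<integral>\<^sup>+x. ennreal t * ennreal (q x * \<bar>(1 / t) * f x\<bar>) \<partial>M)"
      by (simp add: nn_integral_cmult)
    also have "(\<lambda>x. ennreal t * ennreal (q x * \<bar>(1 / t) * f x\<bar>)) = (\<lambda>x. ennreal (q x * \<bar>f x\<bar>))"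
      using t0 q0 by (auto simp: ennreal_mult'[symmetric] abs_mult)
    finally show ?thesis
      using t0 K by (simp add: ennreal_mult' mult.commute)
  qed
  have "?J < \<infinity>"
    using le[of "N f + 1"] by (simp add: le_less_trans)
  then obtain J where J: "?J = ennreal J" "0 \<le> J"
    by (metis ennreal_cases infinity_ennreal_def less_irrefl)
  have "J \<le> K * N f"
  proof (rule field_le_epsilon)
    fix e :: real
    assume e: "0 < e"
    have "J \<le> K * (N f + e / (K + 1))"
      using le[of "N f + e / (K + 1)"] J K e N_nonneg[of f] by (simp add: ennreal_le_iff)
    also have "\<dots> = K * N f + e * (K / (K + 1))"
      by (simp add: algebra_simps)
    also have "e * (K / (K + 1)) \<le> e * 1"
      using K e by (intro mult_left_mono) auto
    finally show "J \<le> K * N f + e"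
      by simp
  qed
  then show ?thesis
    using J by (simp add: ennreal_leI)
qed

text \<open>
  An inequality of Young's type gives a bound on the unit ball, which scaling turns into a bound of
  Hoelder's type.
\<close>

lemma bound_by_pointwise:
  assumes \<kappa> [measurable]: "\<kappa> \<in> borel_measurable M" and fin: "(\<integral>\<^sup>+x. \<kappa> x \<partial>M) < \<infinity>"
    and q [measurable]: "q \<in> borel_measurable M" and q0: "\<And>x. 0 \<le> q x" and C: "0 \<le> C"
    and le: "AE x in M. \<forall>y\<ge>0. ennreal (q x * y) \<le> \<kappa> x + ennreal (C * (w x * y powr p))"
  shows "\<exists>K\<ge>0. \<forall>f\<in>L. (\<integral>\<^sup>+x. ennreal (q x * \<bar>f x\<bar>) \<partial>M) \<le> ennreal (K * N f)"
proof -
  obtain A where A: "(\<integral>\<^sup>+x. \<kappa> x \<partial>M) = ennreal A" "0 \<le> A"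
    using fin by (metis ennreal_cases infinity_ennreal_def less_irrefl)
  have unit: "(\<integral>\<^sup>+x. ennreal (q x * \<bar>f x\<bar>) \<partial>M) \<le> ennreal (A + C)" if f: "f \<in> L" and "N f \<le> 1" for f
  proof -
    have [measurable]: "f \<in> borel_measurable M"
      using f by (rule L_measurable)
    have "(\<integral>\<^sup>+x. ennreal (q x * \<bar>f x\<bar>) \<partial>M) \<le> (\<integral>\<^sup>+x. \<kappa> x + ennreal (C * (w x * \<bar>f x\<bar> powr p)) \<partial>M)"
      by (intro nn_integral_mono_AE) (use le in \<open>auto elim!: eventually_mono\<close>)
    also have "\<dots> = ennreal A + (\<integral>\<^sup>+x. ennreal (C * (w x * \<bar>f x\<bar> powr p)) \<partial>M)"
      unfolding A(1)[symmetric] by (intro nn_integral_add) auto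
    also have "(\<integral>\<^sup>+x. ennreal (C * (w x * \<bar>f x\<bar> powr p)) \<partial>M) = ennreal C * ennreal (N f powr p)"
      unfolding nn_integral_N[OF f, symmetric] using C
      by (simp add: ennreal_mult' nn_integral_cmult)
    also have "ennreal A + ennreal C * ennreal (N f powr p) \<le> ennreal A + ennreal C * ennreal 1"
      using \<open>N f \<le> 1\<close> N_nonneg[of f] p1 powr_mono2[of p "N f" 1]
      by (intro add_left_mono mult_left_mono ennreal_leI) auto
    also have "\<dots> = ennreal (A + C)"
      using A(2) C by simp
    finally show ?thesis .
  qed
  show ?thesis
    by (rule exI[of _ "A + C"]) (use A C in \<open>auto intro!: bound_by_scaling[OF unit q q0]\<close>)
qed

lemma w_measurable_on:
  assumes "S \<subseteq> {a..b}"
  shows "w \<in> borel_measurable (lebesgue_on S)"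
proof -
  have "(\<lambda>x. if x \<in> I then w x else 0) \<in> borel_measurable lebesgue"
    using w_measurable by (subst borel_measurable_if) auto
  then have "(\<lambda>x. (if x \<in> I then w x else 0) + (indicator {a} x * w a + indicator {b} x * w b)) \<in> borel_measurable lebesgue"
    by (intro borel_measurable_add borel_measurable_times borel_measurable_indicator) auto
  then have "(\<lambda>x. (if x \<in> I then w x else 0) + (indicator {a} x * w a + indicator {b} x * w b)) \<in> borel_measurable (lebesgue_on S)"
    by (rule measurable_restrict_space1)
  then show ?thesis
    by (rule measurable_cong[THEN iffD1, rotated])
      (use assms ab in \<open>auto simp: space_restrict_space indicator_def dest!: subsetD\<close>)
qed

text \<open>
  The integrand whose integral, or whose essential supremum if \<open>p = 1\<close>, decides whether \<open>c\<close> is critical.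
\<close>

definition ratio :: "real \<Rightarrow> real \<Rightarrow> real \<Rightarrow> ennreal" where
  "ratio \<alpha> c x = (if p = 1 then ennreal (\<bar>x - c\<bar> powr \<alpha>) / ennreal (w x)
     else ennreal_powr (ennreal (\<bar>x - c\<bar> powr \<alpha>) / ennreal (w x powr (1 / p))) (p / (p - 1)))"

lemma crit_infinite_ratio:
  "crit_infinite a b p w \<alpha> c B \<longleftrightarrow> (if p = 1 then esssup (lebesgue_on ({a..b} \<inter> B)) (ratio \<alpha> c) = \<infinity>
     else (\<integral>\<^sup>+x. ratio \<alpha> c x \<partial>lebesgue_on ({a..b} \<inter> B)) = \<infinity>)"
  unfolding crit_infinite_def ratio_def[abs_def] by simp

lemma ratio_measurable_on:
  assumes "S \<subseteq> {a..b}"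
  shows "ratio \<alpha> c \<in> borel_measurable (lebesgue_on S)"
proof -
  note [measurable] = w_measurable_on[OF assms]
  have [measurable]: "(\<lambda>x. x) \<in> borel_measurable (lebesgue_on S)"
    by (intro measurable_restrict_space1 measurable_completion) simp
  show ?thesis
    unfolding ratio_def[abs_def] ennreal_powr_def by measurable
qed

lemma ratio_measurable [measurable]: "ratio \<alpha> c \<in> borel_measurable M"
  by (rule ratio_measurable_on) auto

lemma ident_measurable [measurable]: "(\<lambda>x. x) \<in> borel_measurable M"
  by (intro measurable_restrict_space1 measurable_completion) simp

lemma AE_lebesgue_on_iff:
  assumes "B \<in> sets lebesgue"
  shows "(AE x in lebesgue_on ({a..b} \<inter> B). P x) \<longleftrightarrow> (AE x in M. x \<in> B \<longrightarrow> P x)"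
proof -
  have [simp]: "{a..b} \<inter> B \<in> sets lebesgue"
    using assms by auto
  have "AE x in lebesgue. x \<noteq> a \<and> x \<noteq> b"
    using AE_completion[OF AE_lborel_singleton[of a]] AE_completion[OF AE_lborel_singleton[of b]] by auto
  then have "AE x in lebesgue. (x \<in> {a..b} \<inter> B \<longrightarrow> P x) = (x \<in> I \<longrightarrow> x \<in> B \<longrightarrow> P x)"
    by eventually_elim auto
  then show ?thesis
    by (subst (1 2) AE_restrict_space_iff) (simp_all add: eventually_subst)
qed

lemma nn_integral_lebesgue_on_eq:
  assumes "B \<in> sets lebesgue"
  shows "(\<integral>\<^sup>+x. f x \<partial>lebesgue_on ({a..b} \<inter> B)) = (\<integral>\<^sup>+x. f x * indicator B x \<partial>M)"
proof -
  have [simp]: "{a..b} \<inter> B \<in> sets lebesgue"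
    using assms by auto
  have "AE x in lebesgue. x \<noteq> a \<and> x \<noteq> b"
    using AE_completion[OF AE_lborel_singleton[of a]] AE_completion[OF AE_lborel_singleton[of b]] by auto
  then have "AE x in lebesgue. f x * indicator ({a..b} \<inter> B) x = f x * indicator B x * indicator I x"
    by eventually_elim (auto simp: indicator_def)
  then have "(\<integral>\<^sup>+x. f x * indicator ({a..b} \<inter> B) x \<partial>lebesgue) = (\<integral>\<^sup>+x. f x * indicator B x * indicator I x \<partial>lebesgue)"
    by (rule nn_integral_cong_AE)
  then show ?thesis
    by (simp add: nn_integral_restrict_space)
qed

text \<open>The two cases of the definition, freed of the endpoints and of the essential supremum.\<close>

lemma crit_infinite_iff:
  assumes "B \<in> sets lebesgue"
  shows "\<not> crit_infinite a b p w \<alpha> c B \<longleftrightarrow>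
    (if p = 1 then (\<exists>C\<ge>0. AE x in M. x \<in> B \<longrightarrow> ratio \<alpha> c x \<le> ennreal C)
     else (\<integral>\<^sup>+x. ratio \<alpha> c x * indicator B x \<partial>M) < \<infinity>)"
proof (cases "p = 1")
  case True
  let ?E = "esssup (lebesgue_on ({a..b} \<inter> B)) (ratio \<alpha> c)"
  have "?E \<noteq> \<infinity> \<longleftrightarrow> (\<exists>C\<ge>0. AE x in lebesgue_on ({a..b} \<inter> B). ratio \<alpha> c x \<le> ennreal C)"
  proof
    assume "?E \<noteq> \<infinity>"
    then obtain C where "?E = ennreal C" "0 \<le> C"
      by (metis ennreal_cases infinity_ennreal_def)
    then show "\<exists>C\<ge>0. AE x in lebesgue_on ({a..b} \<inter> B). ratio \<alpha> c x \<le> ennreal C"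
      using esssup_AE[where f = "ratio \<alpha> c" and M = "lebesgue_on ({a..b} \<inter> B)"] by auto
  next
    assume "\<exists>C\<ge>0. AE x in lebesgue_on ({a..b} \<inter> B). ratio \<alpha> c x \<le> ennreal C"
    then obtain C where "AE x in lebesgue_on ({a..b} \<inter> B). ratio \<alpha> c x \<le> ennreal C"
      by blast
    then have "?E \<le> ennreal C"
      by (intro esssup_I ratio_measurable_on) auto
    then show "?E \<noteq> \<infinity>"
      by (auto simp: top_unique)
  qed
  then show ?thesis
    unfolding crit_infinite_ratio if_P[OF True] by (simp only: AE_lebesgue_on_iff[OF assms])
next
  case False
  then show ?thesis
    by (simp add: crit_infinite_ratio nn_integral_lebesgue_on_eq[OF assms] less_top)
qed

lemma ratio_mono:
  assumes "\<alpha> \<le> \<beta>" "\<bar>x - c\<bar> \<le> 1"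
  shows "ratio \<beta> c x \<le> ratio \<alpha> c x"
proof -
  have "\<bar>x - c\<bar> powr \<beta> \<le> \<bar>x - c\<bar> powr \<alpha>"
    using assms by (cases "x = c") (auto intro!: powr_mono')
  then have le: "ennreal (\<bar>x - c\<bar> powr \<beta>) / t \<le> ennreal (\<bar>x - c\<bar> powr \<alpha>) / t" for t
    by (intro divide_right_mono_ennreal ennreal_leI)
  have mono: "ennreal_powr s (p / (p - 1)) \<le> ennreal_powr t (p / (p - 1))" if "s \<le> t" for s t
    using that p1 by (auto simp: ennreal_powr_def top_unique intro!: ennreal_leI powr_mono2 enn2real_mono
        simp: less_top)
  show ?thesis
    using le mono by (simp add: ratio_def)
qed

text \<open>
  Within distance \<open>1\<close> of \<open>c\<close> a larger exponent makes the ratio smaller.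
\<close>

lemma crit_antimono:
  assumes "\<alpha> \<le> \<beta>"
  shows "crit a b p w \<beta> \<subseteq> crit a b p w \<alpha>"
proof
  fix c assume c: "c \<in> crit a b p w \<beta>"
  have "crit_infinite a b p w \<alpha> c (ball c \<epsilon>)" if \<epsilon>: "0 < \<epsilon>" for \<epsilon>
  proof (rule ccontr)
    assume neg: "\<not> crit_infinite a b p w \<alpha> c (ball c \<epsilon>)"
    let ?B = "ball c (min \<epsilon> 1)"
    have B: "x \<in> ?B \<Longrightarrow> x \<in> ball c \<epsilon> \<and> ratio \<beta> c x \<le> ratio \<alpha> c x" for x
      using ratio_mono[OF assms, of x c] by (auto simp: dist_real_def abs_minus_commute)
    have "\<not> crit_infinite a b p w \<beta> c ?B"
    proof (cases "p = 1")
      case True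
      obtain C where "0 \<le> C" "AE x in M. x \<in> ball c \<epsilon> \<longrightarrow> ratio \<alpha> c x \<le> ennreal C"
        using neg crit_infinite_iff[of "ball c \<epsilon>" \<alpha> c] unfolding if_P[OF True] by auto
      then have "AE x in M. x \<in> ?B \<longrightarrow> ratio \<beta> c x \<le> ennreal C"
        using B by (auto elim!: eventually_mono intro: order_trans)
      with \<open>0 \<le> C\<close> show ?thesis
        using crit_infinite_iff[of ?B \<beta> c] unfolding if_P[OF True] by auto
    next
      case False
      have "(\<integral>\<^sup>+x. ratio \<beta> c x * indicator ?B x \<partial>M) \<le> (\<integral>\<^sup>+x. ratio \<alpha> c x * indicator (ball c \<epsilon>) x \<partial>M)"
        by (intro nn_integral_mono) (use B in \<open>auto simp: indicator_def\<close>)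
      also have "\<dots> < \<infinity>"
        using neg False by (subst (asm) crit_infinite_iff) auto
      finally show ?thesis
        using False by (subst crit_infinite_iff) auto
    qed
    moreover have "crit_infinite a b p w \<beta> c ?B"
      using c \<epsilon> unfolding crit_def by auto
    ultimately show False
      by blast
  qed
  then show "c \<in> crit a b p w \<alpha>"
    using c by (auto simp: crit_def)
qed

text \<open>
  For \<open>p > 1\<close>, Young's inequality is applied to \<open>\<bar>x - c\<bar> powr \<alpha> / w x powr (1 / p)\<close> and
  \<open>w x powr (1 / p) * \<bar>f x\<bar>\<close>. Where the weight vanishes, the ratio is infinite except at \<open>c\<close>,
  and nothing is to be shown.
\<close>

lemma noncritical_bound:
  assumes "\<not> crit_infinite a b p w \<alpha> c B" and B: "B \<in> sets lebesgue"
  obtains C where "0 \<le> C"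
    "\<And>f. f \<in> L \<Longrightarrow> (\<integral>\<^sup>+x. ennreal (indicator B x * \<bar>x - c\<bar> powr \<alpha> * \<bar>f x\<bar>) \<partial>M) \<le> ennreal (C * N f)"
proof -
  have BI: "B \<inter> I \<in> sets M"
    using B by (auto simp: sets_restrict_space)
  let ?q = "\<lambda>x. indicator (B \<inter> I) x * \<bar>x - c\<bar> powr \<alpha> :: real"
  have [measurable]: "(indicator (B \<inter> I) :: real \<Rightarrow> real) \<in> borel_measurable M"
    "(indicator (B \<inter> I) :: real \<Rightarrow> ennreal) \<in> borel_measurable M"
    using BI by (auto intro: borel_measurable_indicator)
  have q: "?q \<in> borel_measurable M"
    by measurable
  have q0: "0 \<le> ?q x" for x
    by simp
  have "\<exists>K\<ge>0. \<forall>f\<in>L. (\<integral>\<^sup>+x. ennreal (?q x * \<bar>f x\<bar>) \<partial>M) \<le> ennreal (K * N f)"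
  proof (cases "p = 1")
    case True
    obtain C where C: "0 \<le> C" and le: "AE x in M. x \<in> B \<longrightarrow> ratio \<alpha> c x \<le> ennreal C"
      using assms(1) unfolding crit_infinite_iff[OF B] if_P[OF True] by auto
    have rx: "ratio \<alpha> c x = ennreal (\<bar>x - c\<bar> powr \<alpha>) / ennreal (w x)" for x
      unfolding ratio_def if_P[OF True] by (rule refl)
    have "AE x in M. \<forall>y\<ge>0. ennreal (?q x * y) \<le> 0 + ennreal (C * (w x * y powr p))"
      using le w_nonneg
    proof eventually_elim
      case (elim x)
      show ?case
      proof (intro allI impI)
        fix y :: real assume y: "0 \<le> y"
        have "\<bar>x - c\<bar> powr \<alpha> \<le> C * w x" if "x \<in> B"
        proof (cases "w x = 0")
          case True
          then show ?thesis
            using elim(1) that C by (auto simp: rx ennreal_divide_zero top_unique split: if_splits)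
        next
          case False
          then have "ennreal (\<bar>x - c\<bar> powr \<alpha> / w x) \<le> ennreal C"
            using elim that by (simp add: rx divide_ennreal)
          then show ?thesis
            using False elim C by (simp add: divide_le_eq ennreal_le_iff)
        qed
        then have "?q x * y \<le> C * w x * y"
          using y elim C by (auto simp: indicator_def mult_right_mono)
        then show "ennreal (?q x * y) \<le> 0 + ennreal (C * (w x * y powr p))"
          using True y by (auto intro!: ennreal_leI simp: mult.assoc)
      qed
    qed
    then show ?thesis
      by (intro bound_by_pointwise[of "\<lambda>_. 0", OF _ _ q q0 C]) auto
  next
    case False
    then have p: "1 < p"
      using p1 by simp
    let ?\<kappa> = "\<lambda>x. ratio \<alpha> c x * indicator (B \<inter> I) x"
    have "(\<integral>\<^sup>+x. ?\<kappa> x \<partial>M) = (\<integral>\<^sup>+x. ratio \<alpha> c x * indicator B x \<partial>M)"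
      by (intro nn_integral_cong) (auto simp: indicator_def)
    also have "\<dots> < \<infinity>"
      using assms(1) False by (simp add: crit_infinite_iff[OF B])
    finally have fin: "(\<integral>\<^sup>+x. ?\<kappa> x \<partial>M) < \<infinity>" .
    have "AE x in M. \<forall>y\<ge>0. ennreal (?q x * y) \<le> ?\<kappa> x + ennreal (1 * (w x * y powr p))"
      using w_nonneg
    proof eventually_elim
      case (elim x)
      show ?case
      proof (intro allI impI)
        fix y :: real assume y: "0 \<le> y"
        let ?d = "\<bar>x - c\<bar> powr \<alpha>"
        show "ennreal (?q x * y) \<le> ?\<kappa> x + ennreal (1 * (w x * y powr p))"
        proof (cases "x \<in> B \<inter> I \<and> ?d \<noteq> 0")
          case dB: True
          show ?thesis
          proof (cases "w x = 0")
            case True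
            then have "?\<kappa> x = \<infinity>"
              using dB False by (auto simp: ratio_def ennreal_powr_def ennreal_divide_zero)
            then show ?thesis
              by simp
          next
            case False
            then have w0: "0 < w x"
              using elim by simp
            have q1: "1 < p / (p - 1)" "1 / (p / (p - 1)) + 1 / p = 1"
              using p by (simp_all add: field_simps)
            have "?d * y = (?d / w x powr (1 / p)) * (w x powr (1 / p) * y)"
              using w0 by simp
            also have "\<dots> \<le> (?d / w x powr (1 / p)) powr (p / (p - 1)) / (p / (p - 1)) + (w x powr (1 / p) * y) powr p / p"
              using w0 y by (intro Youngs_inequality q1 p) auto
            also have "\<dots> \<le> (?d / w x powr (1 / p)) powr (p / (p - 1)) / 1 + (w x powr (1 / p) * y) powr p / 1"
              using q1 p by (intro add_mono divide_left_mono) auto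
            also have "(w x powr (1 / p) * y) powr p = w x * y powr p"
              using w0 y p by (simp add: powr_mult powr_powr)
            finally have "ennreal (?d * y) \<le> ennreal ((?d / w x powr (1 / p)) powr (p / (p - 1))) + ennreal (w x * y powr p)"
              using w0 by (simp add: ennreal_leI flip: ennreal_plus)
            also have "ennreal ((?d / w x powr (1 / p)) powr (p / (p - 1))) = ?\<kappa> x"
              using dB w0 \<open>p \<noteq> 1\<close> by (simp add: ratio_def ennreal_powr_def divide_ennreal)
            finally show ?thesis
              using dB by simp
          qed
        qed auto
      qed
    qed
    then show ?thesis
      by (intro bound_by_pointwise[of ?\<kappa> ?q 1, OF _ fin q q0]) auto
  qed
  then obtain K where K: "0 \<le> K" "\<And>f. f \<in> L \<Longrightarrow> (\<integral>\<^sup>+x. ennreal (?q x * \<bar>f x\<bar>) \<partial>M) \<le> ennreal (K * N f)"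
    by blast
  have eq: "(\<integral>\<^sup>+x. ennreal (indicator B x * \<bar>x - c\<bar> powr \<alpha> * \<bar>f x\<bar>) \<partial>M) = (\<integral>\<^sup>+x. ennreal (?q x * \<bar>f x\<bar>) \<partial>M)" for f
    by (intro nn_integral_cong) (auto simp: indicator_def)
  show thesis
    using that[of K] K unfolding eq by blast
qed

section \<open>Uniqueness of the weak derivatives\<close>

text \<open>
  Measurable functions are limits almost everywhere of continuous functions. Truncation preserves the
  bound, the Weierstrass theorem makes the functions polynomials, and the cutoff restores the support.
\<close>

lemma smooth_approximation:
  assumes f: "f \<in> borel_measurable M" and B: "\<And>x. x \<in> I \<Longrightarrow> \<bar>f x\<bar> \<le> B" "0 \<le> B"
    and \<kappa>: "smooth \<kappa>" "\<And>x. 0 \<le> \<kappa> x" "\<And>x. \<kappa> x \<le> 1" "\<And>x. x \<in> I \<Longrightarrow> f x \<noteq> 0 \<Longrightarrow> \<kappa> x = 1"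
  obtains g :: "nat \<Rightarrow> real \<Rightarrow> real" where "\<And>n. smooth (g n)" "\<And>n x. x \<in> I \<Longrightarrow> \<bar>g n x\<bar> \<le> B + 1"
    "\<And>n x. \<kappa> x = 0 \<Longrightarrow> g n x = 0" "AE x in M. (\<lambda>n. g n x) \<longlonglongrightarrow> f x"
proof -
  have "f measurable_on I"
    using f by (subst measurable_on_iff_borel_measurable) auto
  then obtain E h where E: "negligible E" and h: "\<And>n. continuous_on UNIV (h n)"
    "\<And>x. x \<notin> E \<Longrightarrow> (\<lambda>n. h n x) \<longlonglongrightarrow> (if x \<in> I then f x else 0)"
    unfolding measurable_on_def by blast
  define c where "c = (\<lambda>(n::nat) x. max (- B) (min B (h n x)))"
  have "\<exists>q. real_polynomial_function q \<and> (\<forall>x\<in>{a..b}. \<bar>c n x - q x\<bar> < 1 / Suc n)" for n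
  proof -
    have "continuous_on {a..b} (c n)"
      unfolding c_def by (intro continuous_intros continuous_on_subset[OF h(1)]) auto
    from Stone_Weierstrass_real_polynomial_function[OF compact_Icc this, of "1 / Suc n"]
    show ?thesis
      by (metis of_nat_0_less_iff zero_less_Suc zero_less_divide_1_iff)
  qed
  then obtain q where q: "\<And>n. real_polynomial_function (q n)" "\<And>n x. x \<in> {a..b} \<Longrightarrow> \<bar>c n x - q n x\<bar> < 1 / Suc n"
    by metis
  have c: "\<bar>c n x\<bar> \<le> B" for n x
    using B(2) by (auto simp: c_def)
  show thesis
  proof
    show "smooth (\<lambda>x. \<kappa> x * q n x)" for n
      by (intro smooth_mult \<kappa> smooth_polynomial q)
    show "\<kappa> x * q n x = 0" if "\<kappa> x = 0" for n x
      using that by simp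
    show "\<bar>\<kappa> x * q n x\<bar> \<le> B + 1" if "x \<in> I" for n x
    proof -
      have "\<bar>c n x - q n x\<bar> < 1 / real (Suc n)"
        using q(2)[of x n] that by auto
      also have "\<dots> \<le> 1"
        by simp
      finally have "\<bar>q n x\<bar> \<le> B + 1"
        using c[of n x] by linarith
      then show ?thesis
        using \<kappa>(2,3)[of x] mult_mono[of "\<kappa> x" 1 "\<bar>q n x\<bar>" "B + 1"] B(2) by (simp add: abs_mult)
    qed
    have "AE x in lebesgue. x \<notin> E"
      using E by (simp add: negligible_iff_null_sets AE_not_in)
    then have "AE x in M. x \<notin> E"
      by (subst AE_restrict_space_iff) (auto elim: eventually_mono)
    moreover have "AE x in M. x \<in> I"
      by (rule AE_I2) simp
    ultimately show "AE x in M. (\<lambda>n. \<kappa> x * q n x) \<longlonglongrightarrow> f x"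
    proof eventually_elim
      case (elim x)
      have "(\<lambda>n. c n x) \<longlonglongrightarrow> max (- B) (min B (f x))"
        unfolding c_def using h(2)[OF elim(1)] elim(2) by (auto intro!: tendsto_max tendsto_min)
      also have "max (- B) (min B (f x)) = f x"
        using B(1)[OF elim(2)] by (auto simp: max_def min_def)
      finally have "(\<lambda>n. c n x) \<longlonglongrightarrow> f x" .
      moreover have "(\<lambda>n. q n x - c n x) \<longlonglongrightarrow> 0"
        by (rule tendsto_0_le[OF LIMSEQ_inverse_real_of_nat, of _ 1])
          (use q(2)[of x] elim(2) in \<open>auto intro!: always_eventually less_imp_le simp: abs_minus_commute inverse_eq_divide\<close>)
      ultimately have "(\<lambda>n. c n x + (q n x - c n x)) \<longlonglongrightarrow> f x + 0"
        by (rule tendsto_add)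
      then have "(\<lambda>n. \<kappa> x * q n x) \<longlonglongrightarrow> \<kappa> x * f x"
        by (intro tendsto_mult tendsto_const) simp
      then show ?case
        using \<kappa>(4)[OF elim(2)] by (cases "f x = 0") auto
    qed
  qed
qed

lemma continuous_integrable:
  fixes f :: "real \<Rightarrow> real"
  assumes "continuous_on {a..b} f"
  shows "integrable M f" "(\<integral>x. f x \<partial>M) = integral {a..b} f"
proof -
  have "integrable (lebesgue_on {a..b}) f"
    by (intro continuous_imp_integrable_real assms)
  then have "set_integrable lebesgue {a..b} f"
    by (simp add: integrable_restrict_space set_integrable_def)
  then have "set_integrable lebesgue I f"
    by (rule set_integrable_subset) auto
  then show int: "integrable M f"
    by (simp add: integrable_restrict_space set_integrable_def)
  have "(\<integral>x. f x \<partial>M) = integral I f"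
    by (rule lebesgue_integral_eq_integral[OF int]) auto
  then show "(\<integral>x. f x \<partial>M) = integral {a..b} f"
    by (simp add: integral_open_interval_real)
qed

lemma smooth_integrable: "smooth f \<Longrightarrow> integrable M f"
  by (intro continuous_integrable smooth_continuous_on)

lemma integration_by_parts:
  assumes "smooth f" "smooth g" "g a = 0" "g b = 0"
  shows "(\<integral>x. deriv f x * g x \<partial>M) = - (\<integral>x. f x * deriv g x \<partial>M)"
proof -
  have der: "((\<lambda>x. f x * g x) has_real_derivative deriv f x * g x + f x * deriv g x) (at x)" for x
    using smooth_DERIV_0[OF assms(1)] smooth_DERIV_0[OF assms(2)] by (auto intro!: derivative_eq_intros)
  have "((\<lambda>x. deriv f x * g x + f x * deriv g x) has_integral f b * g b - f a * g a) {a..b}"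
    by (rule fundamental_theorem_of_calculus)
      (use ab der in \<open>auto simp: has_real_derivative_iff_has_vector_derivative[symmetric] has_field_derivative_at_within\<close>)
  then have "((\<lambda>x. deriv f x * g x + f x * deriv g x) has_integral 0) I"
    using assms by (simp add: has_integral_Icc_iff_Ioo)
  moreover have int: "integrable M (\<lambda>x. deriv f x * g x)" "integrable M (\<lambda>x. f x * deriv g x)"
    by (intro smooth_integrable smooth_mult smooth_deriv assms)+
  ultimately have "(\<integral>x. deriv f x * g x + f x * deriv g x \<partial>M) = 0"
    by (subst lebesgue_integral_eq_integral) (auto dest: integral_unique)
  then show ?thesis
    using int by simp
qed

text \<open>
  Where convergence in \<open>L\<close> controls convergence in \<open>L\<^sup>1\<close>, the limit of the derivatives of a null
  sequence vanishes as a distribution.  It is tested against smooth approximations of its sign.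
\<close>

lemma limit_of_derivatives_zero_inside:
  assumes J: "{c - l<..<c + l} \<subseteq> I" and r: "0 < r" "r < l"
    and K: "0 \<le> K" "\<And>f. f \<in> L \<Longrightarrow> (\<integral>\<^sup>+x. ennreal (indicator {c - l<..<c + l} x * \<bar>f x\<bar>) \<partial>M) \<le> ennreal (K * N f)"
    and \<phi>: "\<And>h::nat. smooth (\<phi> h)" and z: "z \<in> L"
    and lim: "(\<lambda>h. N (\<phi> h)) \<longlonglongrightarrow> 0" "(\<lambda>h. N (\<lambda>x. deriv (\<phi> h) x - z x)) \<longlonglongrightarrow> 0"
  shows "AE x in M. \<bar>x - c\<bar> \<le> r \<longrightarrow> z x = 0"
proof -
  let ?J = "{c - l<..<c + l}"
  have [measurable]: "z \<in> borel_measurable M"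
    using z by (rule L_measurable)
  have "{x. \<bar>x - c\<bar> \<le> r} = cball c r"
    by (auto simp: dist_real_def abs_minus_commute)
  then have [measurable]: "?J \<in> sets M" "{x. \<bar>x - c\<bar> \<le> r} \<inter> I \<in> sets M"
    using J by (auto simp: sets_restrict_space_iff)
  have int_J: "integrable M (\<lambda>x. indicator ?J x * f x)" and bound_J: "(\<integral>x. \<bar>indicator ?J x * f x\<bar> \<partial>M) \<le> K * N f"
    if f: "f \<in> L" for f
  proof -
    have [measurable]: "f \<in> borel_measurable M"
      using f by (rule L_measurable)
    have le: "(\<integral>\<^sup>+x. ennreal (norm (indicator ?J x * f x)) \<partial>M) \<le> ennreal (K * N f)"
      using K(2)[OF f] by (simp add: abs_mult)
    then show int: "integrable M (\<lambda>x. indicator ?J x * f x)"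
      by (auto simp: integrable_iff_bounded intro: le_less_trans)
    show "(\<integral>x. \<bar>indicator ?J x * f x\<bar> \<partial>M) \<le> K * N f"
      using le nn_integral_eq_integral[OF integrable_abs[OF int]] K(1) N_nonneg[of f] by (simp add: ennreal_le_iff)
  qed
  have test: "(\<integral>x. z x * g x \<partial>M) = 0" if g: "smooth g" and g0: "\<And>x. R \<le> \<bar>x - c\<bar> \<Longrightarrow> g x = 0" and R: "R < l" for g R
  proof -
    have dg0: "deriv g x = 0" if "x \<notin> ?J" for x
    proof -
      have "(deriv ^^ 1) g x = (deriv ^^ 1) (\<lambda>_. 0) x"
        by (rule deriv_iter_cong_open[where S = "- cball c R"])
          (use g0 that R in \<open>auto simp: dist_real_def abs_minus_commute abs_le_iff\<close>)
      then show ?thesis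
        by simp
    qed
    have g_J: "g x = 0" if "x \<notin> ?J" for x
      using g0[of x] that R by (auto simp: abs_le_iff not_less)
    obtain B where B: "\<And>x. x \<in> I \<Longrightarrow> \<bar>g x\<bar> \<le> B" "\<And>x. x \<in> I \<Longrightarrow> \<bar>deriv g x\<bar> \<le> B" "0 \<le> B"
    proof -
      have "\<exists>B. \<forall>x\<in>{a..b}. \<bar>f x\<bar> \<le> B" if "smooth f" for f
        using compact_imp_bounded[OF compact_continuous_image[OF smooth_continuous_on[OF that] compact_Icc[of a b]]]
        unfolding bounded_iff by auto
      from this[OF g] this[OF smooth_deriv[OF g]] obtain B1 B2 where
        "\<forall>x\<in>{a..b}. \<bar>g x\<bar> \<le> B1" "\<forall>x\<in>{a..b}. \<bar>deriv g x\<bar> \<le> B2"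
        by blast
      then show thesis
        by (intro that[of "max 0 (max B1 B2)"]) (auto simp: le_max_iff_disj)
    qed
    have [measurable]: "g \<in> borel_measurable M" "deriv g \<in> borel_measurable M"
      using smooth_integrable[OF g] smooth_integrable[OF smooth_deriv[OF g]] by auto
    have prod: "integrable M (\<lambda>x. f x * k x)" and prod_le: "\<bar>\<integral>x. f x * k x \<partial>M\<bar> \<le> B * (K * N f)"
      if f: "f \<in> L" and [measurable]: "k \<in> borel_measurable M"
        and k: "\<And>x. x \<in> I \<Longrightarrow> \<bar>k x\<bar> \<le> B" "\<And>x. x \<notin> ?J \<Longrightarrow> k x = 0" for f k
    proof -
      have [measurable]: "f \<in> borel_measurable M"
        using f by (rule L_measurable)
      have le: "AE x in M. \<bar>f x * k x\<bar> \<le> B * \<bar>indicator ?J x * f x\<bar>"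
        using k B(3) by (intro AE_I2) (auto simp: indicator_def abs_mult mult.commute[of B] intro!: mult_left_mono)
      show int: "integrable M (\<lambda>x. f x * k x)"
        by (rule Bochner_Integration.integrable_bound[OF integrable_mult_right[OF integrable_abs[OF int_J[OF f]], of B]])
          (use le B(3) in \<open>auto elim!: eventually_mono\<close>)
      have "\<bar>\<integral>x. f x * k x \<partial>M\<bar> \<le> (\<integral>x. \<bar>f x * k x\<bar> \<partial>M)"
        by (rule integral_abs_bound)
      also have "\<dots> \<le> (\<integral>x. B * \<bar>indicator ?J x * f x\<bar> \<partial>M)"
        by (intro integral_mono_AE integrable_abs int integrable_mult_right int_J f le)
      also have "\<dots> \<le> B * (K * N f)"
        using bound_J[OF f] B(3) by (simp add: mult_left_mono)
      finally show "\<bar>\<integral>x. f x * k x \<partial>M\<bar> \<le> B * (K * N f)" .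
    qed
    have le: "\<bar>\<integral>x. z x * g x \<partial>M\<bar> \<le> B * (K * N (\<lambda>x. deriv (\<phi> h) x - z x)) + B * (K * N (\<phi> h))" for h
    proof -
      have dL: "deriv (\<phi> h) \<in> L" "\<phi> h \<in> L"
        by (intro smooth_L smooth_deriv \<phi>)+
      have "a \<notin> ?J" "b \<notin> ?J"
        using J by auto
      then have "(\<integral>x. deriv (\<phi> h) x * g x \<partial>M) = - (\<integral>x. \<phi> h x * deriv g x \<partial>M)"
        by (intro integration_by_parts \<phi> g g_J)
      moreover have "(\<integral>x. (deriv (\<phi> h) x - z x) * g x \<partial>M) = (\<integral>x. deriv (\<phi> h) x * g x \<partial>M) - (\<integral>x. z x * g x \<partial>M)"
        unfolding left_diff_distrib
        by (intro Bochner_Integration.integral_diff prod dL z B g_J) auto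
      moreover have "\<bar>\<integral>x. (deriv (\<phi> h) x - z x) * g x \<partial>M\<bar> \<le> B * (K * N (\<lambda>x. deriv (\<phi> h) x - z x))"
        by (intro prod_le L_diff dL z B g_J) auto
      moreover have "\<bar>\<integral>x. \<phi> h x * deriv g x \<partial>M\<bar> \<le> B * (K * N (\<phi> h))"
        by (intro prod_le dL B dg0) auto
      ultimately show ?thesis
        by linarith
    qed
    have "(\<lambda>h. B * (K * N (\<lambda>x. deriv (\<phi> h) x - z x)) + B * (K * N (\<phi> h))) \<longlonglongrightarrow> B * (K * 0) + B * (K * 0)"
      by (intro tendsto_intros lim)
    then have "\<bar>\<integral>x. z x * g x \<partial>M\<bar> \<le> B * (K * 0) + B * (K * 0)"
      by (rule LIMSEQ_le_const) (use le in auto)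
    then show ?thesis
      by simp
  qed
  define R where "R = (r + l) / 2"
  have R: "r < R" "R < l"
    using r by (auto simp: R_def)
  obtain \<kappa> where \<kappa>: "\<kappa> \<in> test_functions" "\<And>x. \<bar>x - c\<bar> \<le> r \<Longrightarrow> \<kappa> x = 1"
    "\<And>x. R \<le> \<bar>x - c\<bar> \<Longrightarrow> \<kappa> x = 0" "\<And>x. 0 \<le> \<kappa> x" "\<And>x. \<kappa> x \<le> 1"
    using cutoff_exists[OF R(1)] by blast
  define S where "S = (\<lambda>x. indicator ({x. \<bar>x - c\<bar> \<le> r} \<inter> I) x * sgn (z x))"
  have S: "S \<in> borel_measurable M" "\<And>x. x \<in> I \<Longrightarrow> \<bar>S x\<bar> \<le> 1" "\<And>x. x \<in> I \<Longrightarrow> S x \<noteq> 0 \<Longrightarrow> \<kappa> x = 1"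
    unfolding S_def using \<kappa>(2) by (auto simp: indicator_def abs_sgn_eq)
  obtain g where g: "\<And>n. smooth (g n)" "\<And>n x. x \<in> I \<Longrightarrow> \<bar>g n x\<bar> \<le> 1 + 1"
    "\<And>n x. \<kappa> x = 0 \<Longrightarrow> g n x = 0" "AE x in M. (\<lambda>n. g n x) \<longlonglongrightarrow> S x"
    by (rule smooth_approximation[OF S(1,2) _ test_smooth[OF \<kappa>(1)] \<kappa>(4,5) S(3)]) auto
  have [measurable]: "g n \<in> borel_measurable M" for n
    using smooth_integrable[OF g(1)] by auto
  have "(\<lambda>n. \<integral>x. z x * g n x \<partial>M) \<longlonglongrightarrow> (\<integral>x. z x * S x \<partial>M)"
  proof (rule integral_dominated_convergence[where w = "\<lambda>x. 2 * \<bar>indicator ?J x * z x\<bar>"])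
    show "integrable M (\<lambda>x. 2 * \<bar>indicator ?J x * z x\<bar>)"
      by (intro integrable_mult_right integrable_abs int_J z)
    show "AE x in M. (\<lambda>n. z x * g n x) \<longlonglongrightarrow> z x * S x"
      using g(4) by eventually_elim (auto intro: tendsto_mult)
    show "AE x in M. norm (z x * g n x) \<le> 2 * \<bar>indicator ?J x * z x\<bar>" for n
    proof (rule AE_I2)
      fix x assume "x \<in> space M"
      then have "\<bar>g n x\<bar> \<le> 2" "x \<notin> ?J \<Longrightarrow> g n x = 0"
        using g(2)[of x n] g(3)[OF \<kappa>(3)[of x], of n] R by (auto simp: abs_le_iff not_less)
      then show "norm (z x * g n x) \<le> 2 * \<bar>indicator ?J x * z x\<bar>"
        by (auto simp: indicator_def abs_mult mult.commute[of 2] intro!: mult_left_mono)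
    qed
    show "(\<lambda>x. z x * S x) \<in> borel_measurable M"
      using S(1) by measurable
  qed measurable
  moreover have "(\<integral>x. z x * g n x \<partial>M) = 0" for n
    by (rule test[OF g(1) _ R(2)]) (use g(3) \<kappa>(3) in auto)
  ultimately have zero: "(\<integral>x. z x * S x \<partial>M) = 0"
    by (simp add: LIMSEQ_const_iff)
  have zS: "z x * S x = \<bar>indicator ({x. \<bar>x - c\<bar> \<le> r} \<inter> I) x * (indicator ?J x * z x)\<bar>" for x
    using r by (auto simp: S_def indicator_def abs_sgn abs_le_iff)
  have "integrable M (\<lambda>x. \<bar>indicator ({x. \<bar>x - c\<bar> \<le> r} \<inter> I) x * (indicator ?J x * z x)\<bar>)"
    by (rule Bochner_Integration.integrable_bound[OF integrable_abs[OF int_J[OF z]]])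
      (auto simp: indicator_def)
  then have "integrable M (\<lambda>x. z x * S x)"
    by (simp add: zS)
  then have "AE x in M. z x * S x = 0"
    using zero integral_nonneg_eq_0_iff_AE[of M "\<lambda>x. z x * S x"] by (simp add: zS)
  moreover have "AE x in M. x \<in> I"
    by (rule AE_I2) simp
  ultimately show ?thesis
    by eventually_elim (auto simp: S_def indicator_def sgn_zero_iff)
qed

text \<open>
  The interval is exhausted by compact subintervals.
\<close>

lemma limit_of_derivatives_zero:
  assumes J: "{s<..<t} \<subseteq> I"
    and K: "\<exists>K\<ge>0. \<forall>f\<in>L. (\<integral>\<^sup>+x. ennreal (indicator {s<..<t} x * \<bar>f x\<bar>) \<partial>M) \<le> ennreal (K * N f)"
    and \<phi>: "\<And>h::nat. smooth (\<phi> h)" and z: "z \<in> L"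
    and lim: "(\<lambda>h. N (\<phi> h)) \<longlonglongrightarrow> 0" "(\<lambda>h. N (\<lambda>x. deriv (\<phi> h) x - z x)) \<longlonglongrightarrow> 0"
  shows "AE x in M. x \<in> {s<..<t} \<longrightarrow> z x = 0"
proof (cases "s < t")
  case True
  define c l where "c = (s + t) / 2" and "l = (t - s) / 2"
  have st: "{s<..<t} = {c - l<..<c + l}" and l: "0 < l"
    using True by (auto simp: c_def l_def field_simps)
  have "AE x in M. \<forall>n::nat. \<bar>x - c\<bar> \<le> l * (1 - 1 / (real n + 2)) \<longrightarrow> z x = 0"
    unfolding AE_all_countable
  proof
    fix n :: nat
    have pos: "0 < 1 - 1 / (real n + 2)" "1 - 1 / (real n + 2) < 1"
      by (auto simp: field_simps)
    then have "0 < l * (1 - 1 / (real n + 2))" "l * (1 - 1 / (real n + 2)) < l"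
      using l by auto
    then show "AE x in M. \<bar>x - c\<bar> \<le> l * (1 - 1 / (real n + 2)) \<longrightarrow> z x = 0"
      using limit_of_derivatives_zero_inside[OF _ _ _ _ _ \<phi> z lim] K J unfolding st by blast
  qed
  then show ?thesis
  proof eventually_elim
    case (elim x)
    show ?case
    proof
      assume "x \<in> {s<..<t}"
      then have "\<bar>x - c\<bar> < l"
        unfolding st by (auto simp: abs_less_iff)
      moreover have "(\<lambda>n. l * (1 - 1 / (real n + 2))) \<longlonglongrightarrow> l * (1 - 0)"
        by (intro tendsto_intros LIMSEQ_ignore_initial_segment[OF lim_1_over_n, of 2, unfolded of_nat_add of_nat_numeral])
      ultimately have "eventually (\<lambda>n. \<bar>x - c\<bar> < l * (1 - 1 / (real n + 2))) sequentially"
        by (intro order_tendstoD) auto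
      then show "z x = 0"
        using elim by (metis (mono_tags, lifting) eventually_happens' less_imp_le sequentially_bot)
    qed
  qed
qed simp

text \<open>
  Consider the points whose null neighbourhood on the right contains a fixed rational \<open>q\<close>. The
  neighbourhoods of a sequence of such points that tends to their infimum cover all of them except
  the infimum itself, so they form a null set. There are countably many \<open>q\<close>.
\<close>

lemma negligible_one_sided:
  fixes Z :: "real set"
  assumes Z: "Z \<subseteq> I"
    and one_sided: "\<And>x. x \<in> Z \<Longrightarrow> \<exists>r>0. negligible (Z \<inter> {x<..<x + r}) \<or> negligible (Z \<inter> {x - r<..<x})"
  shows "negligible Z"
proof -
  define A where "A = (\<lambda>q::rat. {x \<in> Z. x < of_rat q \<and> negligible (Z \<inter> {x<..<of_rat q})})"
  define B where "B = (\<lambda>q::rat. {x \<in> Z. of_rat q < x \<and> negligible (Z \<inter> {of_rat q<..<x})})"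
  have A: "negligible (A q)" for q
  proof (cases "A q = {}")
    case False
    have bdd: "bdd_below (A q)"
      using Z by (intro bdd_belowI[of _ a]) (auto simp: A_def)
    have "\<exists>y\<in>A q. y < Inf (A q) + 1 / Suc n" for n
    proof -
      have "Inf (A q) < Inf (A q) + 1 / Suc n"
        by simp
      then show ?thesis
        using cInf_less_iff[OF False bdd] by blast
    qed
    then obtain y where y: "\<And>n. y n \<in> A q" "\<And>n. y n < Inf (A q) + 1 / Suc n"
      by metis
    have "A q \<subseteq> {Inf (A q)} \<union> (\<Union>n. Z \<inter> {y n<..<of_rat q})"
    proof
      fix x assume x: "x \<in> A q"
      show "x \<in> {Inf (A q)} \<union> (\<Union>n. Z \<inter> {y n<..<of_rat q})"
      proof (cases "x = Inf (A q)")
        case False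
        then have "0 < x - Inf (A q)"
          using cInf_lower[OF x bdd] by simp
        then obtain n where "1 / Suc n < x - Inf (A q)"
          using nat_approx_posE by blast
        then have "y n < x"
          using y(2)[of n] by linarith
        then show ?thesis
          using x by (auto simp: A_def)
      qed simp
    qed
    moreover have "negligible (\<Union>n. Z \<inter> {y n<..<of_rat q})"
      by (rule negligible_Union_nat) (use y(1) in \<open>auto simp: A_def\<close>)
    ultimately show ?thesis
      by (meson negligible_Un negligible_sing negligible_subset)
  qed simp
  have B: "negligible (B q)" for q
  proof (cases "B q = {}")
    case False
    have bdd: "bdd_above (B q)"
      using Z by (intro bdd_aboveI[of _ b]) (auto simp: B_def)
    have "\<exists>y\<in>B q. Sup (B q) - 1 / Suc n < y" for n
    proof -
      have "Sup (B q) - 1 / Suc n < Sup (B q)"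
        by simp
      then show ?thesis
        using less_cSup_iff[OF False bdd] by blast
    qed
    then obtain y where y: "\<And>n. y n \<in> B q" "\<And>n. Sup (B q) - 1 / Suc n < y n"
      by metis
    have "B q \<subseteq> {Sup (B q)} \<union> (\<Union>n. Z \<inter> {of_rat q<..<y n})"
    proof
      fix x assume x: "x \<in> B q"
      show "x \<in> {Sup (B q)} \<union> (\<Union>n. Z \<inter> {of_rat q<..<y n})"
      proof (cases "x = Sup (B q)")
        case False
        then have "0 < Sup (B q) - x"
          using cSup_upper[OF x bdd] by simp
        then obtain n where "1 / Suc n < Sup (B q) - x"
          using nat_approx_posE by blast
        then have "x < y n"
          using y(2)[of n] by linarith
        then show ?thesis
          using x by (auto simp: B_def)
      qed simp
    qed
    moreover have "negligible (\<Union>n. Z \<inter> {of_rat q<..<y n})"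
      by (rule negligible_Union_nat) (use y(1) in \<open>auto simp: B_def\<close>)
    ultimately show ?thesis
      by (meson negligible_Un negligible_sing negligible_subset)
  qed simp
  have "Z \<subseteq> \<Union>(range A \<union> range B)"
  proof
    fix x assume x: "x \<in> Z"
    from one_sided[OF this] obtain r where r: "0 < r"
      "negligible (Z \<inter> {x<..<x + r}) \<or> negligible (Z \<inter> {x - r<..<x})"
      by blast
    obtain q q' :: rat where q: "x < of_rat q" "of_rat q < x + r" "x - r < of_rat q'" "of_rat q' < x"
      using of_rat_dense[of x "x + r"] of_rat_dense[of "x - r" x] r(1) by auto
    from r(2) show "x \<in> \<Union>(range A \<union> range B)"
    proof
      assume "negligible (Z \<inter> {x<..<x + r})"
      then have "negligible (Z \<inter> {x<..<of_rat q})"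
        by (rule negligible_subset) (use q in auto)
      then have "x \<in> A q"
        using x q by (simp add: A_def)
      then show ?thesis
        by blast
    next
      assume "negligible (Z \<inter> {x - r<..<x})"
      then have "negligible (Z \<inter> {of_rat q'<..<x})"
        by (rule negligible_subset) (use q in auto)
      then have "x \<in> B q'"
        using x q by (simp add: B_def)
      then show ?thesis
        by blast
    qed
  qed
  moreover have "negligible (\<Union>(range A \<union> range B))"
    by (rule negligible_countable_Union) (use A B in auto)
  ultimately show ?thesis
    by (rule negligible_subset[rotated])
qed

end

locale stable_interval = weighted_interval +
  assumes stable: "stable_weight a b p w"
begin

lemma AE_M_iff_negligible: "(AE x in M. P x) \<longleftrightarrow> negligible {x \<in> I. \<not> P x}"
proof -
  have "(AE x in M. P x) \<longleftrightarrow> (AE x in lebesgue. x \<in> I \<longrightarrow> P x)"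
    by (subst AE_restrict_space_iff) auto
  also have "\<dots> \<longleftrightarrow> {x. \<not> (x \<in> I \<longrightarrow> P x)} \<in> null_sets lebesgue"
    by (simp add: AE_iff_null_sets completion.AE_iff_null_sets[symmetric] eventually_ae_filter)
      (metis (no_types, lifting) AE_I' AE_E3 completion.complete2 space_completion UNIV_I mem_Collect_eq subsetI null_sets_completion_subset space_lborel)
  finally show ?thesis
    by (simp add: negligible_iff_null_sets)
qed

text \<open>
  On the side where the weight is monotone, it vanishes up to some point and is bounded away from
  zero beyond each later point; there \<open>y \<le> 1 + y powr p\<close> controls the \<open>L\<^sup>1\<close> norm.
\<close>

lemma limit_zero_where_monotone:
  assumes J: "{s<..<t} \<subseteq> I" and x0: "x0 \<le> s \<or> t \<le> x0"
    and w': "AE x in M. w' x = w x"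
    and mono: "\<And>x y. x \<in> {s<..<t} \<Longrightarrow> y \<in> {s<..<t} \<Longrightarrow> \<bar>x - x0\<bar> \<le> \<bar>y - x0\<bar> \<Longrightarrow> w' x \<le> w' y"
    and \<phi>: "\<And>h::nat. smooth (\<phi> h)" and z: "z \<in> L"
    and lim: "(\<lambda>h. N (\<phi> h)) \<longlonglongrightarrow> 0" "(\<lambda>h. N (\<lambda>x. deriv (\<phi> h) x - z x)) \<longlonglongrightarrow> 0"
  shows "negligible {x \<in> {s<..<t}. 0 < w x \<and> z x \<noteq> 0}"
proof -
  define Z where "Z = {x \<in> {s<..<t}. 0 < w x \<and> z x \<noteq> 0}"
  define E where "E = {x \<in> I. w' x \<noteq> w x}"
  have E: "negligible E"
    using w' unfolding AE_M_iff_negligible E_def .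
  define G where "G = (\<lambda>q. if x0 \<le> s then {max s q<..<t} else {s<..<min t q})"
  have G_iff: "x \<in> G q \<longleftrightarrow> x \<in> {s<..<t} \<and> \<bar>q - x0\<bar> < \<bar>x - x0\<bar>" if "q \<in> {s<..<t}" for q x
    using x0 that by (auto simp: G_def)
  have neg: "negligible (Z \<inter> G q)" if q: "q \<in> {s<..<t}" "0 < w' q" for q
  proof -
    obtain s' t' where G: "G q = {s'<..<t'}"
      unfolding G_def by (cases "x0 \<le> s") auto
    have sub: "G q \<subseteq> I"
      using G_iff[OF q(1)] J by auto
    have [measurable]: "G q \<in> sets M"
      using sub G by (auto simp: sets_restrict_space_iff)
    have "AE x in M. x \<in> I"
      by (rule AE_I2) simp
    with w' w_nonneg have "AE x in M. \<forall>y\<ge>0. ennreal (indicator (G q) x * y) \<le> 1 + ennreal ((1 / w' q) * (w x * y powr p))"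
    proof eventually_elim
      case (elim x)
      show ?case
      proof (intro allI impI)
        fix y :: real assume y: "0 \<le> y"
        have nn: "0 \<le> (1 / w' q) * (w x * y powr p)"
          using q elim y by simp
        show "ennreal (indicator (G q) x * y) \<le> 1 + ennreal ((1 / w' q) * (w x * y powr p))"
        proof (cases "x \<in> G q")
          case True
          then have "w' q \<le> w x"
            using mono[OF q(1), of x] G_iff[OF q(1)] elim by auto
          then have "1 * y powr p \<le> (w x / w' q) * y powr p"
            using q by (intro mult_right_mono) auto
          moreover have "y \<le> 1 + y powr p"
          proof (cases "y \<le> 1")
            case False
            then have "y powr 1 \<le> y powr p"
              using p1 by (intro powr_mono) auto
            then show ?thesis
              using False by simp
          qed (simp add: add_increasing2)
          ultimately have "y \<le> 1 + (1 / w' q) * (w x * y powr p)"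
            by simp
          then have "ennreal y \<le> ennreal (1 + (1 / w' q) * (w x * y powr p))"
            by (rule ennreal_leI)
          also have "\<dots> = ennreal 1 + ennreal ((1 / w' q) * (w x * y powr p))"
            using nn by (intro ennreal_plus) auto
          finally show ?thesis
            using True by simp
        qed simp
      qed
    qed
    moreover have "(\<integral>\<^sup>+x. 1 \<partial>M) < \<infinity>"
      using ab by (simp add: emeasure_restrict_space)
    ultimately have "\<exists>K\<ge>0. \<forall>f\<in>L. (\<integral>\<^sup>+x. ennreal (indicator (G q) x * \<bar>f x\<bar>) \<partial>M) \<le> ennreal (K * N f)"
      using q by (intro bound_by_pointwise[where \<kappa> = "\<lambda>_. 1" and C = "1 / w' q"]) auto
    then have "AE x in M. x \<in> G q \<longrightarrow> z x = 0"
      using limit_of_derivatives_zero[OF _ _ \<phi> z lim, of s' t'] sub unfolding G by blast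
    then show ?thesis
      unfolding AE_M_iff_negligible
      by (rule negligible_subset) (use J in \<open>auto simp: Z_def\<close>)
  qed
  \<comment> \<open>Only the threshold at which \<open>w'\<close> becomes positive can belong to \<open>X\<close>.\<close>
  define X where "X = {x \<in> {s<..<t}. 0 < w' x \<and> (\<forall>q\<in>\<rat>. q \<in> {s<..<t} \<longrightarrow> \<bar>q - x0\<bar> < \<bar>x - x0\<bar> \<longrightarrow> w' q \<le> 0)}"
  have X: "x = y" if xy: "x \<in> X" "y \<in> X" for x y
  proof -
    have less: False if "u \<in> X" "v \<in> X" "\<bar>u - x0\<bar> < \<bar>v - x0\<bar>" for u v
    proof -
      have uv: "u \<in> {s<..<t}" "v \<in> {s<..<t}"
        using that by (auto simp: X_def)
      then have "min u v < max u v"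
        using that(3) by (auto simp: min_def max_def)
      then obtain q where q: "q \<in> \<rat>" "min u v < q" "q < max u v"
        using Rats_dense_in_real by blast
      then have "q \<in> {s<..<t}" "\<bar>u - x0\<bar> < \<bar>q - x0\<bar>" "\<bar>q - x0\<bar> < \<bar>v - x0\<bar>"
        using uv x0 that(3) by (auto simp: min_def max_def split: if_splits)
      then show False
        using that(1,2) q(1) mono[OF uv(1), of q] by (force simp: X_def)
    qed
    have "\<bar>x - x0\<bar> = \<bar>y - x0\<bar>"
      using less[OF xy] less[OF xy(2,1)] linorder_less_linear by blast
    then show ?thesis
      using xy x0 by (auto simp: X_def)
  qed
  have "negligible X"
  proof (cases "X = {}")
    case False
    then obtain x where "x \<in> X"
      by blast
    then have "X = {x}"
      using X by blast
    then show ?thesis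
      by simp
  qed simp
  have "Z \<subseteq> E \<union> X \<union> (\<Union>q\<in>{q \<in> \<rat>. q \<in> {s<..<t} \<and> 0 < w' q}. Z \<inter> G q)"
  proof
    fix x assume x: "x \<in> Z"
    show "x \<in> E \<union> X \<union> (\<Union>q\<in>{q \<in> \<rat>. q \<in> {s<..<t} \<and> 0 < w' q}. Z \<inter> G q)"
    proof (rule ccontr)
      assume no: "\<not> ?thesis"
      then have "0 < w' x" "x \<in> {s<..<t}"
        using x J by (auto simp: E_def Z_def)
      then obtain q where "q \<in> \<rat>" "q \<in> {s<..<t}" "\<bar>q - x0\<bar> < \<bar>x - x0\<bar>" "0 < w' q"
        using no by (auto simp: X_def not_le)
      then show False
        using no x G_iff[of q x] by (auto simp: Z_def)
    qed
  qed
  moreover have "negligible (\<Union>q\<in>{q \<in> \<rat>. q \<in> {s<..<t} \<and> 0 < w' q}. Z \<inter> G q)"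
    by (rule negligible_countable_Union)
      (use neg in \<open>auto intro!: countable_image countable_subset[OF _ countable_rat]\<close>)
  ultimately show ?thesis
    using \<open>negligible X\<close> E unfolding Z_def by (meson negligible_Un negligible_subset)
qed

text \<open>
  At an endpoint, the half-neighbourhood that faces outwards is empty, so a critical endpoint can be
  stable on its inner side only.
\<close>

lemma not_crit_infinite_empty: "\<not> crit_infinite a b p w \<alpha> c B" if "{a..b} \<inter> B = {}"
proof -
  have "space (lebesgue_on ({a..b} \<inter> B)) = {}"
    using that by (simp add: space_restrict_space)
  then have "(AE x in lebesgue_on ({a..b} \<inter> B). ratio \<alpha> c x \<le> 0)"
    "(\<integral>\<^sup>+x. ratio \<alpha> c x \<partial>lebesgue_on ({a..b} \<inter> B)) = 0"
    by (auto intro!: AE_I2 nn_integral_empty)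
  then have "esssup (lebesgue_on ({a..b} \<inter> B)) (ratio \<alpha> c) \<le> 0"
    by (intro esssup_I ratio_measurable_on) auto
  then show ?thesis
    using \<open>(\<integral>\<^sup>+x. ratio \<alpha> c x \<partial>lebesgue_on ({a..b} \<inter> B)) = 0\<close> by (auto simp: crit_infinite_ratio)
qed

text \<open>
  Every point has a neighbourhood on at least one side in which the limit vanishes almost everywhere
  where the weight is positive: on both sides if the point is not critical, and on the side of
  stability otherwise.
\<close>

lemma limit_of_derivatives_unique:
  assumes \<phi>: "\<And>h::nat. smooth (\<phi> h)" and z: "z \<in> L"
    and lim: "(\<lambda>h. N (\<phi> h)) \<longlonglongrightarrow> 0" "(\<lambda>h. N (\<lambda>x. deriv (\<phi> h) x - z x)) \<longlonglongrightarrow> 0"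
  shows "N z = 0"
proof -
  define Z where "Z = {x \<in> I. 0 < w x \<and> z x \<noteq> 0}"
  have "negligible Z"
  proof (rule negligible_one_sided)
    show "Z \<subseteq> I"
      by (auto simp: Z_def)
    fix x assume "x \<in> Z"
    then have x: "x \<in> I"
      by (auto simp: Z_def)
    show "\<exists>r>0. negligible (Z \<inter> {x<..<x + r}) \<or> negligible (Z \<inter> {x - r<..<x})"
    proof (cases "x \<in> crit a b p w 0")
      case False
      then obtain \<epsilon> where \<epsilon>: "0 < \<epsilon>" "\<not> crit_infinite a b p w 0 x (ball x \<epsilon>)"
        using x by (auto simp: crit_def)
      obtain C where C: "0 \<le> C"
        "\<And>f. f \<in> L \<Longrightarrow> (\<integral>\<^sup>+y. ennreal (indicator (ball x \<epsilon>) y * \<bar>y - x\<bar> powr 0 * \<bar>f y\<bar>) \<partial>M) \<le> ennreal (C * N f)"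
        by (rule noncritical_bound[OF \<epsilon>(2)]) auto
      define r where "r = min \<epsilon> (b - x)"
      have r: "0 < r" "r \<le> \<epsilon>" "{x<..<x + r} \<subseteq> I"
        using \<epsilon>(1) x by (auto simp: r_def)
      have "(\<integral>\<^sup>+y. ennreal (indicator {x<..<x + r} y * \<bar>f y\<bar>) \<partial>M) \<le> ennreal (C * N f)" if "f \<in> L" for f
      proof -
        have "(\<integral>\<^sup>+y. ennreal (indicator {x<..<x + r} y * \<bar>f y\<bar>) \<partial>M) \<le>
            (\<integral>\<^sup>+y. ennreal (indicator (ball x \<epsilon>) y * \<bar>y - x\<bar> powr 0 * \<bar>f y\<bar>) \<partial>M)"
          by (intro nn_integral_mono) (use r in \<open>auto simp: indicator_def dist_real_def\<close>)
        then show ?thesis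
          using C(2)[OF that] by (rule order_trans)
      qed
      then have "AE y in M. y \<in> {x<..<x + r} \<longrightarrow> z y = 0"
        using limit_of_derivatives_zero[OF r(3) _ \<phi> z lim] C(1) by blast
      then have "negligible (Z \<inter> {x<..<x + r})"
        unfolding AE_M_iff_negligible by (rule negligible_subset) (auto simp: Z_def)
      then show ?thesis
        using r(1) by blast
    next
      case True
      then have "right_stable a b p w x \<or> left_stable a b p w x"
        using stable by (simp add: stable_weight_def)
      then show ?thesis
      proof
        assume "right_stable a b p w x"
        then obtain r w' where r: "0 < r" "AE y in M. w' y = w y"
          "\<forall>y\<in>{x<..<x + r} \<inter> I. \<forall>y'\<in>{x<..<x + r} \<inter> I. \<bar>y - x\<bar> \<le> \<bar>y' - x\<bar> \<longrightarrow> w' y \<le> w' y'"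
          unfolding right_stable_def nondecreasing_rep_on_def by blast
        define r' where "r' = min r (b - x)"
        have r': "0 < r'" "{x<..<x + r'} \<subseteq> {x<..<x + r} \<inter> I"
          using r(1) x by (auto simp: r'_def)
        have "{x<..<x + r'} \<subseteq> I"
          using r'(2) by blast
        then have "negligible {y \<in> {x<..<x + r'}. 0 < w y \<and> z y \<noteq> 0}"
        proof (rule limit_zero_where_monotone[OF _ _ r(2) _ \<phi> z lim])
          show "w' y \<le> w' y'" if "y \<in> {x<..<x + r'}" "y' \<in> {x<..<x + r'}" "\<bar>y - x\<bar> \<le> \<bar>y' - x\<bar>" for y y'
            using r(3) r'(2) that by blast
        qed simp
        then have "negligible (Z \<inter> {x<..<x + r'})"
          by (rule negligible_subset) (auto simp: Z_def)
        then show ?thesis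
          using r'(1) by blast
      next
        assume "left_stable a b p w x"
        then obtain r w' where r: "0 < r" "AE y in M. w' y = w y"
          "\<forall>y\<in>{x - r<..<x} \<inter> I. \<forall>y'\<in>{x - r<..<x} \<inter> I. \<bar>y - x\<bar> \<le> \<bar>y' - x\<bar> \<longrightarrow> w' y \<le> w' y'"
          unfolding left_stable_def nondecreasing_rep_on_def by blast
        define r' where "r' = min r (x - a)"
        have r': "0 < r'" "{x - r'<..<x} \<subseteq> {x - r<..<x} \<inter> I"
          using r(1) x by (auto simp: r'_def)
        have "{x - r'<..<x} \<subseteq> I"
          using r'(2) by blast
        then have "negligible {y \<in> {x - r'<..<x}. 0 < w y \<and> z y \<noteq> 0}"
        proof (rule limit_zero_where_monotone[OF _ _ r(2) _ \<phi> z lim])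
          show "w' y \<le> w' y'" if "y \<in> {x - r'<..<x}" "y' \<in> {x - r'<..<x}" "\<bar>y - x\<bar> \<le> \<bar>y' - x\<bar>" for y y'
            using r(3) r'(2) that by blast
        qed simp
        then have "negligible (Z \<inter> {x - r'<..<x})"
          by (rule negligible_subset) (auto simp: Z_def)
        then show ?thesis
          using r'(1) by blast
      qed
    qed
  qed
  then show ?thesis
    unfolding N_eq_0_iff[OF z] AE_M_iff_negligible by (rule negligible_subset) (auto simp: Z_def)
qed

definition approximates :: "nat \<Rightarrow> (nat \<Rightarrow> real \<Rightarrow> real) \<Rightarrow> (nat \<Rightarrow> real \<Rightarrow> real) \<Rightarrow> bool" where
  "approximates m v \<phi> \<longleftrightarrow> (\<forall>k\<le>m. v k \<in> L) \<and> (\<forall>h. \<phi> h \<in> test_functions) \<and>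
     (\<forall>k\<le>m. (\<lambda>h. N (\<lambda>x. (deriv ^^ k) (\<phi> h) x - v k x)) \<longlonglongrightarrow> 0)"

lemma is_derivs_iff: "is_derivs a b p w m u v \<longleftrightarrow> v 0 = u \<and> (\<exists>\<phi>. approximates m v \<phi>)"
  unfolding is_derivs_def approximates_def by blast

lemma approximates_diff:
  assumes "approximates m v \<phi>" "approximates m v' \<psi>"
  shows "approximates m (\<lambda>k x. v k x - v' k x) (\<lambda>h x. \<phi> h x - \<psi> h x)"
proof -
  have "(\<lambda>h. N (\<lambda>x. (deriv ^^ k) (\<lambda>x. \<phi> h x - \<psi> h x) x - (v k x - v' k x))) \<longlonglongrightarrow> 0" if k: "k \<le> m" for k
  proof (rule tendsto_sandwich)
    show "\<forall>\<^sub>F h in sequentially. 0 \<le> N (\<lambda>x. (deriv ^^ k) (\<lambda>x. \<phi> h x - \<psi> h x) x - (v k x - v' k x))"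
      by (simp add: N_nonneg)
    have "N (\<lambda>x. (deriv ^^ k) (\<lambda>x. \<phi> h x - \<psi> h x) x - (v k x - v' k x)) \<le>
      N (\<lambda>x. (deriv ^^ k) (\<phi> h) x - v k x) + N (\<lambda>x. (deriv ^^ k) (\<psi> h) x - v' k x)" for h
    proof -
      have "N (\<lambda>x. ((deriv ^^ k) (\<phi> h) x - v k x) - ((deriv ^^ k) (\<psi> h) x - v' k x)) \<le>
        N (\<lambda>x. (deriv ^^ k) (\<phi> h) x - v k x) + N (\<lambda>x. (deriv ^^ k) (\<psi> h) x - v' k x)"
        using assms k by (intro N_triangle_diff L_diff test_L) (auto simp: approximates_def)
      moreover have "(deriv ^^ k) (\<lambda>x. \<phi> h x - \<psi> h x) = (\<lambda>x. (deriv ^^ k) (\<phi> h) x - (deriv ^^ k) (\<psi> h) x)"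
        using assms by (intro deriv_iter_diff test_smooth) (auto simp: approximates_def)
      ultimately show ?thesis
        by (simp add: algebra_simps)
    qed
    then show "\<forall>\<^sub>F h in sequentially. N (\<lambda>x. (deriv ^^ k) (\<lambda>x. \<phi> h x - \<psi> h x) x - (v k x - v' k x)) \<le>
      N (\<lambda>x. (deriv ^^ k) (\<phi> h) x - v k x) + N (\<lambda>x. (deriv ^^ k) (\<psi> h) x - v' k x)"
      by simp
    have "(\<lambda>h. N (\<lambda>x. (deriv ^^ k) (\<phi> h) x - v k x) + N (\<lambda>x. (deriv ^^ k) (\<psi> h) x - v' k x)) \<longlonglongrightarrow> 0 + 0"
      using assms k by (intro tendsto_add) (auto simp: approximates_def)
    then show "(\<lambda>h. N (\<lambda>x. (deriv ^^ k) (\<phi> h) x - v k x) + N (\<lambda>x. (deriv ^^ k) (\<psi> h) x - v' k x)) \<longlonglongrightarrow> 0"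
      by simp
  qed simp
  with assms show ?thesis
    by (auto simp: approximates_def intro!: L_diff test_diff)
qed

lemma approximates_const:
  assumes "\<phi> \<in> test_functions"
  shows "approximates m (\<lambda>k. (deriv ^^ k) \<phi>) (\<lambda>h. \<phi>)"
  using assms by (auto simp: approximates_def N_zero test_L)

lemma N_limit:
  assumes "approximates m v \<phi>" "k \<le> m"
  shows "(\<lambda>h. N ((deriv ^^ k) (\<phi> h))) \<longlonglongrightarrow> N (v k)"
proof -
  let ?f = "\<lambda>h. (deriv ^^ k) (\<phi> h)"
  have L: "?f h \<in> L" "v k \<in> L" for h
    using assms by (auto simp: approximates_def intro: test_L)
  have "\<bar>N (?f h) - N (v k)\<bar> \<le> N (\<lambda>x. ?f h x - v k x)" for h
    using N_triangle[OF L_diff[OF L(1)[of h] L(2)] L(2)] N_triangle[OF L_diff[OF L(2) L(1)[of h]] L(1)[of h]]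
      N_diff_commute[of "v k" "?f h"] by simp
  then have le: "\<forall>\<^sub>F h in sequentially. norm (N (?f h) - N (v k)) \<le> N (\<lambda>x. ?f h x - v k x)"
    by (simp add: always_eventually)
  have "(\<lambda>h. N (\<lambda>x. ?f h x - v k x)) \<longlonglongrightarrow> 0"
    using assms unfolding approximates_def by blast
  with le have "(\<lambda>h. N (?f h) - N (v k)) \<longlonglongrightarrow> 0"
    by (rule Lim_null_comparison)
  then show ?thesis
    by (simp add: LIM_zero_iff)
qed

text \<open>
  Each derivative that is shown to vanish provides the null sequence for the next one.
\<close>

lemma derivs_zero:
  assumes "approximates m v \<phi>" "v 0 = (\<lambda>x. 0)" "k \<le> m"
  shows "N (v k) = 0"
  using assms(3)
proof (induction k)
  case 0
  then show ?case
    by (simp add: assms(2) N_zero)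
next
  case (Suc k)
  have v: "v (Suc k) \<in> L" and \<phi>: "\<And>h. \<phi> h \<in> test_functions"
    and lim: "(\<lambda>h. N (\<lambda>x. (deriv ^^ Suc k) (\<phi> h) x - v (Suc k) x)) \<longlonglongrightarrow> 0"
    using assms(1) Suc.prems unfolding approximates_def by blast+
  have "(\<lambda>h. N ((deriv ^^ k) (\<phi> h))) \<longlonglongrightarrow> 0"
    using N_limit[OF assms(1), of k] Suc.IH Suc.prems by simp
  then show ?case
    by (rule limit_of_derivatives_unique[OF smooth_iter_deriv[OF test_smooth[OF \<phi>]] v])
      (use lim in simp)
qed

lemma derivs_unique:
  assumes "approximates m v \<phi>" "approximates m v' \<psi>" "v 0 = v' 0" "k \<le> m"
  shows "N (\<lambda>x. v k x - v' k x) = 0"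
  using derivs_zero[OF approximates_diff[OF assms(1,2)] _ assms(4)] assms(3) by simp

lemma is_derivs_D_mu:
  assumes "is_derivs a b p w m u v"
  shows "is_derivs a b p w m u (\<lambda>k. D_mu a b p w m k u)"
  using someI[of "is_derivs a b p w m u", OF assms] by (simp add: D_mu_def)

text \<open>
  By uniqueness, every choice of representatives of the weak derivatives gives the same norm.
\<close>

lemma H_norm_eq:
  assumes v: "approximates m v \<phi>"
  shows "H_norm a b p w m (v 0) = (\<Sum>k\<le>m. N (v k) powr p) powr (1 / p)"
proof -
  have "is_derivs a b p w m (v 0) v"
    using v by (auto simp: is_derivs_iff)
  from is_derivs_D_mu[OF this] obtain \<psi> where
    \<psi>: "D_mu a b p w m 0 (v 0) = v 0" "approximates m (\<lambda>k. D_mu a b p w m k (v 0)) \<psi>"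
    by (auto simp: is_derivs_iff)
  have "N (D_mu a b p w m k (v 0)) = N (v k)" if k: "k \<le> m" for k
  proof -
    let ?D = "D_mu a b p w m k (v 0)"
    have L: "?D \<in> L" "v k \<in> L"
      using v \<psi>(2) k by (auto simp: approximates_def)
    have "N (\<lambda>x. ?D x - v k x) = 0" "N (\<lambda>x. v k x - ?D x) = 0"
      using derivs_unique[OF \<psi>(2) v _ k] derivs_unique[OF v \<psi>(2) _ k] \<psi>(1) by simp_all
    then show ?thesis
      using N_triangle[OF L_diff[OF L(1,2)] L(2)] N_triangle[OF L_diff[OF L(2,1)] L(1)] by simp
  qed
  then show ?thesis
    unfolding H_norm_def by (intro arg_cong[where f = "\<lambda>x. x powr (1 / p)"] sum.cong) auto
qed

lemma N_le_H_norm: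
  assumes "approximates m v \<phi>" "k \<le> m"
  shows "N (v k) \<le> H_norm a b p w m (v 0)"
proof -
  have "N (v k) powr p \<le> (\<Sum>k\<le>m. N (v k) powr p)"
    using assms(2) by (intro member_le_sum) auto
  then have "(N (v k) powr p) powr (1 / p) \<le> (\<Sum>k\<le>m. N (v k) powr p) powr (1 / p)"
    using p1 by (intro powr_mono2) auto
  then show ?thesis
    using p1 N_nonneg by (simp add: H_norm_eq[OF assms(1)] powr_powr)
qed

lemma H_norm_le:
  assumes "approximates m v \<phi>" and le: "\<And>k. k \<le> m \<Longrightarrow> N (v k) \<le> e" and e: "0 \<le> e"
  shows "H_norm a b p w m (v 0) \<le> (1 + real m) * e"
proof -
  have "(\<Sum>k\<le>m. N (v k) powr p) \<le> (\<Sum>k\<le>m. e powr p)"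
    using le p1 N_nonneg by (intro sum_mono powr_mono2) auto
  also have "\<dots> = (1 + real m) * e powr p"
    by simp
  finally have "H_norm a b p w m (v 0) \<le> ((1 + real m) * e powr p) powr (1 / p)"
    unfolding H_norm_eq[OF assms(1)] using p1 by (intro powr_mono2 sum_nonneg) auto
  also have "\<dots> = (1 + real m) powr (1 / p) * e"
    using e p1 by (simp add: powr_mult powr_powr)
  also have "\<dots> \<le> (1 + real m) powr 1 * e"
    using e p1 by (intro mult_right_mono powr_mono) auto
  finally show ?thesis
    by simp
qed

section \<open>Traces\<close>

lemma nn_integral_M_continuous:
  assumes S: "S = {s..t}" "S \<subseteq> {a..b}" and f: "continuous_on S f" "\<And>x. x \<in> S \<Longrightarrow> 0 \<le> f x"
  shows "(\<integral>\<^sup>+x. ennreal (indicator S x * f x) \<partial>M) = ennreal (integral S f)"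
proof -
  have "(f has_integral integral S f) S"
    using f(1) unfolding S(1) by (intro integrable_integral integrable_continuous_interval)
  from nn_integral_has_integral_lebesgue[OF f(2) this]
  have "integral\<^sup>N lborel (\<lambda>x. ennreal (indicator S x * f x)) = ennreal (integral S f)"
    by simp
  moreover have "(\<lambda>x. indicator S x * f x) \<in> borel_measurable borel"
    using borel_measurable_continuous_on_indicator[OF _ f(1)] unfolding S(1) by simp
  ultimately have "integral\<^sup>N lebesgue (\<lambda>x. ennreal (indicator S x * f x)) = ennreal (integral S f)"
    by (subst nn_integral_completion) auto
  moreover have "integral\<^sup>N lebesgue (\<lambda>x. ennreal (indicator S x * f x)) =
      integral\<^sup>N (lebesgue_on ({a..b} \<inter> UNIV)) (\<lambda>x. ennreal (indicator S x * f x))"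
    using S(2) by (subst nn_integral_restrict_space) (auto intro!: nn_integral_cong simp: indicator_def)
  ultimately show ?thesis
    by (subst (asm) nn_integral_lebesgue_on_eq) auto
qed

lemma endpoint_ball:
  assumes "c = a \<or> c = b" "\<epsilon> \<le> b - a"
  obtains s t where "{a..b} \<inter> cball c \<epsilon> = {s..t}"
  using assms by (cases "c = a") (auto simp: dist_real_def intro: that[of a "a + \<epsilon>"] that[of "b - \<epsilon>" b])

text \<open>
  The averaged Taylor expansion produces \<open>L\<^sup>1\<close> norms with exactly the weight that a point which is not
  critical of order \<open>m - k - 1\<close> allows.
\<close>

lemma trace_bound:
  assumes c: "c = a \<or> c = b" and k: "k < m" and noncrit: "c \<notin> crit a b p w (real (m - k - 1))"
  shows "\<exists>C\<ge>0. \<forall>\<phi>\<in>test_functions. \<bar>(deriv ^^ k) \<phi> c\<bar> \<le> C * (\<Sum>j\<le>m. N ((deriv ^^ j) \<phi>))"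
proof -
  define n where "n = m - k - 1"
  have "c \<in> {a..b}"
    using c ab by auto
  then obtain \<epsilon> where \<epsilon>: "0 < \<epsilon>" "\<not> crit_infinite a b p w (real n) c (ball c \<epsilon>)"
    using noncrit by (auto simp: crit_def n_def)
  obtain K where K: "0 \<le> K"
    "\<And>f. f \<in> L \<Longrightarrow> (\<integral>\<^sup>+x. ennreal (indicator (ball c \<epsilon>) x * \<bar>x - c\<bar> powr real n * \<bar>f x\<bar>) \<partial>M) \<le> ennreal (K * N f)"
    by (rule noncritical_bound[OF \<epsilon>(2)]) auto
  define \<delta> where "\<delta> = min (\<epsilon> / 2) (b - a)"
  have \<delta>: "0 < \<delta>" "\<delta> < \<epsilon>" "\<delta> \<le> b - a"
    using \<epsilon>(1) ab by (auto simp: \<delta>_def)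
  let ?S = "{a..b} \<inter> cball c \<delta>"
  obtain C where C: "0 \<le> C" "\<And>\<phi>. smooth \<phi> \<Longrightarrow> \<bar>(deriv ^^ k) \<phi> c\<bar> \<le>
      C * (\<Sum>j\<le>m. integral ?S (\<lambda>t. \<bar>t - c\<bar> ^ n * \<bar>(deriv ^^ j) \<phi> t\<bar>))"
    using endpoint_derivative_bound[OF k \<delta>(1,3) c] unfolding n_def by blast
  obtain s t where st: "?S = {s..t}"
    using endpoint_ball[OF c \<delta>(3)] by blast
  have "integral ?S (\<lambda>t. \<bar>t - c\<bar> ^ n * \<bar>(deriv ^^ j) \<phi> t\<bar>) \<le> K * N ((deriv ^^ j) \<phi>)" if \<phi>: "\<phi> \<in> test_functions" for \<phi> j
  proof -
    have cont: "continuous_on S ((deriv ^^ j) \<phi>)" for S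
      by (intro smooth_continuous_on smooth_iter_deriv test_smooth \<phi>)
    have "ennreal (integral ?S (\<lambda>t. \<bar>t - c\<bar> ^ n * \<bar>(deriv ^^ j) \<phi> t\<bar>)) =
        (\<integral>\<^sup>+x. ennreal (indicator ?S x * (\<bar>x - c\<bar> ^ n * \<bar>(deriv ^^ j) \<phi> x\<bar>)) \<partial>M)"
      by (rule nn_integral_M_continuous[symmetric, OF st])
        (auto intro!: continuous_intros cont)
    also have "\<dots> \<le> (\<integral>\<^sup>+x. ennreal (indicator (ball c \<epsilon>) x * \<bar>x - c\<bar> powr real n * \<bar>(deriv ^^ j) \<phi> x\<bar>) \<partial>M)"
    proof (rule nn_integral_mono)
      fix x assume "x \<in> space M"
      then have "\<bar>x - c\<bar> powr real n = \<bar>x - c\<bar> ^ n"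
        using c by (intro powr_realpow) auto
      then show "ennreal (indicator ?S x * (\<bar>x - c\<bar> ^ n * \<bar>(deriv ^^ j) \<phi> x\<bar>)) \<le>
          ennreal (indicator (ball c \<epsilon>) x * \<bar>x - c\<bar> powr real n * \<bar>(deriv ^^ j) \<phi> x\<bar>)"
        using \<delta>(2) by (auto simp: indicator_def intro!: ennreal_leI)
    qed
    also have "\<dots> \<le> ennreal (K * N ((deriv ^^ j) \<phi>))"
      by (rule K(2)[OF test_L[OF \<phi>]])
    finally show ?thesis
      using K(1) N_nonneg by (simp add: ennreal_le_iff)
  qed
  then have "C * (\<Sum>j\<le>m. integral ?S (\<lambda>t. \<bar>t - c\<bar> ^ n * \<bar>(deriv ^^ j) \<phi> t\<bar>)) \<le>
      (C * K) * (\<Sum>j\<le>m. N ((deriv ^^ j) \<phi>))" if "\<phi> \<in> test_functions" for \<phi>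
    unfolding mult.assoc sum_distrib_left using that C(1) by (intro mult_left_mono sum_mono) auto
  then have "\<bar>(deriv ^^ k) \<phi> c\<bar> \<le> (C * K) * (\<Sum>j\<le>m. N ((deriv ^^ j) \<phi>))" if "\<phi> \<in> test_functions" for \<phi>
    using C(2)[OF test_smooth[OF that]] that order_trans by blast
  then show ?thesis
    using C(1) K(1) by (intro exI[of _ "C * K"]) auto
qed

lemma Delta_k_least:
  assumes "\<alpha> \<ge> 0" "c \<notin> crit a b p w \<alpha>"
  obtains d where "Delta_k a b p w c = enat d" "1 \<le> d" "c \<notin> crit a b p w (real d - 1)"
    "\<And>d'. 1 \<le> d' \<Longrightarrow> c \<notin> crit a b p w (real d' - 1) \<Longrightarrow> d \<le> d'"
proof -
  define Q where "Q = (\<lambda>d::nat. 1 \<le> d \<and> c \<notin> crit a b p w (real d - 1))"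
  have "Q (nat \<lceil>\<alpha>\<rceil> + 1)"
    using assms crit_antimono[of \<alpha> "real (nat \<lceil>\<alpha>\<rceil>)"] by (auto simp: Q_def real_nat_ceiling_ge)
  then have "Q (LEAST d. Q d)" "\<And>d'. Q d' \<Longrightarrow> (LEAST d. Q d) \<le> d'"
    by (auto intro: LeastI Least_le)
  moreover have "Delta_k a b p w c = enat (LEAST d. Q d)"
    using assms unfolding Delta_k_def Q_def by auto
  ultimately show thesis
    using that[of "LEAST d. Q d"] by (auto simp: Q_def)
qed

text \<open>
  Critical sets shrink as the order grows, so \<open>Delta_k - 1\<close> separates the critical integer orders from
  the others.
\<close>

lemma le_kbar_iff:
  assumes "k < m"
  shows "int k \<le> kbar a b p w m c \<longleftrightarrow> c \<notin> crit a b p w (real (m - k - 1))"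
proof (cases "\<forall>\<alpha>\<ge>0. c \<in> crit a b p w \<alpha>")
  case True
  then show ?thesis
    by (simp add: kbar_def Delta_k_def)
next
  case False
  then obtain d where d: "Delta_k a b p w c = enat d" "1 \<le> d" "c \<notin> crit a b p w (real d - 1)"
    "\<And>d'. 1 \<le> d' \<Longrightarrow> c \<notin> crit a b p w (real d' - 1) \<Longrightarrow> d \<le> d'"
    using Delta_k_least by blast
  have "int k \<le> kbar a b p w m c \<longleftrightarrow> d \<le> m - k"
    using assms by (auto simp: kbar_def d(1))
  also have "\<dots> \<longleftrightarrow> c \<notin> crit a b p w (real (m - k - 1))"
  proof
    assume "d \<le> m - k"
    then have "real d - 1 \<le> real (m - k - 1)"
      using d(2) by linarith
    then show "c \<notin> crit a b p w (real (m - k - 1))"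
      using d(3) crit_antimono by blast
  next
    assume noncrit: "c \<notin> crit a b p w (real (m - k - 1))"
    have eq: "real (m - k - 1) = real (m - k) - 1"
      using assms by (simp add: of_nat_diff)
    have "c \<notin> crit a b p w (real (m - k) - 1)"
      using noncrit unfolding eq .
    moreover have "1 \<le> m - k"
      using assms by linarith
    ultimately show "d \<le> m - k"
      by (intro d(4))
  qed
  finally show ?thesis .
qed

end

context stable_interval
begin

lemma test_has_derivs:
  assumes "\<psi> \<in> test_functions"
  shows "\<exists>v \<phi>. v 0 = \<psi> \<and> approximates m v \<phi>"
proof (rule exI[of _ "\<lambda>k. (deriv ^^ k) \<psi>"], rule exI[of _ "\<lambda>h. \<psi>"])
  show "(deriv ^^ 0) \<psi> = \<psi> \<and> approximates m (\<lambda>k. (deriv ^^ k) \<psi>) (\<lambda>h. \<psi>)"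
    using approximates_const[OF assms] by simp
qed

text \<open>
  The bound makes the derivatives at \<open>c\<close> a Cauchy sequence along every approximating sequence, and the
  limit depends on the function only. This defines a trace, so the choice in \<open>Tr\<close> picks a trace, and
  continuity determines its value at the limit of the test functions.
\<close>

lemma trace_limit:
  assumes C: "0 \<le> C" "\<And>\<phi>. \<phi> \<in> test_functions \<Longrightarrow> \<bar>(deriv ^^ k) \<phi> c\<bar> \<le> C * (\<Sum>j\<le>m. N ((deriv ^^ j) \<phi>))"
    and u: "approximates m v \<phi>"
  shows "(\<lambda>h. (deriv ^^ k) (\<phi> h) c) \<longlonglongrightarrow> Tr a b p w m k (v 0) c"
proof -
  define D where "D = (\<lambda>u v \<phi> l. v 0 = u \<and> approximates m v \<phi> \<and> (\<lambda>h. (deriv ^^ k) (\<phi> h) c) \<longlonglongrightarrow> (l::real))"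
  define T where "T = (\<lambda>u. SOME l. \<exists>v \<phi>. D u v \<phi> l)"
  have diff_limit: "\<bar>l - l'\<bar> \<le> C * ((1 + real m) * H_norm a b p w m (\<lambda>x. u x - u' x))"
    if "D u v \<phi> l" "D u' v' \<psi> l'" for u v \<phi> l u' v' \<psi> l'
  proof -
    have v: "v 0 = u" "approximates m v \<phi>" "(\<lambda>h. (deriv ^^ k) (\<phi> h) c) \<longlonglongrightarrow> l"
      and v': "v' 0 = u'" "approximates m v' \<psi>" "(\<lambda>h. (deriv ^^ k) (\<psi> h) c) \<longlonglongrightarrow> l'"
      using that by (auto simp: D_def)
    note diff = approximates_diff[OF v(2) v'(2)]
    let ?\<zeta> = "\<lambda>h x. \<phi> h x - \<psi> h x"
    have test: "\<phi> h \<in> test_functions" "\<psi> h \<in> test_functions" for h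
      using v(2) v'(2) by (auto simp: approximates_def)
    have "(\<lambda>h. \<bar>(deriv ^^ k) (\<phi> h) c - (deriv ^^ k) (\<psi> h) c\<bar>) \<longlonglongrightarrow> \<bar>l - l'\<bar>"
      by (intro tendsto_intros v v')
    moreover have "(\<lambda>h. C * (\<Sum>j\<le>m. N ((deriv ^^ j) (?\<zeta> h)))) \<longlonglongrightarrow> C * (\<Sum>j\<le>m. N (\<lambda>x. v j x - v' j x))"
      by (intro tendsto_intros) (use N_limit[OF diff] in auto)
    moreover have "\<bar>(deriv ^^ k) (\<phi> h) c - (deriv ^^ k) (\<psi> h) c\<bar> \<le> C * (\<Sum>j\<le>m. N ((deriv ^^ j) (?\<zeta> h)))" for h
      using C(2)[OF test_diff[OF test]] deriv_iter_diff[OF test_smooth[OF test(1)] test_smooth[OF test(2)]] by simp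
    ultimately have "\<bar>l - l'\<bar> \<le> C * (\<Sum>j\<le>m. N (\<lambda>x. v j x - v' j x))"
      by (intro LIMSEQ_le) auto
    also have "\<dots> \<le> C * (\<Sum>j\<le>m. H_norm a b p w m (\<lambda>x. u x - u' x))"
      using N_le_H_norm[OF diff] v(1) v'(1) C(1) by (intro mult_left_mono sum_mono) auto
    finally show ?thesis
      by simp
  qed
  have H_iff: "u \<in> H_space a b p w m \<longleftrightarrow> (\<exists>v \<phi>. v 0 = u \<and> approximates m v \<phi>)" for u
    by (auto simp: H_space_def is_derivs_iff)
  have ex: "\<exists>l. D u v \<phi> l" if v: "v 0 = u" "approximates m v \<phi>" for u v \<phi>
  proof -
    have test: "\<phi> h \<in> test_functions" for h
      using v(2) by (auto simp: approximates_def)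
    have "Cauchy (\<lambda>h. (deriv ^^ k) (\<phi> h) c)"
    proof (rule metric_CauchyI)
      fix e :: real assume e: "0 < e"
      define e' where "e' = (e / (C + 1)) / (2 * (1 + real m))"
      have e': "0 < e'"
        using e C(1) by (simp add: e'_def)
      have "\<forall>\<^sub>F h in sequentially. \<forall>j\<in>{..m}. N (\<lambda>x. (deriv ^^ j) (\<phi> h) x - v j x) < e'"
        using v(2) e' by (intro eventually_ball_finite ballI order_tendstoD(2)[of _ 0]) (auto simp: approximates_def)
      then obtain n where n: "\<And>h j. n \<le> h \<Longrightarrow> j \<le> m \<Longrightarrow> N (\<lambda>x. (deriv ^^ j) (\<phi> h) x - v j x) < e'"
        by (auto simp: eventually_sequentially)
      have "dist ((deriv ^^ k) (\<phi> h) c) ((deriv ^^ k) (\<phi> i) c) < e" if "n \<le> h" "n \<le> i" for h i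
      proof -
        have "N ((deriv ^^ j) (\<lambda>x. \<phi> h x - \<phi> i x)) \<le> 2 * e'" if j: "j \<le> m" for j
        proof -
          have "v j \<in> L"
            using v(2) j by (simp add: approximates_def)
          then have "N (\<lambda>x. (deriv ^^ j) (\<phi> h) x - (deriv ^^ j) (\<phi> i) x) \<le>
              N (\<lambda>x. (deriv ^^ j) (\<phi> h) x - v j x) + N (\<lambda>x. v j x - (deriv ^^ j) (\<phi> i) x)"
            by (intro N_triangle3 test_L test)
          also have "\<dots> \<le> e' + e'"
            using n[OF \<open>n \<le> h\<close> j] n[OF \<open>n \<le> i\<close> j] N_diff_commute[of "v j"] by simp
          finally show ?thesis
            using deriv_iter_diff[OF test_smooth[OF test] test_smooth[OF test]] by simp
        qed
        then have "C * (\<Sum>j\<le>m. N ((deriv ^^ j) (\<lambda>x. \<phi> h x - \<phi> i x))) \<le> C * (\<Sum>j\<le>m. 2 * e')"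
          using C(1) by (intro mult_left_mono sum_mono) auto
        also have "(\<Sum>j\<le>m. 2 * e') = e / (C + 1)"
        proof -
          have cancel: "s * (2 * (x / (2 * s))) = x" if "s \<noteq> 0" for s x :: real
            using that by simp
          have "(\<Sum>j\<le>m. 2 * e') = (1 + real m) * (2 * e')"
            by simp
          also have "\<dots> = e / (C + 1)"
            unfolding e'_def by (rule cancel) simp
          finally show ?thesis .
        qed
        also have "C * (e / (C + 1)) = e * (C / (C + 1))"
          by simp
        also have "\<dots> < e * 1"
          using C(1) e by (intro mult_strict_left_mono) auto
        finally show ?thesis
          using C(2)[OF test_diff[OF test test], of h i] deriv_iter_diff[OF test_smooth[OF test] test_smooth[OF test]]
          by (simp add: dist_real_def)
      qed
      then show "\<exists>n. \<forall>h\<ge>n. \<forall>i\<ge>n. dist ((deriv ^^ k) (\<phi> h) c) ((deriv ^^ k) (\<phi> i) c) < e"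
        by blast
    qed
    then show ?thesis
      using v by (auto simp: D_def Cauchy_convergent_iff convergent_def)
  qed
  have T: "\<exists>v \<phi>. D u v \<phi> (T u)" if "u \<in> H_space a b p w m" for u
  proof -
    have "\<exists>l v \<phi>. D u v \<phi> l"
      using that ex unfolding H_iff by blast
    then show ?thesis
      unfolding T_def by (rule someI_ex)
  qed
  have H_zero: "H_norm a b p w m (\<lambda>x. 0) = 0"
  proof -
    have "H_norm a b p w m ((deriv ^^ 0) (\<lambda>x. 0)) \<le> (1 + real m) * 0"
      by (rule H_norm_le[OF approximates_const[OF test_zero]]) (auto simp: deriv_iter_const N_zero)
    then show ?thesis
      by (simp add: H_norm_def order_antisym)
  qed
  have T_test: "T \<psi> = (deriv ^^ k) \<psi> c" if \<psi>: "\<psi> \<in> test_functions" for \<psi>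
  proof -
    have D: "D \<psi> (\<lambda>k. (deriv ^^ k) \<psi>) (\<lambda>h. \<psi>) ((deriv ^^ k) \<psi> c)"
      using approximates_const[OF \<psi>] by (simp add: D_def)
    have "\<psi> \<in> H_space a b p w m"
      unfolding H_iff by (rule test_has_derivs[OF \<psi>])
    then obtain v \<phi> where "D \<psi> v \<phi> (T \<psi>)"
      using T by blast
    from diff_limit[OF this D] show ?thesis
      by (simp add: H_zero)
  qed
  have "is_trace a b p w m k c T"
    unfolding is_trace_def
  proof (intro conjI ballI allI impI T_test)
    fix u f
    assume u: "u \<in> H_space a b p w m" and f: "\<forall>n::nat. f n \<in> H_space a b p w m"
      and lim: "(\<lambda>n. H_norm a b p w m (\<lambda>x. f n x - u x)) \<longlonglongrightarrow> 0"
    have "\<bar>T (f n) - T u\<bar> \<le> C * ((1 + real m) * H_norm a b p w m (\<lambda>x. f n x - u x))" for n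
      using T[OF u] T[OF f[rule_format, of n]] diff_limit by blast
    then have le: "\<forall>\<^sub>F n in sequentially. norm (T (f n) - T u) \<le> C * ((1 + real m) * H_norm a b p w m (\<lambda>x. f n x - u x))"
      by (simp add: always_eventually)
    have "(\<lambda>n. C * ((1 + real m) * H_norm a b p w m (\<lambda>x. f n x - u x))) \<longlonglongrightarrow> C * ((1 + real m) * 0)"
      by (intro tendsto_intros lim)
    then have "(\<lambda>n. C * ((1 + real m) * H_norm a b p w m (\<lambda>x. f n x - u x))) \<longlonglongrightarrow> 0"
      by simp
    with le have "(\<lambda>n. T (f n) - T u) \<longlonglongrightarrow> 0"
      by (rule Lim_null_comparison)
    then show "(\<lambda>n. T (f n)) \<longlonglongrightarrow> T u"
      by (simp add: LIM_zero_iff)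
  qed
  then have Tr: "is_trace a b p w m k c (SOME T. is_trace a b p w m k c T)"
    by (rule someI[of "is_trace a b p w m k c"])
  have test: "\<phi> h \<in> test_functions" for h
    using u by (auto simp: approximates_def)
  have H: "\<phi> h \<in> H_space a b p w m" for h
    unfolding H_iff by (rule test_has_derivs[OF test])
  have uH: "v 0 \<in> H_space a b p w m"
    unfolding H_iff using u by blast
  have "(\<lambda>h. H_norm a b p w m (\<lambda>x. \<phi> h x - v 0 x)) \<longlonglongrightarrow> 0"
  proof (rule Lim_null_comparison)
    show "\<forall>\<^sub>F h in sequentially. norm (H_norm a b p w m (\<lambda>x. \<phi> h x - v 0 x)) \<le>
        (1 + real m) * (\<Sum>j\<le>m. N (\<lambda>x. (deriv ^^ j) (\<phi> h) x - v j x))"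
    proof (rule always_eventually, rule allI)
      fix h
      have "H_norm a b p w m (\<lambda>x. (deriv ^^ 0) (\<phi> h) x - v 0 x) \<le>
          (1 + real m) * (\<Sum>j\<le>m. N (\<lambda>x. (deriv ^^ j) (\<phi> h) x - v j x))"
        by (rule H_norm_le[OF approximates_diff[OF approximates_const[OF test] u]])
          (auto intro!: sum_nonneg N_nonneg member_le_sum[where f = "\<lambda>j. N (\<lambda>x. (deriv ^^ j) (\<phi> h) x - v j x)"])
      then show "norm (H_norm a b p w m (\<lambda>x. \<phi> h x - v 0 x)) \<le>
          (1 + real m) * (\<Sum>j\<le>m. N (\<lambda>x. (deriv ^^ j) (\<phi> h) x - v j x))"
        by (simp add: H_norm_def)
    qed
    have "(\<lambda>h. (1 + real m) * (\<Sum>j\<le>m. N (\<lambda>x. (deriv ^^ j) (\<phi> h) x - v j x))) \<longlonglongrightarrow> (1 + real m) * (\<Sum>j\<le>m. 0)"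
      by (intro tendsto_intros) (use u in \<open>auto simp: approximates_def\<close>)
    then show "(\<lambda>h. (1 + real m) * (\<Sum>j\<le>m. N (\<lambda>x. (deriv ^^ j) (\<phi> h) x - v j x))) \<longlonglongrightarrow> 0"
      by simp
  qed
  then have "(\<lambda>h. (SOME T. is_trace a b p w m k c T) (\<phi> h)) \<longlonglongrightarrow> (SOME T. is_trace a b p w m k c T) (v 0)"
    using Tr uH H unfolding is_trace_def by blast
  moreover have "(SOME T. is_trace a b p w m k c T) (\<phi> h) = (deriv ^^ k) (\<phi> h) c" for h
    using Tr test unfolding is_trace_def by blast
  ultimately show ?thesis
    by (simp add: Tr_def)
qed

lemma trace_limit_endpoint:
  assumes "c = a \<or> c = b" "k < m" "int k \<le> kbar a b p w m c" "approximates m v \<phi>"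
  shows "(\<lambda>h. (deriv ^^ k) (\<phi> h) c) \<longlonglongrightarrow> Tr a b p w m k (v 0) c"
  using trace_bound[OF assms(1,2)] trace_limit[OF _ _ assms(4)] assms(3) unfolding le_kbar_iff[OF assms(2)]
  by blast

section \<open>Concentration at critical points\<close>

text \<open>
  Functions that can be approximated by smooth functions vanishing near \<open>c\<close>.  The distance
  \<open>\<delta>\<close> from \<open>c\<close> yields, for the primitives, a vanishing derivative of order \<open>m\<close> near \<open>c\<close>.
\<close>

definition admissible :: "real \<Rightarrow> real \<Rightarrow> (real \<Rightarrow> real) \<Rightarrow> bool" where
  "admissible c \<rho> f \<longleftrightarrow> f \<in> borel_measurable M \<and> (\<exists>B. \<forall>x. 0 \<le> f x \<and> f x \<le> B) \<and>
     (\<exists>\<delta>>0. \<forall>x. f x \<noteq> 0 \<longrightarrow> x \<in> I \<and> \<delta> < \<bar>x - c\<bar> \<and> \<bar>x - c\<bar> < \<rho>)"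

lemma admissible_L: "admissible c \<rho> f \<Longrightarrow> f \<in> L"
  unfolding admissible_def by (metis L_bounded abs_of_nonneg)

lemma AE_M_neq: "AE x in M. x \<noteq> c"
  by (subst AE_restrict_space_iff) (auto intro: AE_mp[OF AE_completion[OF AE_lborel_singleton[of c]]])

lemma annulus_exhausts:
  assumes "x \<noteq> (c::real)"
  obtains n :: nat where "1 / Suc n < \<bar>x - c\<bar>"
  using nat_approx_posE[of "\<bar>x - c\<bar>"] assms by auto

text \<open>
  The bound is tested on the indicator functions of the sets where the ratio exceeds \<open>K\<close>; these sets
  must be null.
\<close>

lemma concentration_ratio_1:
  assumes p: "p = 1" and K: "0 \<le> K" and \<alpha>: "0 \<le> \<alpha>"
    and le: "\<And>f. admissible c \<rho> f \<Longrightarrow> (\<integral>\<^sup>+x. ennreal (\<bar>x - c\<bar> powr \<alpha> * f x) \<partial>M) \<le> ennreal (K * N f)"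
  shows "AE x in M. x \<in> ball c \<rho> \<longrightarrow> ratio \<alpha> c x \<le> ennreal K"
proof -
  define f where "f = (\<lambda>n::nat. \<lambda>x. if a < x \<and> x < b \<and> 1 / Suc n < \<bar>x - c\<bar> \<and> \<bar>x - c\<bar> < \<rho> \<and>
    K * w x < \<bar>x - c\<bar> powr \<alpha> then 1 else 0 :: real)"
  have [measurable]: "f n \<in> borel_measurable M" for n
    unfolding f_def by measurable
  have adm: "admissible c \<rho> (f n)" for n
    unfolding admissible_def
    by (intro conjI exI[of _ 1] exI[of _ "1 / real (Suc n)"]) (auto simp: f_def split: if_splits)
  have "AE x in M. f n x = 0" for n
  proof -
    have fin: "(\<integral>\<^sup>+x. ennreal (K * (w x * \<bar>f n x\<bar> powr p)) \<partial>M) = ennreal (K * N (f n))"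
      using nn_integral_N[OF admissible_L[OF adm[of n]]] K N_nonneg[of "f n"]
      by (simp add: ennreal_mult' nn_integral_cmult p)
    have le': "AE x in M. ennreal (K * (w x * \<bar>f n x\<bar> powr p)) \<le> ennreal (\<bar>x - c\<bar> powr \<alpha> * f n x)"
      by (intro AE_I2 ennreal_leI) (auto simp: f_def p)
    have "AE x in M. ennreal (\<bar>x - c\<bar> powr \<alpha> * f n x) \<le> ennreal (K * (w x * \<bar>f n x\<bar> powr p))"
    proof (rule AE_mp[OF _ AE_I2])
      have "(\<integral>\<^sup>+x. ennreal (\<bar>x - c\<bar> powr \<alpha> * f n x) - ennreal (K * (w x * \<bar>f n x\<bar> powr p)) \<partial>M) =
          (\<integral>\<^sup>+x. ennreal (\<bar>x - c\<bar> powr \<alpha> * f n x) \<partial>M) - (\<integral>\<^sup>+x. ennreal (K * (w x * \<bar>f n x\<bar> powr p)) \<partial>M)"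
        by (rule nn_integral_diff) (use le' fin in auto)
      also have "\<dots> = 0"
        unfolding fin using le[OF adm[of n]] neq_top_trans[OF ennreal_neq_top le[OF adm[of n]]]
        by (simp add: diff_eq_0_iff_ennreal less_top)
      finally show "AE x in M. ennreal (\<bar>x - c\<bar> powr \<alpha> * f n x) - ennreal (K * (w x * \<bar>f n x\<bar> powr p)) = 0"
        by (subst (asm) nn_integral_0_iff_AE) auto
      show "ennreal (\<bar>x - c\<bar> powr \<alpha> * f n x) - ennreal (K * (w x * \<bar>f n x\<bar> powr p)) = 0 \<longrightarrow>
          ennreal (\<bar>x - c\<bar> powr \<alpha> * f n x) \<le> ennreal (K * (w x * \<bar>f n x\<bar> powr p))" for x
        by (auto simp: diff_eq_0_iff_ennreal)
    qed
    with w_nonneg show ?thesis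
    proof eventually_elim
      case (elim x)
      then have "\<bar>x - c\<bar> powr \<alpha> * f n x \<le> K * (w x * \<bar>f n x\<bar> powr p)"
        using K by (subst (asm) ennreal_le_iff) auto
      then show ?case
        by (auto simp: f_def p split: if_splits)
    qed
  qed
  then have "AE x in M. \<forall>n. f n x = 0"
    by (simp add: AE_all_countable)
  moreover have "AE x in M. x \<in> I"
    by (rule AE_I2) simp
  ultimately show ?thesis
    using AE_M_neq[of c] w_nonneg
  proof eventually_elim
    case (elim x)
    have rx: "ratio \<alpha> c x = ennreal (\<bar>x - c\<bar> powr \<alpha>) / ennreal (w x)"
      unfolding ratio_def if_P[OF p] by (rule refl)
    show ?case
    proof
      assume x: "x \<in> ball c \<rho>"
      obtain n where "1 / Suc n < \<bar>x - c\<bar>"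
        using annulus_exhausts[OF elim(3)] by blast
      then have le: "\<bar>x - c\<bar> powr \<alpha> \<le> K * w x"
        using elim(1)[rule_format, of n] elim(2) x
        by (auto simp: f_def dist_real_def abs_minus_commute not_less split: if_splits)
      show "ratio \<alpha> c x \<le> ennreal K"
      proof (cases "w x = 0")
        case True
        then show ?thesis
          using le elim(3) by simp
      next
        case False
        then show ?thesis
          using le elim(4) by (simp add: rx divide_ennreal ennreal_leI divide_le_eq)
      qed
    qed
  qed
qed

text \<open>
  The test functions are the extremal functions of Hoelder's inequality, truncated where \<open>x\<close> is close to
  \<open>c\<close> or the weight is small. For these, the moment and the \<open>p\<close>-th power of the norm are both the integral of the
  truncated ratio, which the bound therefore controls uniformly; monotone convergence removes the
  truncation. Indicator functions of the zero set of the weight show beforehand that this set is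
  null.
\<close>

lemma concentration_ratio:
  assumes p: "p \<noteq> 1" and K: "0 \<le> K" and \<alpha>: "0 \<le> \<alpha>" and \<rho>: "0 < \<rho>"
    and le: "\<And>f. admissible c \<rho> f \<Longrightarrow> (\<integral>\<^sup>+x. ennreal (\<bar>x - c\<bar> powr \<alpha> * f x) \<partial>M) \<le> ennreal (K * N f)"
  shows "(\<integral>\<^sup>+x. ratio \<alpha> c x * indicator (ball c \<rho>) x \<partial>M) < \<infinity>"
proof -
  have p': "1 < p"
    using p p1 by simp
  define q where "q = p / (p - 1)"
  have q: "1 < q" "(q - 1) * p = q" "1 - 1 / p = 1 / q"
    using p' by (simp_all add: q_def field_simps)
  define A where "A = (\<lambda>(n::nat) x. a < x \<and> x < b \<and> 1 / Suc n < \<bar>x - c\<bar> \<and> \<bar>x - c\<bar> < \<rho>)"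
  have A_I: "A n x \<Longrightarrow> x \<in> I \<and> 1 / Suc n < \<bar>x - c\<bar> \<and> \<bar>x - c\<bar> < \<rho>" for n x
    by (auto simp: A_def)
  have [measurable]: "Measurable.pred M (A n)" for n
    unfolding A_def by measurable
  have pos: "AE x in M. x \<in> ball c \<rho> \<longrightarrow> 0 < w x"
  proof -
    define f where "f = (\<lambda>(n::nat) x. if A n x \<and> w x \<le> 0 then 1 else 0 :: real)"
    have [measurable]: "f n \<in> borel_measurable M" for n
      unfolding f_def by measurable
    have adm: "admissible c \<rho> (f n)" for n
      unfolding admissible_def
      by (intro conjI exI[of _ 1] exI[of _ "1 / real (Suc n)"]) (use A_I in \<open>auto simp: f_def split: if_splits\<close>)
    have "AE x in M. f n x = 0" for n
    proof -
      have "N (f n) = 0"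
        unfolding N_eq_0_iff[OF admissible_L[OF adm]] by (intro AE_I2) (auto simp: f_def)
      then have "(\<integral>\<^sup>+x. ennreal (\<bar>x - c\<bar> powr \<alpha> * f n x) \<partial>M) = 0"
        using le[OF adm[of n]] by simp
      then have "AE x in M. ennreal (\<bar>x - c\<bar> powr \<alpha> * f n x) = 0"
        by (subst (asm) nn_integral_0_iff_AE) auto
      then show ?thesis
        using AE_M_neq[of c] by eventually_elim (auto simp: f_def ennreal_eq_0_iff split: if_splits)
    qed
    then have "AE x in M. \<forall>n. f n x = 0"
      by (simp add: AE_all_countable)
    moreover have "AE x in M. x \<in> I"
      by (rule AE_I2) simp
    ultimately show ?thesis
      using AE_M_neq[of c]
    proof eventually_elim
      case (elim x)
      obtain n where "1 / Suc n < \<bar>x - c\<bar>"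
        using annulus_exhausts[OF elim(3)] by blast
      then show ?case
        using elim(1)[rule_format, of n] elim(2)
        by (auto simp: f_def A_def dist_real_def abs_minus_commute not_le split: if_splits)
    qed
  qed
  define R where "R = (\<lambda>x. \<bar>x - c\<bar> powr \<alpha> / w x powr (1 / p))"
  define f where "f = (\<lambda>(n::nat) x. if A n x \<and> 1 / Suc n < w x then R x powr (q - 1) / w x powr (1 / p) else 0)"
  define \<kappa> where "\<kappa> = (\<lambda>(n::nat) x. if A n x \<and> 1 / Suc n < w x then R x powr q else 0)"
  have [measurable]: "f n \<in> borel_measurable M" "\<kappa> n \<in> borel_measurable M" for n
    unfolding f_def \<kappa>_def R_def by measurable
  have w_pos: "0 < w x" if "1 / real (Suc n) < w x" for n x
    using that by (smt (verit) divide_nonneg_nonneg of_nat_0_le_iff)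
  have R: "0 \<le> R x" "R x \<le> \<rho> powr \<alpha> * Suc n powr (1 / p)" if "A n x" "1 / Suc n < w x" for n x
  proof -
    have w0: "0 < w x"
      using w_pos that(2) by blast
    show "0 \<le> R x"
      by (simp add: R_def)
    have "1 \<le> Suc n * w x"
      using that(2) by (simp add: field_simps)
    then have "1 \<le> (Suc n * w x) powr (1 / p)"
      using p' by (intro ge_one_powr_ge_zero) auto
    then have "1 \<le> Suc n powr (1 / p) * w x powr (1 / p)"
      using w0 by (simp add: powr_mult)
    moreover have "\<bar>x - c\<bar> powr \<alpha> \<le> \<rho> powr \<alpha>"
      using \<alpha> A_I[OF that(1)] by (intro powr_mono2) auto
    ultimately have "\<bar>x - c\<bar> powr \<alpha> * 1 \<le> \<rho> powr \<alpha> * (Suc n powr (1 / p) * w x powr (1 / p))"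
      by (intro mult_mono) auto
    then show "R x \<le> \<rho> powr \<alpha> * Suc n powr (1 / p)"
      using w0 by (simp add: R_def divide_le_eq mult.assoc)
  qed
  have f_bound: "0 \<le> f n x \<and> f n x \<le> (\<rho> powr \<alpha> * Suc n powr (1 / p)) powr (q - 1) * Suc n powr (1 / p)" for n x
  proof (cases "A n x \<and> 1 / Suc n < w x")
    case True
    have w0: "0 < w x"
      using w_pos True by blast
    have "1 / w x \<le> Suc n"
      using True w0 by (simp add: field_simps)
    then have "(1 / w x) powr (1 / p) \<le> Suc n powr (1 / p)"
      using w0 p' by (intro powr_mono2) auto
    then have "1 / w x powr (1 / p) \<le> Suc n powr (1 / p)"
      using w0 by (simp add: powr_divide)
    moreover have "R x powr (q - 1) \<le> (\<rho> powr \<alpha> * Suc n powr (1 / p)) powr (q - 1)"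
      using R True q by (intro powr_mono2) auto
    ultimately have "R x powr (q - 1) * (1 / w x powr (1 / p)) \<le> (\<rho> powr \<alpha> * Suc n powr (1 / p)) powr (q - 1) * Suc n powr (1 / p)"
      by (intro mult_mono) auto
    then show ?thesis
      using True by (simp add: f_def)
  next
    case False
    then show ?thesis
      unfolding f_def if_not_P[OF False] by simp
  qed
  have adm: "admissible c \<rho> (f n)" for n
    unfolding admissible_def
  proof (intro conjI exI allI)
    show "f n x \<le> (\<rho> powr \<alpha> * Suc n powr (1 / p)) powr (q - 1) * Suc n powr (1 / p)" "0 \<le> f n x" for x
      using f_bound by blast+
    show "0 < 1 / real (Suc n)"
      by simp
    show "f n x \<noteq> 0 \<longrightarrow> x \<in> I \<and> 1 / real (Suc n) < \<bar>x - c\<bar> \<and> \<bar>x - c\<bar> < \<rho>" for x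
      using A_I[of n x] by (auto simp: f_def)
  qed measurable
  have moment: "\<bar>x - c\<bar> powr \<alpha> * f n x = \<kappa> n x" and energy: "w x * \<bar>f n x\<bar> powr p = \<kappa> n x" for n x
  proof -
    have "\<bar>x - c\<bar> powr \<alpha> * f n x = \<kappa> n x \<and> w x * \<bar>f n x\<bar> powr p = \<kappa> n x"
    proof (cases "A n x \<and> 1 / Suc n < w x")
      case True
      have w0: "0 < w x"
        using w_pos True by blast
      have "1 / Suc n < \<bar>x - c\<bar>"
        using True A_I by blast
      then have "0 < \<bar>x - c\<bar>"
        by (smt (verit) divide_nonneg_nonneg of_nat_0_le_iff)
      then have R0: "0 < R x"
        using w0 by (simp add: R_def)
      have "\<bar>x - c\<bar> powr \<alpha> * f n x = R x powr (q - 1) * R x"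
        unfolding f_def if_P[OF True] by (simp add: R_def)
      also have "\<dots> = R x powr (q - 1) * R x powr 1"
        using R0 by simp
      also have "\<dots> = \<kappa> n x"
        unfolding \<kappa>_def if_P[OF True] powr_add[symmetric] by simp
      finally have 1: "\<bar>x - c\<bar> powr \<alpha> * f n x = \<kappa> n x" .
      have "w x * \<bar>f n x\<bar> powr p = w x * ((R x powr (q - 1)) powr p / (w x powr (1 / p)) powr p)"
        unfolding f_def if_P[OF True] using w0 R0 by (simp add: powr_divide)
      also have "\<dots> = R x powr ((q - 1) * p)"
        using w0 p' by (simp add: powr_powr)
      also have "\<dots> = \<kappa> n x"
        unfolding \<kappa>_def if_P[OF True] q(2) by (rule refl)
      finally show ?thesis
        using 1 by simp
    next
      case False
      then show ?thesis
        unfolding f_def \<kappa>_def if_not_P[OF False] by simp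
    qed
    then show "\<bar>x - c\<bar> powr \<alpha> * f n x = \<kappa> n x" "w x * \<bar>f n x\<bar> powr p = \<kappa> n x"
      by blast+
  qed
  have bound: "(\<integral>\<^sup>+x. ennreal (\<kappa> n x) \<partial>M) \<le> ennreal (K powr q)" for n
  proof -
    have J: "(\<integral>\<^sup>+x. ennreal (\<kappa> n x) \<partial>M) = ennreal (N (f n) powr p)"
      using nn_integral_N[OF admissible_L[OF adm[of n]]] by (simp add: energy)
    then have "ennreal (N (f n) powr p) \<le> ennreal (K * N (f n))"
      using le[OF adm[of n]] by (simp add: moment)
    then have *: "N (f n) powr p \<le> K * N (f n)"
      using K N_nonneg by (simp add: ennreal_le_iff)
    have "N (f n) powr p \<le> K powr q"
    proof (cases "N (f n) = 0")
      case False
      then have N0: "0 < N (f n)"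
        using N_nonneg[of "f n"] by simp
      have "N (f n) powr p = N (f n) powr (p - 1) * N (f n) powr 1"
        unfolding powr_add[symmetric] by simp
      then have "N (f n) powr (p - 1) \<le> K"
        using * N0 by simp
      then have "(N (f n) powr (p - 1)) powr q \<le> K powr q"
        using q by (intro powr_mono2) auto
      moreover have "(p - 1) * q = p"
        using p' by (simp add: q_def)
      ultimately show ?thesis
        by (simp add: powr_powr)
    qed simp
    then show ?thesis
      unfolding J by (rule ennreal_leI)
  qed
  have "(\<integral>\<^sup>+x. ratio \<alpha> c x * indicator (ball c \<rho>) x \<partial>M) \<le> (\<integral>\<^sup>+x. (SUP n. ennreal (\<kappa> n x)) \<partial>M)"
  proof (rule nn_integral_mono_AE)
    have "AE x in M. x \<in> I"
      by (rule AE_I2) simp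
    with pos AE_M_neq[of c] show "AE x in M. ratio \<alpha> c x * indicator (ball c \<rho>) x \<le> (SUP n. ennreal (\<kappa> n x))"
    proof eventually_elim
      case (elim x)
      show ?case
      proof (cases "x \<in> ball c \<rho>")
        case True
        then have w0: "0 < w x"
          using elim by blast
        obtain n where "1 / Suc n < min \<bar>x - c\<bar> (w x)"
          using nat_approx_posE[of "min \<bar>x - c\<bar> (w x)"] w0 elim(2) by auto
        then have n: "A n x \<and> 1 / Suc n < w x"
          using elim(3) True by (auto simp: A_def dist_real_def abs_minus_commute)
        have "ratio \<alpha> c x = ennreal (R x powr q)"
          using w0 p by (simp add: ratio_def ennreal_powr_def divide_ennreal R_def q_def)
        also have "\<dots> = ennreal (\<kappa> n x)"
          unfolding \<kappa>_def if_P[OF n] by (rule refl)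
        also have "\<dots> \<le> (SUP n. ennreal (\<kappa> n x))"
          by (rule SUP_upper) simp
        finally show ?thesis
          using True by simp
      qed simp
    qed
  qed
  also have "\<dots> = (SUP n. \<integral>\<^sup>+x. ennreal (\<kappa> n x) \<partial>M)"
  proof (rule nn_integral_monotone_convergence_SUP)
    show "incseq (\<lambda>n x. ennreal (\<kappa> n x))"
    proof (rule incseq_SucI, rule le_funI, rule ennreal_leI)
      fix n x
      have "1 / real (Suc (Suc n)) \<le> 1 / real (Suc n)"
        by (intro divide_left_mono) auto
      then have "A n x \<and> 1 / Suc n < w x \<Longrightarrow> A (Suc n) x \<and> 1 / Suc (Suc n) < w x"
        unfolding A_def by linarith
      then show "\<kappa> n x \<le> \<kappa> (Suc n) x"
        unfolding \<kappa>_def by (simp split: if_split) 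
    qed
  qed measurable
  also have "\<dots> \<le> ennreal (K powr q)"
    by (rule SUP_least) (rule bound)
  also have "\<dots> < \<infinity>"
    by simp
  finally show ?thesis .
qed

text \<open>
  If no admissible function had a moment larger than its norm divided by \<open>\<eta>\<close>, the ratio would be finite
  near \<open>c\<close>.
\<close>

lemma critical_concentration:
  assumes c: "c \<in> crit a b p w \<alpha>" and \<alpha>: "0 \<le> \<alpha>" and \<rho>: "0 < \<rho>" and \<eta>: "0 < \<eta>"
  obtains f where "admissible c \<rho> f" "(\<integral>\<^sup>+x. ennreal (\<bar>x - c\<bar> powr \<alpha> * f x) \<partial>M) = 1" "N f \<le> \<eta>"
proof -
  define K where "K = 1 / \<eta>"
  have K: "0 < K"
    using \<eta> by (simp add: K_def)
  have "crit_infinite a b p w \<alpha> c (ball c \<rho>)"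
    using c \<rho> by (simp add: crit_def)
  then have inf: "\<not> (if p = 1 then \<exists>C\<ge>0. AE x in M. x \<in> ball c \<rho> \<longrightarrow> ratio \<alpha> c x \<le> ennreal C
     else (\<integral>\<^sup>+x. ratio \<alpha> c x * indicator (ball c \<rho>) x \<partial>M) < \<infinity>)"
    using crit_infinite_iff[of "ball c \<rho>" \<alpha> c] by simp
  have "\<exists>f. admissible c \<rho> f \<and> \<not> (\<integral>\<^sup>+x. ennreal (\<bar>x - c\<bar> powr \<alpha> * f x) \<partial>M) \<le> ennreal (K * N f)"
  proof (rule ccontr)
    assume "\<not> ?thesis"
    then have le: "(\<integral>\<^sup>+x. ennreal (\<bar>x - c\<bar> powr \<alpha> * f x) \<partial>M) \<le> ennreal (K * N f)" if "admissible c \<rho> f" for f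
      using that by blast
    show False
    proof (cases "p = 1")
      case True
      show False
        using inf concentration_ratio_1[OF True less_imp_le[OF K] \<alpha> le] less_imp_le[OF K]
        unfolding if_P[OF True] by blast
    next
      case False
      show False
        using inf concentration_ratio[OF False less_imp_le[OF K] \<alpha> \<rho> le] unfolding if_not_P[OF False] by blast
    qed
  qed
  then obtain f where f: "admissible c \<rho> f" "\<not> (\<integral>\<^sup>+x. ennreal (\<bar>x - c\<bar> powr \<alpha> * f x) \<partial>M) \<le> ennreal (K * N f)"
    by blast
  obtain B \<delta> where B: "\<And>x. 0 \<le> f x" "\<And>x. f x \<le> B" and \<delta>: "0 < \<delta>"
    "\<And>x. f x \<noteq> 0 \<Longrightarrow> x \<in> I \<and> \<delta> < \<bar>x - c\<bar> \<and> \<bar>x - c\<bar> < \<rho>"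
    using f(1) unfolding admissible_def by blast
  have [measurable]: "f \<in> borel_measurable M"
    using f(1) by (simp add: admissible_def)
  have "(\<integral>\<^sup>+x. ennreal (\<bar>x - c\<bar> powr \<alpha> * f x) \<partial>M) \<le> (\<integral>\<^sup>+x. ennreal (\<rho> powr \<alpha> * B) \<partial>M)"
  proof (intro nn_integral_mono ennreal_leI)
    fix x
    show "\<bar>x - c\<bar> powr \<alpha> * f x \<le> \<rho> powr \<alpha> * B"
    proof (cases "f x = 0")
      case True
      then show ?thesis
        using order_trans[OF B(1)[of x] B(2)[of x]] by simp
    next
      case False
      then show ?thesis
        using B[of x] \<delta>(2)[OF False] \<alpha> by (intro mult_mono powr_mono2) auto
    qed
  qed
  also have "\<dots> < \<infinity>"
    using ab by (simp add: emeasure_restrict_space ennreal_mult_less_top)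
  finally have "(\<integral>\<^sup>+x. ennreal (\<bar>x - c\<bar> powr \<alpha> * f x) \<partial>M) < \<infinity>" .
  then obtain j where j: "(\<integral>\<^sup>+x. ennreal (\<bar>x - c\<bar> powr \<alpha> * f x) \<partial>M) = ennreal j" "0 \<le> j"
    by (cases "\<integral>\<^sup>+x. ennreal (\<bar>x - c\<bar> powr \<alpha> * f x) \<partial>M") auto
  have Nj: "K * N f < j"
    using f(2) j K N_nonneg[of f] by (simp add: ennreal_le_iff not_le)
  then have j0: "0 < j"
    using mult_nonneg_nonneg[OF less_imp_le[OF K] N_nonneg[of f]] by linarith
  let ?f = "\<lambda>x. (1 / j) * f x"
  show thesis
  proof
    have "\<exists>B. \<forall>x. 0 \<le> ?f x \<and> ?f x \<le> B"
      using B j0 by (intro exI[of _ "B / j"]) (auto simp: divide_right_mono)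
    then show "admissible c \<rho> ?f"
      unfolding admissible_def using \<delta> by (intro conjI) (auto intro!: exI[of _ \<delta>])
    have "(\<integral>\<^sup>+x. ennreal (\<bar>x - c\<bar> powr \<alpha> * ?f x) \<partial>M) = (\<integral>\<^sup>+x. ennreal (1 / j) * ennreal (\<bar>x - c\<bar> powr \<alpha> * f x) \<partial>M)"
      using j0 B(1) by (intro nn_integral_cong) (auto simp: ennreal_mult'[symmetric] mult.commute)
    also have "\<dots> = ennreal (1 / j) * ennreal j"
      by (simp add: nn_integral_cmult j(1))
    also have "\<dots> = 1"
      using j0 by (simp add: ennreal_mult'[symmetric])
    finally show "(\<integral>\<^sup>+x. ennreal (\<bar>x - c\<bar> powr \<alpha> * ?f x) \<partial>M) = 1" .
    have "N ?f = N f / j"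
      unfolding N_cmult using j0 by simp
    also have "\<dots> \<le> \<eta>"
      using Nj j0 \<eta> by (simp add: K_def field_simps)
    finally show "N ?f \<le> \<eta>" .
  qed
qed

text \<open>
  Bounds independent of \<open>n\<close> allow dominated convergence in the weighted and in the unweighted space
  at once. The first space controls the norm, the second one the moments.
\<close>

lemma admissible_smooth_approximation:
  assumes f: "admissible c \<rho> f" and \<rho>: "0 < \<rho>" and e: "0 < e"
  obtains g \<delta> where "smooth g" "0 < \<delta>" "\<And>x. \<bar>x - c\<bar> \<le> \<delta> \<Longrightarrow> g x = 0" "\<And>x. 2 * \<rho> \<le> \<bar>x - c\<bar> \<Longrightarrow> g x = 0"
    "N (\<lambda>x. g x - f x) \<le> e" "(\<integral>x. \<bar>g x - f x\<bar> \<partial>M) \<le> e" "integrable M f"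
proof -
  obtain B \<delta> where B: "\<And>x. 0 \<le> f x" "\<And>x. f x \<le> B" and \<delta>: "0 < \<delta>"
    "\<And>x. f x \<noteq> 0 \<Longrightarrow> x \<in> I \<and> \<delta> < \<bar>x - c\<bar> \<and> \<bar>x - c\<bar> < \<rho>"
    using f unfolding admissible_def by blast
  have f_meas [measurable]: "f \<in> borel_measurable M"
    using f by (simp add: admissible_def)
  have B0: "0 \<le> B"
    by (rule order_trans[OF B(1)[of 0] B(2)[of 0]])
  interpret M: finite_measure M
    by standard (use ab in \<open>simp add: emeasure_restrict_space\<close>)
  obtain \<kappa>1 where \<kappa>1: "\<kappa>1 \<in> test_functions" "\<And>x. \<bar>x - c\<bar> \<le> \<rho> \<Longrightarrow> \<kappa>1 x = 1"
    "\<And>x. 2 * \<rho> \<le> \<bar>x - c\<bar> \<Longrightarrow> \<kappa>1 x = 0" "\<And>x. 0 \<le> \<kappa>1 x" "\<And>x. \<kappa>1 x \<le> 1"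
    by (rule cutoff_exists[of \<rho> "2 * \<rho>" c]) (use \<rho> in auto)
  obtain \<kappa>2 where \<kappa>2: "\<kappa>2 \<in> test_functions" "\<And>x. \<bar>x - c\<bar> \<le> \<delta> / 2 \<Longrightarrow> \<kappa>2 x = 1"
    "\<And>x. \<delta> \<le> \<bar>x - c\<bar> \<Longrightarrow> \<kappa>2 x = 0" "\<And>x. 0 \<le> \<kappa>2 x" "\<And>x. \<kappa>2 x \<le> 1"
    by (rule cutoff_exists[of "\<delta> / 2" \<delta> c]) (use \<delta> in auto)
  define \<kappa> where "\<kappa> = (\<lambda>x. \<kappa>1 x * (1 - \<kappa>2 x))"
  have smooth: "smooth \<kappa>"
    unfolding \<kappa>_def by (intro smooth_mult smooth_diff smooth_const test_smooth \<kappa>1(1) \<kappa>2(1))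
  have bounds: "0 \<le> \<kappa> x" "\<kappa> x \<le> 1" for x
    using \<kappa>1(4,5)[of x] \<kappa>2(4,5)[of x] by (auto simp: \<kappa>_def intro!: mult_le_one)
  have one: "\<kappa> x = 1" if "f x \<noteq> 0" for x
    using \<delta>(2)[OF that] \<kappa>1(2)[of x] \<kappa>2(3)[of x] by (simp add: \<kappa>_def)
  have fB: "\<bar>f x\<bar> \<le> B" for x
    using B[of x] by simp
  obtain g where g: "\<And>n. smooth (g n)" "\<And>n x. x \<in> I \<Longrightarrow> \<bar>g n x\<bar> \<le> B + 1"
    "\<And>n x. \<kappa> x = 0 \<Longrightarrow> g n x = 0" "AE x in M. (\<lambda>n. g n x) \<longlonglongrightarrow> f x"
    by (rule smooth_approximation[OF f_meas fB B0 smooth bounds one]) auto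
  have [measurable]: "g n \<in> borel_measurable M" for n
    using smooth_integrable[OF g(1)] by auto
  have diff: "\<bar>g n x - f x\<bar> \<le> 2 * B + 1" if "x \<in> I" for n x
    using g(2)[OF that, of n] B[of x] by (auto simp: abs_le_iff)
  have int_f: "integrable M f"
    by (rule M.integrable_const_bound[of _ B]) (use B in auto)
  have "(\<lambda>n. \<integral>x. \<bar>g n x - f x\<bar> \<partial>M) \<longlonglongrightarrow> (\<integral>x. 0 \<partial>M)"
  proof (rule integral_dominated_convergence[where w = "\<lambda>x. 2 * B + 1"])
    show "AE x in M. (\<lambda>n. \<bar>g n x - f x\<bar>) \<longlonglongrightarrow> 0"
      using g(4) by eventually_elim (simp add: LIM_zero tendsto_rabs_zero)
    show "AE x in M. norm \<bar>g n x - f x\<bar> \<le> 2 * B + 1" for n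
      by (rule AE_I2) (use diff in auto)
  qed auto
  then have lim1: "(\<lambda>n. \<integral>x. \<bar>g n x - f x\<bar> \<partial>M) \<longlonglongrightarrow> 0"
    by simp
  have [measurable]: "f \<in> borel_measurable \<mu>" "g n \<in> borel_measurable \<mu>" for n
    by (simp_all add: borel_measurable_mu)
  have "(\<lambda>n. \<integral>x. \<bar>g n x - f x\<bar> powr p \<partial>\<mu>) \<longlonglongrightarrow> (\<integral>x. 0 \<partial>\<mu>)"
  proof (rule integral_dominated_convergence[where w = "\<lambda>x. (2 * B + 1) powr p"])
    show "AE x in \<mu>. (\<lambda>n. \<bar>g n x - f x\<bar> powr p) \<longlonglongrightarrow> 0"
    proof (rule AE_mu_I)
      show "AE x in M. (\<lambda>n. \<bar>g n x - f x\<bar> powr p) \<longlonglongrightarrow> 0"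
        using g(4)
      proof eventually_elim
        case (elim x)
        then have "(\<lambda>n. \<bar>g n x - f x\<bar>) \<longlonglongrightarrow> 0"
          by (simp add: LIM_zero tendsto_rabs_zero)
        then have "(\<lambda>n. \<bar>g n x - f x\<bar> powr p) \<longlonglongrightarrow> 0 powr p"
          using p1 by (intro tendsto_powr') auto
        then show ?case
          by simp
      qed
    qed
    show "AE x in \<mu>. norm (\<bar>g n x - f x\<bar> powr p) \<le> (2 * B + 1) powr p" for n
      by (rule AE_I2) (use diff p1 in \<open>auto intro!: powr_mono2\<close>)
  qed auto
  then have lim2: "(\<lambda>n. \<integral>x. \<bar>g n x - f x\<bar> powr p \<partial>\<mu>) \<longlonglongrightarrow> 0"
    by simp
  have "\<forall>\<^sub>F n in sequentially. (\<integral>x. \<bar>g n x - f x\<bar> \<partial>M) < e \<and> (\<integral>x. \<bar>g n x - f x\<bar> powr p \<partial>\<mu>) < e powr p"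
    by (intro eventually_conj order_tendstoD(2)[OF lim1 e] order_tendstoD(2)[OF lim2]) (use e in auto)
  then obtain n where n: "(\<integral>x. \<bar>g n x - f x\<bar> \<partial>M) < e" "(\<integral>x. \<bar>g n x - f x\<bar> powr p \<partial>\<mu>) < e powr p"
    using eventually_happens' sequentially_bot by blast
  show thesis
  proof (rule that[of "g n" "\<delta> / 2"])
    show "N (\<lambda>x. g n x - f x) \<le> e"
      using n(2) e by (subst N_le_iff) auto
    show "g n x = 0" if "\<bar>x - c\<bar> \<le> \<delta> / 2" for x
      using that \<kappa>2(2) by (intro g(3)) (simp add: \<kappa>_def)
    show "g n x = 0" if "2 * \<rho> \<le> \<bar>x - c\<bar>" for x
      using that \<kappa>1(3) by (intro g(3)) (simp add: \<kappa>_def)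
  qed (use g(1) \<delta>(1) n(1) int_f in auto)
qed

section \<open>Corrections near an endpoint\<close>

definition vanishes_beyond :: "real \<Rightarrow> real \<Rightarrow> (real \<Rightarrow> real) \<Rightarrow> bool" where
  "vanishes_beyond c \<rho> X \<longleftrightarrow> (\<forall>k. \<forall>x\<in>{a..b}. \<rho> \<le> \<bar>x - c\<bar> \<longrightarrow> (deriv ^^ k) X x = 0)"

text \<open>
  The functions that may be added near \<open>c\<close>: they do not disturb what has been achieved at the other
  endpoint, and they keep the derivative of order \<open>m\<close> equal to zero near \<open>c\<close>.
\<close>

definition corrector :: "real \<Rightarrow> nat \<Rightarrow> real \<Rightarrow> (real \<Rightarrow> real) \<Rightarrow> bool" where
  "corrector c m \<rho> X \<longleftrightarrow> X \<in> test_functions \<and> vanishes_beyond c \<rho> X \<and>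
     (\<forall>\<^sub>F x in nhds c. x \<in> I \<longrightarrow> (deriv ^^ m) X x = 0)"

lemma deriv_iter_combination:
  assumes "\<And>i. i \<in> A \<Longrightarrow> smooth (Y i)"
  shows "(deriv ^^ j) (\<lambda>x. \<Sum>i\<in>A. \<alpha> i * Y i x) = (\<lambda>x. \<Sum>i\<in>A. \<alpha> i * (deriv ^^ j) (Y i) x)"
proof -
  have "(deriv ^^ j) (\<lambda>x. \<Sum>i\<in>A. \<alpha> i * Y i x) = (\<lambda>x. \<Sum>i\<in>A. (deriv ^^ j) (\<lambda>x. \<alpha> i * Y i x) x)"
    by (rule deriv_iter_sum) (intro smooth_cmult assms)
  also have "\<dots> = (\<lambda>x. \<Sum>i\<in>A. \<alpha> i * (deriv ^^ j) (Y i) x)"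
    by (intro ext sum.cong refl) (simp add: deriv_iter_cmult assms)
  finally show ?thesis .
qed

lemma corrector_combination:
  assumes "finite A" and Y: "\<And>i. i \<in> A \<Longrightarrow> corrector c m \<rho> (Y i)"
  shows "corrector c m \<rho> (\<lambda>x. \<Sum>i\<in>A. \<alpha> i * Y i x)"
proof -
  have test: "Y i \<in> test_functions" if "i \<in> A" for i
    using Y[OF that] by (simp add: corrector_def)
  have D: "(deriv ^^ j) (\<lambda>x. \<Sum>i\<in>A. \<alpha> i * Y i x) = (\<lambda>x. \<Sum>i\<in>A. \<alpha> i * (deriv ^^ j) (Y i) x)" for j
    by (intro deriv_iter_combination test_smooth test)
  have "(\<lambda>x. \<Sum>i\<in>A. \<alpha> i * Y i x) \<in> test_functions"
    by (intro test_sum test_cmult test)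
  moreover have "vanishes_beyond c \<rho> (\<lambda>x. \<Sum>i\<in>A. \<alpha> i * Y i x)"
    using Y by (auto simp: vanishes_beyond_def D corrector_def intro!: sum.neutral)
  moreover have "\<forall>\<^sub>F x in nhds c. \<forall>i\<in>A. x \<in> I \<longrightarrow> (deriv ^^ m) (Y i) x = 0"
    using Y assms(1) by (intro eventually_ball_finite) (auto simp: corrector_def)
  then have "\<forall>\<^sub>F x in nhds c. x \<in> I \<longrightarrow> (deriv ^^ m) (\<lambda>x. \<Sum>i\<in>A. \<alpha> i * Y i x) x = 0"
    by eventually_elim (auto simp: D intro!: sum.neutral)
  ultimately show ?thesis
    by (simp add: corrector_def)
qed

lemma N_combination:
  assumes "\<And>i. i \<in> A \<Longrightarrow> Y i \<in> test_functions"
  shows "N ((deriv ^^ j) (\<lambda>x. \<Sum>i\<in>A. \<alpha> i * Y i x)) \<le> (\<Sum>i\<in>A. \<bar>\<alpha> i\<bar> * N ((deriv ^^ j) (Y i)))"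
proof -
  have "(deriv ^^ j) (\<lambda>x. \<Sum>i\<in>A. \<alpha> i * Y i x) = (\<lambda>x. \<Sum>i\<in>A. \<alpha> i * (deriv ^^ j) (Y i) x)"
    by (intro deriv_iter_combination test_smooth assms)
  moreover have "N (\<lambda>x. \<Sum>i\<in>A. \<alpha> i * (deriv ^^ j) (Y i) x) \<le> (\<Sum>i\<in>A. N (\<lambda>x. \<alpha> i * (deriv ^^ j) (Y i) x))"
    by (rule N_sum_le[THEN conjunct2]) (intro L_cmult test_L assms)
  ultimately show ?thesis
    by (simp add: N_cmult)
qed

lemma profile_exists:
  assumes \<rho>: "0 < \<rho>" and j: "j < m"
  obtains e where "corrector c m \<rho> e" "\<And>i. (deriv ^^ i) e c = (if i = j then 1 else 0)"
proof -
  obtain \<kappa> where \<kappa>: "\<kappa> \<in> test_functions" "\<And>x. \<bar>x - c\<bar> \<le> \<rho> / 4 \<Longrightarrow> \<kappa> x = 1"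
    "\<And>x. \<rho> / 2 \<le> \<bar>x - c\<bar> \<Longrightarrow> \<kappa> x = 0" "\<And>x. 0 \<le> \<kappa> x" "\<And>x. \<kappa> x \<le> 1"
    by (rule cutoff_exists[of "\<rho> / 4" "\<rho> / 2" c]) (use \<rho> in auto)
  let ?q = "\<lambda>x. (x - c) ^ j / fact j"
  define e where "e = (\<lambda>x. ?q x * \<kappa> x)"
  have "smooth (\<lambda>x. (1 / fact j) * (x - c) ^ j)"
    by (intro smooth_cmult smooth_power_shift)
  then have "smooth ?q"
    by simp
  then have test: "e \<in> test_functions"
    unfolding e_def using \<kappa>(1) by (rule test_mult)
  have near: "(deriv ^^ i) e x = (if i \<le> j then (x - c) ^ (j - i) / fact (j - i) else 0)" if "x \<in> ball c (\<rho> / 4)" for i x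
  proof -
    have "(deriv ^^ i) e x = (deriv ^^ i) ?q x"
      by (rule deriv_iter_cong_open[where S = "ball c (\<rho> / 4)"])
        (use that \<kappa>(2) in \<open>auto simp: e_def dist_real_def abs_minus_commute\<close>)
    then show ?thesis
      by (simp add: deriv_iter_power_shift)
  qed
  have far: "(deriv ^^ i) e x = 0" if "\<rho> \<le> \<bar>x - c\<bar>" for i x
  proof -
    have "(deriv ^^ i) e x = (deriv ^^ i) (\<lambda>_. 0) x"
      by (rule deriv_iter_cong_open[where S = "- cball c (\<rho> / 2)"])
        (use that \<kappa>(3) \<rho> in \<open>auto simp: e_def dist_real_def abs_minus_commute\<close>)
    then show ?thesis
      by (simp add: deriv_iter_const)
  qed
  have "\<forall>\<^sub>F x in nhds c. x \<in> ball c (\<rho> / 4)"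
    using \<rho> by (intro eventually_nhds_in_open) auto
  then have "\<forall>\<^sub>F x in nhds c. x \<in> I \<longrightarrow> (deriv ^^ m) e x = 0"
    by eventually_elim (use near j in simp)
  then have "corrector c m \<rho> e"
    using test far by (simp add: corrector_def vanishes_beyond_def)
  moreover have "(deriv ^^ i) e c = (if i = j then 1 else 0)" for i
    using near[of c i] \<rho> by auto
  ultimately show thesis
    by (rule that)
qed

lemma primitive:
  assumes c: "c = a \<or> c = b" and \<rho>: "\<rho> \<le> b - a" and g: "smooth g" "\<And>x. \<rho> \<le> \<bar>x - c\<bar> \<Longrightarrow> g x = 0"
  obtains \<zeta> where "\<zeta> \<in> test_functions" "\<And>x. x \<in> {a..b} \<Longrightarrow> (deriv ^^ m) \<zeta> x = g x" "vanishes_beyond c \<rho> \<zeta>"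
    "\<And>k x. k < m \<Longrightarrow> x \<in> {a..b} \<Longrightarrow> ennreal \<bar>(deriv ^^ k) \<zeta> x\<bar> \<le>
       ennreal ((1 + (b - a)) ^ m) * (\<integral>\<^sup>+t. ennreal (indicator (beyond c x {a..b}) t * \<bar>g t\<bar>) \<partial>M)"
    "\<And>k. k < m \<Longrightarrow> \<bar>(deriv ^^ k) \<zeta> c\<bar> = \<bar>\<integral>t. \<bar>t - c\<bar> ^ (m - k - 1) / fact (m - k - 1) * g t \<partial>M\<bar>"
proof (rule endpoint_primitive[OF ab c \<rho> g, of m])
  fix \<zeta>
  assume \<zeta>: "\<zeta> \<in> test_functions" "\<And>x. x \<in> {a..b} \<Longrightarrow> (deriv ^^ m) \<zeta> x = g x"
    "\<And>k x. x \<in> {a..b} \<Longrightarrow> \<rho> \<le> \<bar>x - c\<bar> \<Longrightarrow> (deriv ^^ k) \<zeta> x = 0"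
    "\<And>k x. k < m \<Longrightarrow> x \<in> {a..b} \<Longrightarrow> \<exists>s\<in>{1, -1}.
      ((\<lambda>t. \<bar>t - x\<bar> ^ (m - k - 1) / fact (m - k - 1) * g t) has_integral s * (deriv ^^ k) \<zeta> x) (beyond c x {a..b})"
  let ?P = "(1 + (b - a)) ^ m"
  show thesis
  proof (rule that[OF \<zeta>(1,2)])
    show "vanishes_beyond c \<rho> \<zeta>"
      using \<zeta>(3) by (simp add: vanishes_beyond_def)
    show "\<bar>(deriv ^^ k) \<zeta> c\<bar> = \<bar>\<integral>t. \<bar>t - c\<bar> ^ (m - k - 1) / fact (m - k - 1) * g t \<partial>M\<bar>" if k: "k < m" for k
    proof -
      have cI: "c \<in> {a..b}" "beyond c c {a..b} = {a..b}"
        using c ab by (auto simp: beyond_def)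
      obtain s where s: "s = 1 \<or> s = - 1"
        "((\<lambda>t. \<bar>t - c\<bar> ^ (m - k - 1) / fact (m - k - 1) * g t) has_integral s * (deriv ^^ k) \<zeta> c) {a..b}"
        using \<zeta>(4)[OF k cI(1)] unfolding cI(2) by blast
      have "(\<integral>t. \<bar>t - c\<bar> ^ (m - k - 1) / fact (m - k - 1) * g t \<partial>M) = s * (deriv ^^ k) \<zeta> c"
        unfolding integral_unique[OF s(2), symmetric]
        by (rule continuous_integrable) (intro continuous_intros smooth_continuous_on g(1); simp)
      then show ?thesis
        using s(1) by auto
    qed
    fix k x
    assume k: "k < m" and x: "x \<in> {a..b}"
    define S where "S = beyond c x {a..b}"
    obtain s t where S: "S = {s..t}" "S \<subseteq> {a..b}"
    proof (cases "c = a")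
      case True
      then have "S = {x..b}" "S \<subseteq> {a..b}"
        using x by (auto simp: S_def beyond_def)
      then show thesis
        by (rule that)
    next
      case False
      then have "S = {a..x}" "S \<subseteq> {a..b}"
        using x c by (auto simp: S_def beyond_def)
      then show thesis
        by (rule that)
    qed
    obtain \<sigma> where \<sigma>: "\<sigma> = 1 \<or> \<sigma> = - 1"
      "((\<lambda>t. \<bar>t - x\<bar> ^ (m - k - 1) / fact (m - k - 1) * g t) has_integral \<sigma> * (deriv ^^ k) \<zeta> x) S"
      using \<zeta>(4)[OF k x] unfolding S_def by blast
    have cont: "continuous_on A g" for A
      by (rule smooth_continuous_on[OF g(1)])
    have "norm (integral S (\<lambda>t. \<bar>t - x\<bar> ^ (m - k - 1) / fact (m - k - 1) * g t)) \<le> integral S (\<lambda>t. ?P * \<bar>g t\<bar>)"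
    proof (rule integral_norm_bound_integral[OF has_integral_integrable[OF \<sigma>(2)]])
      show "(\<lambda>t. ?P * \<bar>g t\<bar>) integrable_on S"
        unfolding S(1) by (intro integrable_continuous_interval continuous_intros cont)
      fix t assume t: "t \<in> S"
      have "\<bar>t - x\<bar> ^ (m - k - 1) / fact (m - k - 1) \<le> \<bar>t - x\<bar> ^ (m - k - 1) / 1"
        by (intro divide_left_mono) auto
      also have "\<dots> \<le> (1 + (b - a)) ^ (m - k - 1)"
        using subsetD[OF S(2) t] x by (auto intro!: power_mono)
      also have "\<dots> \<le> ?P"
        using ab by (intro power_increasing) auto
      finally have "\<bar>t - x\<bar> ^ (m - k - 1) / fact (m - k - 1) * \<bar>g t\<bar> \<le> ?P * \<bar>g t\<bar>"
        by (rule mult_right_mono) simp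
      then show "norm (\<bar>t - x\<bar> ^ (m - k - 1) / fact (m - k - 1) * g t) \<le> ?P * \<bar>g t\<bar>"
        by (simp add: abs_mult)
    qed
    then have "\<bar>(deriv ^^ k) \<zeta> x\<bar> \<le> ?P * integral S (\<lambda>t. \<bar>g t\<bar>)"
      using \<sigma>(1) unfolding integral_unique[OF \<sigma>(2)] by auto
    then have "ennreal \<bar>(deriv ^^ k) \<zeta> x\<bar> \<le> ennreal (?P * integral S (\<lambda>t. \<bar>g t\<bar>))"
      by (rule ennreal_leI)
    also have "\<dots> = ennreal ?P * ennreal (integral S (\<lambda>t. \<bar>g t\<bar>))"
      using ab by (intro ennreal_mult') auto
    also have "ennreal (integral S (\<lambda>t. \<bar>g t\<bar>)) = (\<integral>\<^sup>+t. ennreal (indicator S t * \<bar>g t\<bar>) \<partial>M)"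
      by (rule nn_integral_M_continuous[symmetric, OF S]) (auto intro!: continuous_intros cont)
    finally show "ennreal \<bar>(deriv ^^ k) \<zeta> x\<bar> \<le>
       ennreal ?P * (\<integral>\<^sup>+t. ennreal (indicator (beyond c x {a..b}) t * \<bar>g t\<bar>) \<partial>M)"
      unfolding S_def .
  qed
qed

text \<open>
  A weight that increases with the distance from \<open>c\<close> only gains when it is moved from \<open>x\<close> to the
  points beyond \<open>x\<close>, over which the primitive integrates.
\<close>

lemma weighted_primitive:
  assumes c: "c = a \<or> c = b" and w': "AE x in M. w' x = w x"
    and mono: "\<And>x y. x \<in> I \<Longrightarrow> y \<in> I \<Longrightarrow> \<bar>y - c\<bar> < r \<Longrightarrow> \<bar>x - c\<bar> \<le> \<bar>y - c\<bar> \<Longrightarrow> w' x \<le> w' y"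
  shows "\<exists>C\<ge>0. \<forall>\<rho> g. \<rho> \<le> r \<longrightarrow> \<rho> \<le> b - a \<longrightarrow> smooth g \<longrightarrow> (\<forall>x. \<rho> \<le> \<bar>x - c\<bar> \<longrightarrow> g x = 0) \<longrightarrow>
    (\<exists>\<zeta>\<in>test_functions. (\<forall>x\<in>{a..b}. (deriv ^^ m) \<zeta> x = g x) \<and> vanishes_beyond c \<rho> \<zeta> \<and>
      (\<forall>k\<le>m. N ((deriv ^^ k) \<zeta>) \<le> C * N g) \<and>
      (\<forall>k<m. \<bar>(deriv ^^ k) \<zeta> c\<bar> = \<bar>\<integral>t. \<bar>t - c\<bar> ^ (m - k - 1) / fact (m - k - 1) * g t \<partial>M\<bar>))"
proof -
  define q where "q = (\<lambda>x. max 0 (w x) powr (1 / p))"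
  have [measurable]: "q \<in> borel_measurable M"
    unfolding q_def by measurable
  have q0: "0 \<le> q x" for x
    by (simp add: q_def)
  have q_powr: "(q x * y) powr p = w x * y powr p" if "0 \<le> w x" "0 \<le> y" for x y
    using that p1 by (simp add: q_def powr_mult powr_powr)
  have "\<exists>K\<ge>0. \<forall>f\<in>L. (\<integral>\<^sup>+x. ennreal (q x * \<bar>f x\<bar>) \<partial>M) \<le> ennreal (K * N f)"
  proof (rule bound_by_pointwise[where \<kappa> = "\<lambda>_. 1" and C = 1])
    show "(\<integral>\<^sup>+x. 1 \<partial>M) < \<infinity>"
      using ab by (simp add: emeasure_restrict_space)
    show "AE x in M. \<forall>y\<ge>0. ennreal (q x * y) \<le> 1 + ennreal (1 * (w x * y powr p))"
      using w_nonneg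
    proof eventually_elim
      case (elim x)
      show ?case
      proof (intro allI impI)
        fix y :: real assume y: "0 \<le> y"
        have "q x * y \<le> 1 + (q x * y) powr p"
        proof (cases "q x * y \<le> 1")
          case False
          then have "(q x * y) powr 1 \<le> (q x * y) powr p"
            using p1 by (intro powr_mono) auto
          then show ?thesis
            using False by simp
        qed (simp add: add_increasing2)
        then have "ennreal (q x * y) \<le> ennreal (1 + w x * y powr p)"
          unfolding q_powr[OF elim y] by (rule ennreal_leI)
        also have "\<dots> = ennreal 1 + ennreal (w x * y powr p)"
          using elim by (intro ennreal_plus) auto
        finally show "ennreal (q x * y) \<le> 1 + ennreal (1 * (w x * y powr p))"
          by simp
      qed
    qed
  qed (auto simp: q0)
  then obtain K where K: "0 \<le> K" "\<And>f. f \<in> L \<Longrightarrow> (\<integral>\<^sup>+x. ennreal (q x * \<bar>f x\<bar>) \<partial>M) \<le> ennreal (K * N f)"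
    by blast
  define P where "P = (1 + (b - a)) ^ m"
  have P: "0 \<le> P"
    using ab by (simp add: P_def)
  define C where "C = 1 + P * K * (b - a) powr (1 / p)"
  have C: "1 \<le> C"
    using P K(1) by (simp add: C_def)
  show ?thesis
  proof (intro exI[of _ C] conjI allI impI)
    show "0 \<le> C"
      using C by simp
    fix \<rho> g
    assume \<rho>: "\<rho> \<le> r" "\<rho> \<le> b - a" and g': "smooth g" "\<forall>x. \<rho> \<le> \<bar>x - c\<bar> \<longrightarrow> g x = 0"
    then have g: "smooth g" "\<And>x. \<rho> \<le> \<bar>x - c\<bar> \<Longrightarrow> g x = 0"
      by auto
    obtain \<zeta> where \<zeta>: "\<zeta> \<in> test_functions" "\<And>x. x \<in> {a..b} \<Longrightarrow> (deriv ^^ m) \<zeta> x = g x" "vanishes_beyond c \<rho> \<zeta>"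
      "\<And>k x. k < m \<Longrightarrow> x \<in> {a..b} \<Longrightarrow> ennreal \<bar>(deriv ^^ k) \<zeta> x\<bar> \<le>
         ennreal P * (\<integral>\<^sup>+t. ennreal (indicator (beyond c x {a..b}) t * \<bar>g t\<bar>) \<partial>M)"
      "\<And>k. k < m \<Longrightarrow> \<bar>(deriv ^^ k) \<zeta> c\<bar> = \<bar>\<integral>t. \<bar>t - c\<bar> ^ (m - k - 1) / fact (m - k - 1) * g t \<partial>M\<bar>"
      by (rule primitive[OF c \<rho>(2) g, of m, folded P_def]) (assumption, rule that, assumption+)
    have gL: "g \<in> L"
      using g(1) by (rule smooth_L)
    have [measurable]: "g \<in> borel_measurable M"
      using gL by (rule L_measurable)
    have "N ((deriv ^^ k) \<zeta>) \<le> C * N g" if k: "k \<le> m" for k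
    proof (cases "k = m")
      case True
      have "N ((deriv ^^ m) \<zeta>) = N g"
        by (rule N_cong) (use \<zeta>(2) in auto)
      then show ?thesis
        using True C mult_right_mono[OF C N_nonneg[of g]] by simp
    next
      case False
      then have k: "k < m"
        using k by simp
      let ?D = "(deriv ^^ k) \<zeta>"
      have AE_I: "AE x in M. x \<in> I"
        by (rule AE_I2) simp
      have "AE x in M. ennreal (w x * \<bar>?D x\<bar> powr p) \<le> ennreal ((P * (K * N g)) powr p)"
        using w' w_nonneg AE_I
      proof eventually_elim
        case (elim x)
        have "q x * \<bar>?D x\<bar> \<le> P * (K * N g)"
        proof -
          have "ennreal (q x * \<bar>?D x\<bar>) \<le> ennreal (q x) * (ennreal P * (\<integral>\<^sup>+t. ennreal (indicator (beyond c x {a..b}) t * \<bar>g t\<bar>) \<partial>M))"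
            using \<zeta>(4)[OF k, of x] elim(3) by (subst ennreal_mult'[OF q0]) (intro mult_left_mono; simp)
          also have "\<dots> = ennreal P * (ennreal (q x) * (\<integral>\<^sup>+t. ennreal (indicator (beyond c x {a..b}) t * \<bar>g t\<bar>) \<partial>M))"
            by (simp add: ac_simps)
          also have "ennreal (q x) * (\<integral>\<^sup>+t. ennreal (indicator (beyond c x {a..b}) t * \<bar>g t\<bar>) \<partial>M) =
              (\<integral>\<^sup>+t. ennreal (q x) * ennreal (indicator (beyond c x {a..b}) t * \<bar>g t\<bar>) \<partial>M)"
          proof (rule nn_integral_cmult[symmetric])
            have "beyond c x {a..b} = {a..b} - ball c \<bar>x - c\<bar>"
              by (auto simp: beyond_def dist_real_def abs_minus_commute)
            then have "beyond c x {a..b} \<in> sets lebesgue"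
              by simp
            then have "(indicator (beyond c x {a..b}) :: real \<Rightarrow> real) \<in> borel_measurable M"
              by (intro measurable_restrict_space1 borel_measurable_indicator)
            then show "(\<lambda>t. ennreal (indicator (beyond c x {a..b}) t * \<bar>g t\<bar>)) \<in> borel_measurable M"
              by measurable
          qed
          also have "\<dots> \<le> (\<integral>\<^sup>+t. ennreal (q t * \<bar>g t\<bar>) \<partial>M)"
          proof (rule nn_integral_mono_AE)
            show "AE t in M. ennreal (q x) * ennreal (indicator (beyond c x {a..b}) t * \<bar>g t\<bar>) \<le> ennreal (q t * \<bar>g t\<bar>)"
              using w' AE_I
            proof eventually_elim
              case (elim t)
              show ?case
              proof (cases "t \<in> beyond c x {a..b} \<and> g t \<noteq> 0")
                case True
                then have "\<bar>t - c\<bar> < r" "\<bar>x - c\<bar> \<le> \<bar>t - c\<bar>"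
                  using g(2)[of t] \<rho>(1) by (auto simp: beyond_def not_le[symmetric])
                then have "w' x \<le> w' t"
                  using mono[of x t] elim(2) \<open>x \<in> I\<close> by blast
                then have "q x \<le> q t"
                  using elim(1) \<open>w' x = w x\<close> p1 by (auto simp: q_def intro!: powr_mono2)
                then have "q x * \<bar>g t\<bar> \<le> q t * \<bar>g t\<bar>"
                  by (rule mult_right_mono) simp
                then show ?thesis
                  using True q0[of x] by (simp add: ennreal_mult'[symmetric] ennreal_leI)
              next
                case False
                then have zero: "indicator (beyond c x {a..b}) t * \<bar>g t\<bar> = 0"
                  by (auto simp: indicator_def)
                show ?thesis
                  unfolding zero by simp
              qed
            qed
          qed
          also have "\<dots> \<le> ennreal (K * N g)"
            by (rule K(2)[OF gL])
          finally have "ennreal (q x * \<bar>?D x\<bar>) \<le> ennreal P * ennreal (K * N g)"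
            by (simp add: mult_left_mono)
          then show ?thesis
            using P K(1) N_nonneg[of g] by (simp add: ennreal_mult'[symmetric] ennreal_le_iff)
        qed
        then have "(q x * \<bar>?D x\<bar>) powr p \<le> (P * (K * N g)) powr p"
          using q0[of x] p1 by (intro powr_mono2) auto
        then show ?case
          using q_powr[OF elim(2), of "\<bar>?D x\<bar>"] by (simp add: ennreal_leI)
      qed
      then have "(\<integral>\<^sup>+x. ennreal (w x * \<bar>?D x\<bar> powr p) \<partial>M) \<le> (\<integral>\<^sup>+x. ennreal ((P * (K * N g)) powr p) \<partial>M)"
        by (rule nn_integral_mono_AE)
      also have "\<dots> = ennreal ((P * (K * N g)) powr p * (b - a))"
        using ab by (simp add: emeasure_restrict_space ennreal_mult')
      finally have "N ?D powr p \<le> (P * (K * N g)) powr p * (b - a)"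
        unfolding nn_integral_N[OF test_L[OF \<zeta>(1)]] using ab by (subst (asm) ennreal_le_iff) auto
      then have "(N ?D powr p) powr (1 / p) \<le> ((P * (K * N g)) powr p * (b - a)) powr (1 / p)"
        using p1 by (intro powr_mono2) auto
      then have "N ?D \<le> P * (K * N g) * (b - a) powr (1 / p)"
        using p1 N_nonneg P K(1) ab by (simp add: powr_powr powr_mult)
      also have "\<dots> \<le> C * N g"
        using N_nonneg[of g] by (simp add: C_def algebra_simps)
      finally show ?thesis .
    qed
    then show "\<exists>\<zeta>\<in>test_functions. (\<forall>x\<in>{a..b}. (deriv ^^ m) \<zeta> x = g x) \<and> vanishes_beyond c \<rho> \<zeta> \<and>
      (\<forall>k\<le>m. N ((deriv ^^ k) \<zeta>) \<le> C * N g) \<and>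
      (\<forall>k<m. \<bar>(deriv ^^ k) \<zeta> c\<bar> = \<bar>\<integral>t. \<bar>t - c\<bar> ^ (m - k - 1) / fact (m - k - 1) * g t \<partial>M\<bar>)"
      using \<zeta> by (intro bexI[of _ \<zeta>]) auto
  qed
qed

lemma measure_shrinking_balls:
  assumes "c \<notin> I"
  shows "(\<lambda>n. measure \<mu> (I \<inter> ball c (1 / Suc n))) \<longlonglongrightarrow> 0"
proof -
  have "(\<lambda>n. measure \<mu> (I \<inter> ball c (1 / Suc n))) \<longlonglongrightarrow> measure \<mu> (\<Inter>n. I \<inter> ball c (1 / Suc n))"
  proof (rule mu.finite_Lim_measure_decseq)
    show "range (\<lambda>n. I \<inter> ball c (1 / Suc n)) \<subseteq> sets \<mu>"
      by (auto simp: sets_restrict_space_iff)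
    have "1 / real (Suc (Suc n)) \<le> 1 / real (Suc n)" for n
      by (intro divide_left_mono) auto
    then have "ball c (1 / Suc (Suc n)) \<subseteq> ball c (1 / Suc n)" for n
      by (rule subset_ball)
    then show "decseq (\<lambda>n. I \<inter> ball c (1 / Suc n))"
      by (intro decseq_SucI) blast
  qed
  also have "(\<Inter>n. I \<inter> ball c (1 / Suc n)) = {}"
  proof -
    have "\<exists>n. x \<notin> I \<inter> ball c (1 / Suc n)" for x
    proof (cases "x = c")
      case False
      then obtain n where "1 / Suc n < \<bar>x - c\<bar>"
        by (rule annulus_exhausts)
      then show ?thesis
        by (auto simp: dist_real_def abs_minus_commute intro!: exI[of _ n])
    qed (use assms in auto)
    then show ?thesis
      by blast
  qed
  finally show ?thesis
    by simp
qed

text \<open>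
  This \<open>Y\<close> is the \<open>m\<close>-fold primitive of the derivative of order \<open>m\<close> cut off to a small ball. Its derivatives
  of lower order are integrals over the ball, and all derivatives live on the ball, whose measure
  tends to zero because \<open>c\<close> is outside the open interval.
\<close>

lemma flattening:
  assumes c: "c = a \<or> c = b" and \<phi>: "\<phi> \<in> test_functions" and \<rho>: "0 < \<rho>" and \<eta>: "0 < \<eta>"
  obtains Y where "Y \<in> test_functions" "vanishes_beyond c \<rho> Y" "\<And>k. k \<le> m \<Longrightarrow> N ((deriv ^^ k) Y) \<le> \<eta>"
    "\<And>k. k < m \<Longrightarrow> \<bar>(deriv ^^ k) Y c\<bar> \<le> \<eta>"
    "\<forall>\<^sub>F x in nhds c. x \<in> I \<longrightarrow> (deriv ^^ m) Y x = (deriv ^^ m) \<phi> x"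
proof -
  have smooth: "smooth ((deriv ^^ m) \<phi>)"
    by (intro smooth_iter_deriv test_smooth \<phi>)
  obtain A where A: "\<And>x. x \<in> {a..b} \<Longrightarrow> \<bar>(deriv ^^ m) \<phi> x\<bar> \<le> A"
    using compact_imp_bounded[OF compact_continuous_image[OF smooth_continuous_on[OF smooth] compact_Icc[of a b]]]
    unfolding bounded_iff by fastforce
  have A0: "0 \<le> A"
    using order_trans[OF abs_ge_zero A[of a]] ab by simp
  define P where "P = (1 + (b - a)) ^ m"
  have P: "0 \<le> P"
    using ab by (simp add: P_def)
  have lim0: "(\<lambda>n. 1 / real (Suc n)) \<longlonglongrightarrow> 0"
    using LIMSEQ_inverse_real_of_nat by (simp add: inverse_eq_divide)
  have "(\<lambda>n. P * (A * (2 * (1 / real (Suc n))))) \<longlonglongrightarrow> P * (A * (2 * 0))"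
    by (intro tendsto_intros lim0)
  then have lim1: "(\<lambda>n. P * (A * (2 * (1 / real (Suc n))))) \<longlonglongrightarrow> 0"
    by simp
  have "c \<notin> I"
    using c by auto
  then have "(\<lambda>n. measure \<mu> (I \<inter> ball c (1 / Suc n)) powr (1 / p)) \<longlonglongrightarrow> 0 powr (1 / p)"
    using p1 by (intro tendsto_powr' measure_shrinking_balls tendsto_const) auto
  then have "(\<lambda>n. (A + P * (A * 2)) * measure \<mu> (I \<inter> ball c (1 / Suc n)) powr (1 / p)) \<longlonglongrightarrow> (A + P * (A * 2)) * 0 powr (1 / p)"
    by (intro tendsto_mult tendsto_const)
  then have lim2: "(\<lambda>n. (A + P * (A * 2)) * measure \<mu> (I \<inter> ball c (1 / Suc n)) powr (1 / p)) \<longlonglongrightarrow> 0"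
    by simp
  have "\<forall>\<^sub>F n in sequentially. 1 / real (Suc n) < min \<rho> (b - a) \<and> P * (A * (2 * (1 / real (Suc n)))) < \<eta> \<and>
      (A + P * (A * 2)) * measure \<mu> (I \<inter> ball c (1 / Suc n)) powr (1 / p) < \<eta>"
    using \<rho> \<eta> ab by (intro eventually_conj order_tendstoD(2)[OF lim0] order_tendstoD(2)[OF lim1] order_tendstoD(2)[OF lim2]) auto
  then obtain n where n: "1 / real (Suc n) < min \<rho> (b - a)" "P * (A * (2 * (1 / real (Suc n)))) < \<eta>"
    "(A + P * (A * 2)) * measure \<mu> (I \<inter> ball c (1 / Suc n)) powr (1 / p) < \<eta>"
    using eventually_happens' sequentially_bot by blast
  define \<delta> where "\<delta> = 1 / real (Suc n)"
  have \<delta>: "0 < \<delta>" "\<delta> \<le> \<rho>" "\<delta> \<le> b - a" "\<delta> \<le> 1"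
    using n(1) by (auto simp: \<delta>_def)
  obtain \<kappa> where \<kappa>: "\<kappa> \<in> test_functions" "\<And>x. \<bar>x - c\<bar> \<le> \<delta> / 2 \<Longrightarrow> \<kappa> x = 1"
    "\<And>x. \<delta> \<le> \<bar>x - c\<bar> \<Longrightarrow> \<kappa> x = 0" "\<And>x. 0 \<le> \<kappa> x" "\<And>x. \<kappa> x \<le> 1"
    by (rule cutoff_exists[of "\<delta> / 2" \<delta> c]) (use \<delta>(1) in auto)
  define g where "g = (\<lambda>x. (deriv ^^ m) \<phi> x * \<kappa> x)"
  have g: "smooth g" "\<And>x. \<delta> \<le> \<bar>x - c\<bar> \<Longrightarrow> g x = 0"
    unfolding g_def by (auto intro: smooth_mult smooth test_smooth \<kappa>(1) simp: \<kappa>(3))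
  have g_le: "\<bar>g x\<bar> \<le> A" if "x \<in> {a..b}" for x
    using A[OF that] \<kappa>(4,5)[of x] mult_mono[of "\<bar>(deriv ^^ m) \<phi> x\<bar>" A "\<kappa> x" 1] A0 by (simp add: g_def abs_mult)
  obtain \<zeta> where \<zeta>: "\<zeta> \<in> test_functions" "\<And>x. x \<in> {a..b} \<Longrightarrow> (deriv ^^ m) \<zeta> x = g x" "vanishes_beyond c \<delta> \<zeta>"
    "\<And>k x. k < m \<Longrightarrow> x \<in> {a..b} \<Longrightarrow> ennreal \<bar>(deriv ^^ k) \<zeta> x\<bar> \<le>
       ennreal P * (\<integral>\<^sup>+t. ennreal (indicator (beyond c x {a..b}) t * \<bar>g t\<bar>) \<partial>M)"
    by (rule primitive[OF c \<delta>(3) g, of m, folded P_def]) (assumption, rule that, assumption+)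
  have point: "\<bar>(deriv ^^ k) \<zeta> x\<bar> \<le> P * (A * (2 * \<delta>))" if "k < m" "x \<in> {a..b}" for k x
  proof -
    have "(\<integral>\<^sup>+t. ennreal (indicator (beyond c x {a..b}) t * \<bar>g t\<bar>) \<partial>M) \<le> (\<integral>\<^sup>+t. ennreal A * indicator (ball c \<delta>) t * indicator I t \<partial>lebesgue)"
      unfolding nn_integral_restrict_space[of I lebesgue, simplified]
    proof (rule nn_integral_mono)
      fix t
      show "ennreal (indicator (beyond c x {a..b}) t * \<bar>g t\<bar>) * indicator I t \<le> ennreal A * indicator (ball c \<delta>) t * indicator I t"
        using g_le[of t] g(2)[of t]
        by (cases "t \<in> ball c \<delta>") (auto simp: indicator_def dist_real_def abs_minus_commute not_less intro!: ennreal_leI A0)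
    qed
    also have "\<dots> \<le> (\<integral>\<^sup>+t. ennreal A * indicator (ball c \<delta>) t \<partial>lebesgue)"
      by (intro nn_integral_mono) (auto simp: indicator_def)
    also have "\<dots> = ennreal A * emeasure lebesgue (ball c \<delta>)"
      by (rule nn_integral_cmult_indicator) simp
    also have "emeasure lebesgue (ball c \<delta>) = ennreal (2 * \<delta>)"
      using \<delta>(1) by (simp add: ball_eq_greaterThanLessThan)
    finally have le: "(\<integral>\<^sup>+t. ennreal (indicator (beyond c x {a..b}) t * \<bar>g t\<bar>) \<partial>M) \<le> ennreal A * ennreal (2 * \<delta>)" .
    have "ennreal \<bar>(deriv ^^ k) \<zeta> x\<bar> \<le> ennreal P * (ennreal A * ennreal (2 * \<delta>))"
      by (rule order_trans[OF \<zeta>(4)[OF that] mult_left_mono[OF le]]) simp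
    also have "\<dots> = ennreal (P * (A * (2 * \<delta>)))"
      using P A0 \<delta>(1) by (simp add: ennreal_mult')
    finally show ?thesis
      using P A0 \<delta>(1) by (subst (asm) ennreal_le_iff) auto
  qed
  show thesis
  proof (rule that[of \<zeta>])
    show "vanishes_beyond c \<rho> \<zeta>"
      using \<zeta>(3) \<delta>(2) by (auto simp: vanishes_beyond_def)
    show "\<bar>(deriv ^^ k) \<zeta> c\<bar> \<le> \<eta>" if "k < m" for k
      using point[OF that, of c] c ab n(2) by (auto simp: \<delta>_def)
    have "\<forall>\<^sub>F x in nhds c. x \<in> ball c (\<delta> / 2)"
      using \<delta>(1) by (intro eventually_nhds_in_open) auto
    then show "\<forall>\<^sub>F x in nhds c. x \<in> I \<longrightarrow> (deriv ^^ m) \<zeta> x = (deriv ^^ m) \<phi> x"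
      by eventually_elim (use \<zeta>(2) \<kappa>(2) in \<open>auto simp: g_def dist_real_def abs_minus_commute\<close>)
    fix k assume k: "k \<le> m"
    have bound: "\<bar>(deriv ^^ k) \<zeta> x\<bar> \<le> A + P * (A * 2)" if "x \<in> I" for x
    proof (cases "k = m")
      case True
      then show ?thesis
        using \<zeta>(2)[of x] g_le[of x] that P A0 by (simp add: add_increasing2)
    next
      case False
      have "P * (A * (2 * \<delta>)) \<le> P * (A * 2)"
        using \<delta>(4) P A0 by (intro mult_left_mono) auto
      moreover have "\<bar>(deriv ^^ k) \<zeta> x\<bar> \<le> P * (A * (2 * \<delta>))"
        using False k that by (intro point) auto
      ultimately show ?thesis
        using A0 by linarith
    qed
    have "N ((deriv ^^ k) \<zeta>) \<le> (A + P * (A * 2)) * measure \<mu> (I \<inter> ball c \<delta>) powr (1 / p)"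
    proof (rule N_bounded_support[OF L_measurable[OF test_L[OF \<zeta>(1)]] bound])
      show "I \<inter> ball c \<delta> \<in> sets M"
        by (auto simp: sets_restrict_space_iff)
      show "(deriv ^^ k) \<zeta> x = 0" if "x \<in> I - I \<inter> ball c \<delta>" for x
        using \<zeta>(3) that by (auto simp: vanishes_beyond_def dist_real_def abs_minus_commute)
    qed (use P A0 in auto)
    then show "N ((deriv ^^ k) \<zeta>) \<le> \<eta>"
      using n(3) by (simp add: \<delta>_def)
  qed (rule \<zeta>(1))
qed

lemma moment_integrable:
  assumes f: "integrable M f"
  shows "integrable M (\<lambda>t. \<bar>t - c\<bar> ^ j * f t)"
proof -
  have [measurable]: "f \<in> borel_measurable M"
    using f by auto
  show ?thesis
  proof (rule Bochner_Integration.integrable_bound[OF integrable_mult_right[OF f, of "(\<bar>a\<bar> + \<bar>b\<bar> + \<bar>c\<bar>) ^ j"]])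
    show "AE t in M. norm (\<bar>t - c\<bar> ^ j * f t) \<le> norm ((\<bar>a\<bar> + \<bar>b\<bar> + \<bar>c\<bar>) ^ j * f t)"
    proof (rule AE_I2)
      fix t assume "t \<in> space M"
      then have "\<bar>t - c\<bar> ^ j \<le> (\<bar>a\<bar> + \<bar>b\<bar> + \<bar>c\<bar>) ^ j"
        by (intro power_mono) auto
      then show "norm (\<bar>t - c\<bar> ^ j * f t) \<le> norm ((\<bar>a\<bar> + \<bar>b\<bar> + \<bar>c\<bar>) ^ j * f t)"
        by (simp add: abs_mult mult_right_mono)
    qed
  qed measurable
qed

lemma profiles_exist:
  assumes \<rho>: "0 < \<rho>"
  obtains e E where "\<And>i. i < m \<Longrightarrow> corrector c m \<rho> (e i)"
    "\<And>i l. i < m \<Longrightarrow> (deriv ^^ l) (e i) c = (if l = i then 1 else 0)"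
    "\<And>i j. i < m \<Longrightarrow> j \<le> m \<Longrightarrow> N ((deriv ^^ j) (e i)) \<le> E" "0 \<le> E"
proof -
  have "\<forall>i\<in>{..<m}. \<exists>e. corrector c m \<rho> e \<and> (\<forall>l. (deriv ^^ l) e c = (if l = i then 1 else 0))"
    using profile_exists[OF \<rho>, of _ m c] by (metis lessThan_iff)
  then obtain e where e: "\<And>i. i < m \<Longrightarrow> corrector c m \<rho> (e i)"
    "\<And>i l. i < m \<Longrightarrow> (deriv ^^ l) (e i) c = (if l = i then 1 else 0)"
    by (metis lessThan_iff)
  define E where "E = (\<Sum>i<m. \<Sum>j\<le>m. N ((deriv ^^ j) (e i)))"
  have E: "N ((deriv ^^ j) (e i)) \<le> E" if "i < m" "j \<le> m" for i j
  proof -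
    have "N ((deriv ^^ j) (e i)) \<le> (\<Sum>j\<le>m. N ((deriv ^^ j) (e i)))"
      using that by (intro member_le_sum) (auto simp: N_nonneg)
    also have "\<dots> \<le> E"
      unfolding E_def using that by (intro member_le_sum) (auto intro!: sum_nonneg simp: N_nonneg)
    finally show ?thesis .
  qed
  have E0: "0 \<le> E"
    unfolding E_def by (intro sum_nonneg N_nonneg)
  show thesis
    by (rule that[OF e E E0])
qed

text \<open>
  A higher moment gains a power of the radius of the support over the moment of order \<open>s\<close>, so it is
  small if the support is.
\<close>

lemma concentrated_smooth_function:
  assumes c: "c = a \<or> c = b" and crit: "c \<in> crit a b p w (real s)" and s: "s < m"
    and \<rho>: "0 < \<rho>" and \<tau>: "0 < \<tau>" "\<tau> \<le> 1"
  obtains g \<delta> where "smooth g" "0 < \<delta>" "\<And>x. \<bar>x - c\<bar> \<le> \<delta> \<Longrightarrow> g x = 0" "\<And>x. \<rho> \<le> \<bar>x - c\<bar> \<Longrightarrow> g x = 0"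
    "N g \<le> \<tau>" "1 / 2 \<le> (\<integral>t. \<bar>t - c\<bar> ^ s * g t \<partial>M)"
    "\<And>j. s < j \<Longrightarrow> j < m \<Longrightarrow> \<bar>\<integral>t. \<bar>t - c\<bar> ^ j * g t \<partial>M\<bar> \<le> \<tau>"
proof -
  define P where "P = (1 + (b - a)) ^ m"
  have P: "1 \<le> P"
    using ab unfolding P_def by (intro one_le_power) auto
  define \<rho>1 where "\<rho>1 = min (\<rho> / 2) (\<tau> / 2)"
  have \<rho>1: "0 < \<rho>1" "2 * \<rho>1 \<le> \<rho>" "\<rho>1 \<le> \<tau> / 2"
    using \<rho> \<tau> by (auto simp: \<rho>1_def)
  define e where "e = \<tau> / (2 * P)"
  have e: "0 < e" "P * e = \<tau> / 2"
    using \<tau> P by (simp_all add: e_def)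
  have "e \<le> P * e"
    using P e(1) by simp
  then have e_le: "e \<le> \<tau> / 2"
    using e(2) by simp
  obtain f where f: "admissible c \<rho>1 f" "(\<integral>\<^sup>+x. ennreal (\<bar>x - c\<bar> powr real s * f x) \<partial>M) = 1" "N f \<le> \<tau> / 2"
    by (rule critical_concentration[OF crit _ \<rho>1(1), of "\<tau> / 2"]) (use \<tau> in auto)
  obtain g \<delta> where g: "smooth g" "0 < \<delta>" "\<And>x. \<bar>x - c\<bar> \<le> \<delta> \<Longrightarrow> g x = 0" "\<And>x. 2 * \<rho>1 \<le> \<bar>x - c\<bar> \<Longrightarrow> g x = 0"
    "N (\<lambda>x. g x - f x) \<le> e" "(\<integral>x. \<bar>g x - f x\<bar> \<partial>M) \<le> e" "integrable M f"
    by (rule admissible_smooth_approximation[OF f(1) \<rho>1(1) e(1)]) (rule that, assumption+)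
  have fL: "f \<in> L" "g \<in> L"
    using f(1) g(1) by (auto intro: admissible_L smooth_L)
  have f0: "0 \<le> f x" "f x \<noteq> 0 \<Longrightarrow> \<bar>x - c\<bar> < \<rho>1" for x
    using f(1) unfolding admissible_def by blast+
  have int_g: "integrable M g"
    by (rule smooth_integrable[OF g(1)])
  have near: "\<bar>(\<integral>t. \<bar>t - c\<bar> ^ j * g t \<partial>M) - (\<integral>t. \<bar>t - c\<bar> ^ j * f t \<partial>M)\<bar> \<le> \<tau> / 2" if j: "j < m" for j
  proof -
    have int: "integrable M (\<lambda>t. \<bar>g t - f t\<bar>)"
      using int_g g(7) by auto
    have "(\<integral>t. \<bar>t - c\<bar> ^ j * g t \<partial>M) - (\<integral>t. \<bar>t - c\<bar> ^ j * f t \<partial>M) = (\<integral>t. \<bar>t - c\<bar> ^ j * (g t - f t) \<partial>M)"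
      unfolding right_diff_distrib
      by (rule Bochner_Integration.integral_diff[symmetric]) (intro moment_integrable int_g g(7))+
    also have "\<bar>\<dots>\<bar> \<le> (\<integral>t. \<bar>\<bar>t - c\<bar> ^ j * (g t - f t)\<bar> \<partial>M)"
      by (rule integral_abs_bound)
    also have "\<dots> \<le> (\<integral>t. P * \<bar>g t - f t\<bar> \<partial>M)"
    proof (rule integral_mono)
      show "integrable M (\<lambda>t. \<bar>\<bar>t - c\<bar> ^ j * (g t - f t)\<bar>)"
        by (intro integrable_abs moment_integrable Bochner_Integration.integrable_diff int_g g(7))
      show "integrable M (\<lambda>t. P * \<bar>g t - f t\<bar>)"
        using int by simp
      fix t assume "t \<in> space M"
      then have "\<bar>t - c\<bar> ^ j \<le> (1 + (b - a)) ^ j"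
        using c by (intro power_mono) auto
      also have "\<dots> \<le> P"
        unfolding P_def using j ab by (intro power_increasing) auto
      finally show "\<bar>\<bar>t - c\<bar> ^ j * (g t - f t)\<bar> \<le> P * \<bar>g t - f t\<bar>"
        by (simp add: abs_mult mult_right_mono)
    qed
    also have "\<dots> \<le> P * e"
      using g(6) P by (simp add: mult_left_mono)
    finally show ?thesis
      using e(2) by simp
  qed
  have int_f: "integrable M (\<lambda>t. \<bar>t - c\<bar> ^ j * f t)" for j
    by (rule moment_integrable[OF g(7)])
  have moment_s: "(\<integral>t. \<bar>t - c\<bar> ^ s * f t \<partial>M) = 1"
  proof -
    have "ennreal (\<integral>t. \<bar>t - c\<bar> ^ s * f t \<partial>M) = (\<integral>\<^sup>+t. ennreal (\<bar>t - c\<bar> ^ s * f t) \<partial>M)"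
      by (rule nn_integral_eq_integral[symmetric, OF int_f]) (use f0(1) in auto)
    also have "\<dots> = (\<integral>\<^sup>+x. ennreal (\<bar>x - c\<bar> powr real s * f x) \<partial>M)"
      by (intro nn_integral_cong) (use c in \<open>auto simp: powr_realpow\<close>)
    finally show ?thesis
      unfolding f(2) by (simp add: ennreal_eq_1)
  qed
  show thesis
  proof (rule that[OF g(1-3)])
    show "g x = 0" if "\<rho> \<le> \<bar>x - c\<bar>" for x
      using that \<rho>1(2) by (intro g(4)) simp
    have "N (\<lambda>x. f x + (g x - f x)) \<le> N f + N (\<lambda>x. g x - f x)"
      by (intro N_triangle L_diff fL)
    then show "N g \<le> \<tau>"
      using f(3) g(5) e_le by simp
    show "1 / 2 \<le> (\<integral>t. \<bar>t - c\<bar> ^ s * g t \<partial>M)"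
      using near[OF s] \<tau> unfolding moment_s by linarith
    show "\<bar>\<integral>t. \<bar>t - c\<bar> ^ j * g t \<partial>M\<bar> \<le> \<tau>" if j: "s < j" "j < m" for j
    proof -
      have "(\<integral>t. \<bar>t - c\<bar> ^ j * f t \<partial>M) \<le> (\<integral>t. \<rho>1 * (\<bar>t - c\<bar> ^ s * f t) \<partial>M)"
      proof (rule integral_mono[OF int_f])
        show "integrable M (\<lambda>t. \<rho>1 * (\<bar>t - c\<bar> ^ s * f t))"
          by (intro integrable_mult_right int_f)
        show "\<bar>t - c\<bar> ^ j * f t \<le> \<rho>1 * (\<bar>t - c\<bar> ^ s * f t)" for t
        proof (cases "f t = 0")
          case False
          have "\<bar>t - c\<bar> ^ (j - s) \<le> \<bar>t - c\<bar> ^ 1"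
            using f0(2)[OF False] \<rho>1(3) \<tau> j by (intro power_decreasing) auto
          then have "\<bar>t - c\<bar> ^ (j - s) \<le> \<rho>1"
            using f0(2)[OF False] by simp
          then have "\<bar>t - c\<bar> ^ (j - s) * (\<bar>t - c\<bar> ^ s * f t) \<le> \<rho>1 * (\<bar>t - c\<bar> ^ s * f t)"
            using f0(1) by (intro mult_right_mono) auto
          then show ?thesis
            using j by (simp flip: mult.assoc power_add)
        qed simp
      qed
      also have "\<dots> = \<rho>1"
        by (simp add: moment_s)
      finally have "(\<integral>t. \<bar>t - c\<bar> ^ j * f t \<partial>M) \<le> \<tau> / 2"
        using \<rho>1(3) by simp
      moreover have "0 \<le> (\<integral>t. \<bar>t - c\<bar> ^ j * f t \<partial>M)"
        using f0(1) by (intro integral_nonneg_AE AE_I2) auto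
      ultimately show ?thesis
        using near[OF j(2)] by linarith
    qed
  qed
qed

text \<open>
  The primitive of a concentrated function has derivatives at \<open>c\<close> of order below \<open>k\<close> that are small;
  these are removed by fixed profiles.  Its derivatives of order above \<open>k\<close> may be huge, but they belong to
  smaller critical orders, so the correctors that remove them can be chosen, by induction, as small
  as the coefficients require.
\<close>

lemma small_corrector:
  assumes c: "c = a \<or> c = b" and r: "0 < r" and w': "AE x in M. w' x = w x"
    and mono: "\<And>x y. x \<in> I \<Longrightarrow> y \<in> I \<Longrightarrow> \<bar>y - c\<bar> < r \<Longrightarrow> \<bar>x - c\<bar> \<le> \<bar>y - c\<bar> \<Longrightarrow> w' x \<le> w' y"
    and k: "k < m" and crit: "c \<in> crit a b p w (real (m - k - 1))" and \<rho>: "0 < \<rho>" and \<eta>: "0 < \<eta>"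
  shows "\<exists>X. corrector c m \<rho> X \<and> (\<forall>i<m. (deriv ^^ i) X c = (if i = k then 1 else 0)) \<and>
    (\<forall>j\<le>m. N ((deriv ^^ j) X) \<le> \<eta>)"
  using k crit \<eta>
proof (induction "m - k" arbitrary: k \<eta> rule: less_induct)
  case less
  note k = less.prems(1) and crit = less.prems(2) and \<eta> = less.prems(3)
  define s where "s = m - k - 1"
  have "\<exists>C\<ge>0. \<forall>\<rho> g. \<rho> \<le> r \<longrightarrow> \<rho> \<le> b - a \<longrightarrow> smooth g \<longrightarrow> (\<forall>x. \<rho> \<le> \<bar>x - c\<bar> \<longrightarrow> g x = 0) \<longrightarrow>
    (\<exists>\<zeta>\<in>test_functions. (\<forall>x\<in>{a..b}. (deriv ^^ m) \<zeta> x = g x) \<and> vanishes_beyond c \<rho> \<zeta> \<and>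
      (\<forall>k\<le>m. N ((deriv ^^ k) \<zeta>) \<le> C * N g) \<and>
      (\<forall>k<m. \<bar>(deriv ^^ k) \<zeta> c\<bar> = \<bar>\<integral>t. \<bar>t - c\<bar> ^ (m - k - 1) / fact (m - k - 1) * g t \<partial>M\<bar>))"
    by (rule weighted_primitive[OF c w']) (rule mono)
  then obtain C where C: "0 \<le> C" and primitive: "\<forall>\<rho> g. \<rho> \<le> r \<longrightarrow> \<rho> \<le> b - a \<longrightarrow> smooth g \<longrightarrow> (\<forall>x. \<rho> \<le> \<bar>x - c\<bar> \<longrightarrow> g x = 0) \<longrightarrow>
    (\<exists>\<zeta>\<in>test_functions. (\<forall>x\<in>{a..b}. (deriv ^^ m) \<zeta> x = g x) \<and> vanishes_beyond c \<rho> \<zeta> \<and>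
      (\<forall>k\<le>m. N ((deriv ^^ k) \<zeta>) \<le> C * N g) \<and>
      (\<forall>k<m. \<bar>(deriv ^^ k) \<zeta> c\<bar> = \<bar>\<integral>t. \<bar>t - c\<bar> ^ (m - k - 1) / fact (m - k - 1) * g t \<partial>M\<bar>))"
    by blast
  obtain e E where e: "\<And>i. i < m \<Longrightarrow> corrector c m \<rho> (e i)"
    "\<And>i l. i < m \<Longrightarrow> (deriv ^^ l) (e i) c = (if l = i then 1 else 0)"
    and E: "\<And>i j. i < m \<Longrightarrow> j \<le> m \<Longrightarrow> N ((deriv ^^ j) (e i)) \<le> E" and E0: "0 \<le> E"
    by (rule profiles_exist[OF \<rho>, of m c]) (rule that, assumption+)
  define F where "F = (fact s :: real)"
  have F: "1 \<le> F"
    by (simp add: F_def)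
  \<comment> \<open>\<open>G * \<tau>\<close> is the total of the estimates for the terms of the linear combination \<open>Y\<close> below:
    \<open>2 * F\<close> bounds \<open>1 / \<bar>d k\<bar>\<close>, and \<open>C\<close>, \<open>m * E\<close> and \<open>1\<close> come from \<open>\<zeta>\<close>, \<open>e\<close> and \<open>X\<close>.\<close>
  define G where "G = 2 * F * (C + real m * E + 1)"
  have mE: "0 \<le> real m * E"
    using E0 by simp
  then have G: "0 < G"
    unfolding G_def using F C by (intro mult_pos_pos) auto
  define \<tau> where "\<tau> = min 1 (\<eta> / G)"
  have \<tau>: "0 < \<tau>" "\<tau> \<le> 1" "G * \<tau> \<le> \<eta>"
    using \<eta> G by (auto simp: \<tau>_def min_def field_simps)
  define \<rho>0 where "\<rho>0 = min \<rho> (min r (b - a))"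
  have \<rho>0: "0 < \<rho>0" "\<rho>0 \<le> \<rho>" "\<rho>0 \<le> r" "\<rho>0 \<le> b - a"
    using \<rho> r ab by (auto simp: \<rho>0_def)
  have s: "s < m"
    using k by (simp add: s_def)
  obtain g \<delta> where g: "smooth g" "0 < \<delta>" "\<And>x. \<bar>x - c\<bar> \<le> \<delta> \<Longrightarrow> g x = 0" "\<And>x. \<rho>0 \<le> \<bar>x - c\<bar> \<Longrightarrow> g x = 0"
    "N g \<le> \<tau>" "1 / 2 \<le> (\<integral>t. \<bar>t - c\<bar> ^ s * g t \<partial>M)"
    "\<And>j. s < j \<Longrightarrow> j < m \<Longrightarrow> \<bar>\<integral>t. \<bar>t - c\<bar> ^ j * g t \<partial>M\<bar> \<le> \<tau>"
    by (rule concentrated_smooth_function[OF c crit[folded s_def] s \<rho>0(1) \<tau>(1,2)]) (rule that, assumption+)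
  obtain \<zeta> where \<zeta>: "\<zeta> \<in> test_functions" "\<And>x. x \<in> {a..b} \<Longrightarrow> (deriv ^^ m) \<zeta> x = g x" "vanishes_beyond c \<rho>0 \<zeta>"
    "\<And>j. j \<le> m \<Longrightarrow> N ((deriv ^^ j) \<zeta>) \<le> C * N g"
    "\<And>i. i < m \<Longrightarrow> \<bar>(deriv ^^ i) \<zeta> c\<bar> = \<bar>\<integral>t. \<bar>t - c\<bar> ^ (m - i - 1) / fact (m - i - 1) * g t \<partial>M\<bar>"
    using primitive[rule_format, OF \<rho>0(3,4) g(1,4)] by blast
  define d where "d = (\<lambda>i. (deriv ^^ i) \<zeta> c)"
  have d: "\<bar>d i\<bar> = \<bar>\<integral>t. \<bar>t - c\<bar> ^ (m - i - 1) * g t \<partial>M\<bar> / fact (m - i - 1)" if "i < m" for i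
  proof -
    have "(\<integral>t. \<bar>t - c\<bar> ^ (m - i - 1) / fact (m - i - 1) * g t \<partial>M) =
        (\<integral>t. \<bar>t - c\<bar> ^ (m - i - 1) * g t / fact (m - i - 1) \<partial>M)"
      by (intro Bochner_Integration.integral_cong) auto
    also have "\<dots> = (\<integral>t. \<bar>t - c\<bar> ^ (m - i - 1) * g t \<partial>M) / fact (m - i - 1)"
      by (rule integral_divide_zero)
    finally show ?thesis
      unfolding d_def \<zeta>(5)[OF that] by simp
  qed
  have dk: "1 / (2 * F) \<le> \<bar>d k\<bar>"
  proof -
    have "\<bar>d k\<bar> = \<bar>\<integral>t. \<bar>t - c\<bar> ^ s * g t \<partial>M\<bar> / F"
      using d[OF k] by (simp only: s_def F_def)
    moreover have "(1 / 2) / F \<le> \<bar>\<integral>t. \<bar>t - c\<bar> ^ s * g t \<partial>M\<bar> / F"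
      using g(6) F by (intro divide_right_mono) auto
    ultimately show ?thesis
      by simp
  qed
  have d_low: "\<bar>d i\<bar> \<le> \<tau>" if "i < k" for i
  proof -
    have "i < m" "s < m - i - 1" "m - i - 1 < m"
      using that k by (auto simp: s_def)
    then have "\<bar>d i\<bar> \<le> \<tau> / fact (m - i - 1)"
      unfolding d[OF \<open>i < m\<close>] using g(7) by (intro divide_right_mono) auto
    also have "\<dots> \<le> \<tau> / 1"
      using \<tau> by (intro divide_left_mono) auto
    finally show ?thesis
      by simp
  qed
  have "\<forall>i\<in>{k<..<m}. \<exists>X. corrector c m \<rho> X \<and> (\<forall>l<m. (deriv ^^ l) X c = (if l = i then 1 else 0)) \<and>
      (\<forall>j\<le>m. N ((deriv ^^ j) X) \<le> \<tau> / (real m * (1 + \<bar>d i\<bar>)))"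
  proof
    fix i assume i: "i \<in> {k<..<m}"
    have "real (m - i - 1) \<le> real (m - k - 1)"
      using i by (intro of_nat_mono) auto
    from crit_antimono[OF this] crit have "c \<in> crit a b p w (real (m - i - 1))"
      by blast
    then show "\<exists>X. corrector c m \<rho> X \<and> (\<forall>l<m. (deriv ^^ l) X c = (if l = i then 1 else 0)) \<and>
        (\<forall>j\<le>m. N ((deriv ^^ j) X) \<le> \<tau> / (real m * (1 + \<bar>d i\<bar>)))"
      using i k \<tau>(1) by (intro less.hyps) (auto intro!: divide_pos_pos mult_pos_pos)
  qed
  then obtain X where X: "\<And>i. i \<in> {k<..<m} \<Longrightarrow> corrector c m \<rho> (X i)"
    "\<And>i l. i \<in> {k<..<m} \<Longrightarrow> l < m \<Longrightarrow> (deriv ^^ l) (X i) c = (if l = i then 1 else 0)"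
    "\<And>i j. i \<in> {k<..<m} \<Longrightarrow> j \<le> m \<Longrightarrow> N ((deriv ^^ j) (X i)) \<le> \<tau> / (real m * (1 + \<bar>d i\<bar>))"
    by metis
  define Z where "Z = (\<lambda>i. if i < k then e i else if i = k then \<zeta> else X i)"
  define \<beta> where "\<beta> = (\<lambda>i. if i = k then 1 / d k else - d i / d k)"
  have dk0: "d k \<noteq> 0"
    using dk F by auto
  have Zk: "Z k = \<zeta>" and Z_less: "\<And>i. i < k \<Longrightarrow> Z i = e i" and Z_greater: "\<And>i. k < i \<Longrightarrow> Z i = X i"
    by (auto simp: Z_def)
  have "corrector c m \<rho> \<zeta>"
  proof -
    have "\<forall>\<^sub>F x in nhds c. x \<in> ball c \<delta>"
      using g(2) by (intro eventually_nhds_in_open) auto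
    then have "\<forall>\<^sub>F x in nhds c. x \<in> I \<longrightarrow> (deriv ^^ m) \<zeta> x = 0"
      by eventually_elim (use \<zeta>(2) g(3) in \<open>auto simp: dist_real_def abs_minus_commute\<close>)
    then show ?thesis
      using \<zeta>(1,3) \<rho>0(2) by (auto simp: corrector_def vanishes_beyond_def)
  qed
  then have Z: "corrector c m \<rho> (Z i)" if "i \<in> {..<m}" for i
    using that e(1) X(1) k by (auto simp: Z_def)
  then have Z_test: "Z i \<in> test_functions" if "i \<in> {..<m}" for i
    using that by (simp add: corrector_def)
  have Z_trace: "(deriv ^^ l) (Z i) c = (if l = i then 1 else 0)" if "i < m" "i \<noteq> k" "l < m" for i l
    using that e(2) X(2) by (auto simp: Z_def)
  define Y where "Y = (\<lambda>x. \<Sum>i<m. \<beta> i * Z i x)"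
  have trace: "(deriv ^^ l) Y c = (if l = k then 1 else 0)" if l: "l < m" for l
  proof -
    have "(deriv ^^ l) Y c = (\<Sum>i<m. \<beta> i * (deriv ^^ l) (Z i) c)"
      unfolding Y_def by (subst deriv_iter_combination[OF test_smooth[OF Z_test]]) auto
    also have "\<dots> = \<beta> k * (deriv ^^ l) (Z k) c + (\<Sum>i\<in>{..<m} - {k}. \<beta> i * (deriv ^^ l) (Z i) c)"
      using k by (subst sum.remove[of _ k]) auto
    also have "(\<Sum>i\<in>{..<m} - {k}. \<beta> i * (deriv ^^ l) (Z i) c) = (\<Sum>i\<in>{..<m} - {k}. if i = l then \<beta> i else 0)"
      by (intro sum.cong) (use Z_trace l in auto)
    also have "\<dots> = (if l = k then 0 else \<beta> l)"
      using l by (subst sum.delta) auto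
    finally show ?thesis
      using dk0 by (auto simp: Zk \<beta>_def d_def)
  qed
  have inv: "1 / \<bar>d k\<bar> \<le> 2 * F"
  proof -
    have "1 \<le> \<bar>d k\<bar> * (2 * F)"
      using dk F by (simp add: divide_le_eq)
    then show ?thesis
      using dk0 by (simp add: divide_le_eq mult.commute)
  qed
  have norm: "N ((deriv ^^ j) Y) \<le> \<eta>" if j: "j \<le> m" for j
  proof -
    have "N ((deriv ^^ j) Y) \<le> (\<Sum>i<m. \<bar>\<beta> i\<bar> * N ((deriv ^^ j) (Z i)))"
      unfolding Y_def by (rule N_combination) (rule Z_test)
    also have "\<dots> \<le> (\<Sum>i<m. 2 * F * ((if i = k then C * \<tau> else 0) + (\<tau> * E + \<tau> / m)))"
    proof (rule sum_mono)
      fix i assume i: "i \<in> {..<m}"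
      have rest: "0 \<le> \<tau> * E" "0 \<le> \<tau> / m"
        using \<tau> E0 by auto
      show "\<bar>\<beta> i\<bar> * N ((deriv ^^ j) (Z i)) \<le> 2 * F * ((if i = k then C * \<tau> else 0) + (\<tau> * E + \<tau> / m))"
      proof (cases "i = k")
        case True
        have "N ((deriv ^^ j) \<zeta>) \<le> C * \<tau>"
          using \<zeta>(4)[OF j] mult_left_mono[OF g(5) C] by simp
        then have "(1 / \<bar>d k\<bar>) * N ((deriv ^^ j) \<zeta>) \<le> 2 * F * (C * \<tau> + (\<tau> * E + \<tau> / m))"
          using inv rest N_nonneg F by (intro mult_mono) auto
        then show ?thesis
          using True by (simp add: Zk \<beta>_def)
      next
        case False
        have "\<bar>d i\<bar> * N ((deriv ^^ j) (Z i)) \<le> \<tau> * E + \<tau> / m"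
        proof (cases "i < k")
          case True
          then have "\<bar>d i\<bar> * N ((deriv ^^ j) (e i)) \<le> \<tau> * E"
            using d_low[OF True] E[of i j] i j \<tau> N_nonneg by (intro mult_mono) auto
          then show ?thesis
            using Z_less[OF True] rest(2) by simp
        next
          case ik: False
          then have ki: "k < i" "i \<in> {k<..<m}"
            using False i by auto
          have "\<bar>d i\<bar> * N ((deriv ^^ j) (X i)) \<le> (1 + \<bar>d i\<bar>) * (\<tau> / (real m * (1 + \<bar>d i\<bar>)))"
            using X(3)[OF ki(2) j] N_nonneg by (intro mult_mono) auto
          also have "\<dots> = \<tau> / m"
          proof -
            have "1 + \<bar>d i\<bar> \<noteq> 0"
              using abs_ge_zero[of "d i"] by linarith
            then show ?thesis
              by (simp add: mult.commute)
          qed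
          finally show ?thesis
            using Z_greater[OF ki(1)] rest(1) by simp
        qed
        then have "(1 / \<bar>d k\<bar>) * (\<bar>d i\<bar> * N ((deriv ^^ j) (Z i))) \<le> 2 * F * (\<tau> * E + \<tau> / m)"
          using inv F N_nonneg by (intro mult_mono) auto
        then show ?thesis
          using False by (simp add: \<beta>_def)
      qed
    qed
    also have "\<dots> = 2 * F * (C * \<tau> + (real m * (\<tau> * E) + real m * (\<tau> / m)))"
      unfolding sum_distrib_left[symmetric] sum.distrib using k by simp
    also have "\<dots> = G * \<tau>"
      using k by (simp add: G_def algebra_simps)
    also have "\<dots> \<le> \<eta>"
      by (rule \<tau>(3))
    finally show ?thesis .
  qed
  have "corrector c m \<rho> Y"
    unfolding Y_def by (rule corrector_combination) (use Z in auto)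
  then show ?case
    using trace norm by blast
qed

end

context stable_interval
begin

lemma monotone_at_critical_endpoint:
  assumes c: "c = a \<or> c = b" and crit: "c \<in> crit a b p w 0"
  obtains r w' where "0 < r" "AE x in M. w' x = w x"
    "\<And>x y. x \<in> I \<Longrightarrow> y \<in> I \<Longrightarrow> \<bar>y - c\<bar> < r \<Longrightarrow> \<bar>x - c\<bar> \<le> \<bar>y - c\<bar> \<Longrightarrow> w' x \<le> w' y"
proof -
  have empty: "{a..b} \<inter> {b<..<b + 1} = {}" "{a..b} \<inter> {a - 1<..<a} = {}"
    by auto
  have one_sided: "c = b \<Longrightarrow> c \<notin> crit_right a b p w 0" "c = a \<Longrightarrow> c \<notin> crit_left a b p w 0"
    using not_crit_infinite_empty[OF empty(1), of 0 b] not_crit_infinite_empty[OF empty(2), of 0 a]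
    by (auto simp: crit_right_def crit_left_def intro!: exI[of _ 1])
  have "right_stable a b p w c \<or> left_stable a b p w c"
    using stable crit by (simp add: stable_weight_def)
  then have "\<exists>r>0. nondecreasing_rep_on a b w c (if c = a then {c<..<c + r} else {c - r<..<c})"
    using one_sided c ab by (auto simp: right_stable_def left_stable_def)
  then obtain r w' where r: "0 < r" "AE x in M. w' x = w x"
    "\<forall>x\<in>(if c = a then {c<..<c + r} else {c - r<..<c}) \<inter> I.
      \<forall>y\<in>(if c = a then {c<..<c + r} else {c - r<..<c}) \<inter> I. \<bar>x - c\<bar> \<le> \<bar>y - c\<bar> \<longrightarrow> w' x \<le> w' y"
    unfolding nondecreasing_rep_on_def by blast
  have side: "x \<in> (if c = a then {c<..<c + r} else {c - r<..<c}) \<inter> I" if "x \<in> I" "\<bar>x - c\<bar> < r" for x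
    using that c by auto
  show thesis
  proof (rule that[OF r(1,2)])
    show "w' x \<le> w' y" if "x \<in> I" "y \<in> I" "\<bar>y - c\<bar> < r" "\<bar>x - c\<bar> \<le> \<bar>y - c\<bar>" for x y
      using r(3) side[of x] side[of y] that by fastforce
  qed
qed

text \<open>
  After flattening, the error in the values that have traces is at most \<open>2 * \<theta>\<close> and is corrected by
  fixed profiles; the number \<open>\<theta>\<close> can be chosen before \<open>\<phi>\<close>. The remaining errors are arbitrary, but they are
  corrected by functions chosen afterwards, as small as needed.
\<close>

lemma correction:
  assumes c: "c = a \<or> c = b" and m: "1 \<le> m" and \<rho>: "0 < \<rho>" and \<eta>: "0 < \<eta>"
  shows "\<exists>\<theta>>0. \<forall>\<phi>\<in>test_functions.
      (\<forall>k<m. int k \<le> kbar a b p w m c \<longrightarrow> \<bar>(deriv ^^ k) \<phi> c - v k\<bar> \<le> \<theta>) \<longrightarrow>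
      (\<exists>\<psi>\<in>test_functions. (\<forall>k. \<forall>x\<in>{a..b}. \<rho> \<le> \<bar>x - c\<bar> \<longrightarrow> (deriv ^^ k) \<psi> x = (deriv ^^ k) \<phi> x) \<and>
        (\<forall>k<m. (deriv ^^ k) \<psi> c = v k) \<and> (\<forall>\<^sub>F x in nhds c. x \<in> I \<longrightarrow> (deriv ^^ m) \<psi> x = 0) \<and>
        (\<forall>j\<le>m. N (\<lambda>x. (deriv ^^ j) \<phi> x - (deriv ^^ j) \<psi> x) \<le> \<eta>))"
proof -
  obtain e E where e: "\<And>i. i < m \<Longrightarrow> corrector c m \<rho> (e i)"
    "\<And>i l. i < m \<Longrightarrow> (deriv ^^ l) (e i) c = (if l = i then 1 else 0)"
    and E: "\<And>i j. i < m \<Longrightarrow> j \<le> m \<Longrightarrow> N ((deriv ^^ j) (e i)) \<le> E" and E0: "0 \<le> E"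
    by (rule profiles_exist[OF \<rho>, of m c]) (rule that, assumption+)
  define \<theta> where "\<theta> = min (\<eta> / 3) (\<eta> / (6 * (real m * E + 1)))"
  have mE: "0 \<le> real m * E"
    using E0 by simp
  have \<theta>: "0 < \<theta>" "\<theta> \<le> \<eta> / 3"
  proof -
    show "0 < \<theta>"
      using \<eta> mE by (simp add: \<theta>_def)
    show "\<theta> \<le> \<eta> / 3"
      unfolding \<theta>_def by (rule min.cobounded1)
  qed
  have "\<theta> \<le> \<eta> / (6 * (real m * E + 1))"
    by (simp add: \<theta>_def)
  then have "\<theta> * (6 * (real m * E + 1)) \<le> \<eta>"
    using mE by (subst (asm) pos_le_divide_eq) auto
  then have \<theta>E: "real m * (2 * \<theta> * E) \<le> \<eta> / 3"
    using \<theta>(1) by (simp add: algebra_simps)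
  show ?thesis
  proof (intro exI[of _ \<theta>] conjI \<theta>(1) ballI impI)
    fix \<phi>
    assume \<phi>: "\<phi> \<in> test_functions"
      and close: "\<forall>k<m. int k \<le> kbar a b p w m c \<longrightarrow> \<bar>(deriv ^^ k) \<phi> c - v k\<bar> \<le> \<theta>"
    obtain Y where Y: "Y \<in> test_functions" "vanishes_beyond c \<rho> Y" "\<And>k. k \<le> m \<Longrightarrow> N ((deriv ^^ k) Y) \<le> \<theta>"
      "\<And>k. k < m \<Longrightarrow> \<bar>(deriv ^^ k) Y c\<bar> \<le> \<theta>"
      "\<forall>\<^sub>F x in nhds c. x \<in> I \<longrightarrow> (deriv ^^ m) Y x = (deriv ^^ m) \<phi> x"
      by (rule flattening[OF c \<phi> \<rho> \<theta>(1), of m]) (rule that, assumption+)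
    define \<alpha> where "\<alpha> = (\<lambda>k. v k - ((deriv ^^ k) \<phi> c - (deriv ^^ k) Y c))"
    have \<alpha>: "\<bar>\<alpha> k\<bar> \<le> 2 * \<theta>" if "k < m" "int k \<le> kbar a b p w m c" for k
      using close[rule_format, OF that] Y(4)[OF that(1)] unfolding \<alpha>_def by linarith
    have "\<exists>X. corrector c m \<rho> X \<and> (\<forall>i<m. (deriv ^^ i) X c = (if i = k then 1 else 0)) \<and>
        (\<forall>j\<le>m. \<bar>\<alpha> k\<bar> * N ((deriv ^^ j) X) \<le> 2 * \<theta> * E + \<eta> / 3 / m)" if k: "k < m" for k
    proof (cases "int k \<le> kbar a b p w m c")
      case True
      have "\<bar>\<alpha> k\<bar> * N ((deriv ^^ j) (e k)) \<le> 2 * \<theta> * E + \<eta> / 3 / m" if "j \<le> m" for j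
      proof -
        have "\<bar>\<alpha> k\<bar> * N ((deriv ^^ j) (e k)) \<le> 2 * \<theta> * E"
          using \<alpha>[OF k True] E[OF k that] N_nonneg \<theta>(1) by (intro mult_mono) auto
        also have "\<dots> \<le> 2 * \<theta> * E + \<eta> / 3 / m"
          using \<eta> by simp
        finally show ?thesis .
      qed
      then show ?thesis
        using e[OF k] by blast
    next
      case False
      then have crit: "c \<in> crit a b p w (real (m - k - 1))"
        unfolding le_kbar_iff[OF k] by simp
      then have "c \<in> crit a b p w 0"
        using crit_antimono[of 0 "real (m - k - 1)"] by auto
      then obtain r w' where rw: "0 < r" "AE x in M. w' x = w x"
        "\<And>x y. x \<in> I \<Longrightarrow> y \<in> I \<Longrightarrow> \<bar>y - c\<bar> < r \<Longrightarrow> \<bar>x - c\<bar> \<le> \<bar>y - c\<bar> \<Longrightarrow> w' x \<le> w' y"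
        using monotone_at_critical_endpoint[OF c] by blast
      have pos: "0 < \<eta> / 3 / (real m * (1 + \<bar>\<alpha> k\<bar>))"
        using \<eta> m by (intro divide_pos_pos mult_pos_pos) auto
      obtain X where X: "corrector c m \<rho> X" "\<forall>i<m. (deriv ^^ i) X c = (if i = k then 1 else 0)"
        "\<forall>j\<le>m. N ((deriv ^^ j) X) \<le> \<eta> / 3 / (real m * (1 + \<bar>\<alpha> k\<bar>))"
        using small_corrector[OF c rw k crit \<rho> pos] by blast
      have "\<bar>\<alpha> k\<bar> * N ((deriv ^^ j) X) \<le> 2 * \<theta> * E + \<eta> / 3 / m" if "j \<le> m" for j
      proof -
        have "\<bar>\<alpha> k\<bar> * N ((deriv ^^ j) X) \<le> (1 + \<bar>\<alpha> k\<bar>) * (\<eta> / 3 / (real m * (1 + \<bar>\<alpha> k\<bar>)))"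
          using X(3) that N_nonneg by (intro mult_mono) auto
        also have "\<dots> = \<eta> / 3 / m"
        proof -
          have "1 + \<bar>\<alpha> k\<bar> \<noteq> 0"
            using abs_ge_zero[of "\<alpha> k"] by linarith
          then show ?thesis
            by (simp add: mult.commute)
        qed
        also have "\<dots> \<le> 2 * \<theta> * E + \<eta> / 3 / m"
          using \<theta>(1) E0 by simp
        finally show ?thesis .
      qed
      then show ?thesis
        using X(1,2) by blast
    qed
    then obtain X where X: "\<And>k. k < m \<Longrightarrow> corrector c m \<rho> (X k)"
      "\<And>k i. k < m \<Longrightarrow> i < m \<Longrightarrow> (deriv ^^ i) (X k) c = (if i = k then 1 else 0)"
      "\<And>k j. k < m \<Longrightarrow> j \<le> m \<Longrightarrow> \<bar>\<alpha> k\<bar> * N ((deriv ^^ j) (X k)) \<le> 2 * \<theta> * E + \<eta> / 3 / m"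
      by metis
    have X_test: "X k \<in> test_functions" if "k \<in> {..<m}" for k
      using X(1) that by (auto simp: corrector_def)
    define Z where "Z = (\<lambda>x. \<Sum>k<m. \<alpha> k * X k x)"
    have Z: "corrector c m \<rho> Z"
      unfolding Z_def by (rule corrector_combination) (use X(1) in auto)
    then have Z_test: "Z \<in> test_functions"
      by (simp add: corrector_def)
    define \<psi> where "\<psi> = (\<lambda>x. (\<phi> x - Y x) + Z x)"
    have \<psi>_test: "\<psi> \<in> test_functions"
      unfolding \<psi>_def by (intro test_add test_diff \<phi> Y(1) Z_test)
    have D: "(deriv ^^ j) \<psi> = (\<lambda>x. ((deriv ^^ j) \<phi> x - (deriv ^^ j) Y x) + (deriv ^^ j) Z x)" for j
      unfolding \<psi>_def using test_smooth[OF \<phi>] test_smooth[OF Y(1)] test_smooth[OF Z_test]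
      by (simp add: deriv_iter_add deriv_iter_diff smooth_diff)
    have Z_trace: "(deriv ^^ l) Z c = \<alpha> l" if l: "l < m" for l
    proof -
      have "(deriv ^^ l) Z c = (\<Sum>k<m. \<alpha> k * (deriv ^^ l) (X k) c)"
        unfolding Z_def by (subst deriv_iter_combination[OF test_smooth[OF X_test]]) auto
      also have "\<dots> = (\<Sum>k<m. if k = l then \<alpha> k else 0)"
        by (intro sum.cong) (use X(2) l in auto)
      finally show ?thesis
        using l by simp
    qed
    show "\<exists>\<psi>\<in>test_functions. (\<forall>k. \<forall>x\<in>{a..b}. \<rho> \<le> \<bar>x - c\<bar> \<longrightarrow> (deriv ^^ k) \<psi> x = (deriv ^^ k) \<phi> x) \<and>
        (\<forall>k<m. (deriv ^^ k) \<psi> c = v k) \<and> (\<forall>\<^sub>F x in nhds c. x \<in> I \<longrightarrow> (deriv ^^ m) \<psi> x = 0) \<and>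
        (\<forall>j\<le>m. N (\<lambda>x. (deriv ^^ j) \<phi> x - (deriv ^^ j) \<psi> x) \<le> \<eta>)"
    proof (intro bexI[OF _ \<psi>_test] conjI allI ballI impI)
      show "(deriv ^^ k) \<psi> x = (deriv ^^ k) \<phi> x" if "x \<in> {a..b}" "\<rho> \<le> \<bar>x - c\<bar>" for k x
        using Y(2) Z that by (simp add: D vanishes_beyond_def corrector_def)
      show "(deriv ^^ k) \<psi> c = v k" if "k < m" for k
        using Z_trace[OF that] by (simp add: D \<alpha>_def)
      have "\<forall>\<^sub>F x in nhds c. x \<in> I \<longrightarrow> (deriv ^^ m) Z x = 0"
        using Z by (simp add: corrector_def)
      with Y(5) show "\<forall>\<^sub>F x in nhds c. x \<in> I \<longrightarrow> (deriv ^^ m) \<psi> x = 0"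
        by eventually_elim (auto simp: D)
      fix j assume j: "j \<le> m"
      have "N (\<lambda>x. (deriv ^^ j) \<phi> x - (deriv ^^ j) \<psi> x) = N (\<lambda>x. (deriv ^^ j) Y x - (deriv ^^ j) Z x)"
        by (rule N_cong) (simp add: D)
      also have "\<dots> \<le> N ((deriv ^^ j) Y) + N ((deriv ^^ j) Z)"
        by (intro N_triangle_diff test_L Y(1) Z_test)
      also have "N ((deriv ^^ j) Z) \<le> (\<Sum>k<m. \<bar>\<alpha> k\<bar> * N ((deriv ^^ j) (X k)))"
        unfolding Z_def by (rule N_combination) (rule X_test)
      also have "\<dots> \<le> (\<Sum>k<m. 2 * \<theta> * E + \<eta> / 3 / m)"
        by (intro sum_mono X(3) j) auto
      also have "\<dots> = real m * (2 * \<theta> * E) + \<eta> / 3"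
        using m by (simp add: distrib_left)
      finally show "N (\<lambda>x. (deriv ^^ j) \<phi> x - (deriv ^^ j) \<psi> x) \<le> \<eta>"
        using Y(3)[OF j] \<theta>(2) \<theta>E by linarith
    qed
  qed
qed

end

section \<open>Approximation with prescribed boundary values\<close>

theorem theorem5p2:
  fixes a b p :: real and w u :: "real \<Rightarrow> real" and m :: nat
  assumes "a < b" and "1 \<le> p" and "stable_weight a b p w" and "1 \<le> m"
    and "u \<in> H_space a b p w m"
  shows
    "(\<forall>v. compatible a b p w m u a v \<longrightarrow>
        (\<forall>\<epsilon>>0. \<exists>u\<^sub>\<epsilon>\<in>test_functions. \<exists>\<delta>>0.
           H_norm a b p w m (\<lambda>x. u x - u\<^sub>\<epsilon> x) < \<epsilon> \<and>
           (\<forall>k<m. (deriv ^^ k) u\<^sub>\<epsilon> a = v k) \<and>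
           (\<forall>x\<in>ball a \<delta> \<inter> {a<..<b}. (deriv ^^ m) u\<^sub>\<epsilon> x = 0)))
   \<and> (\<forall>v. compatible a b p w m u b v \<longrightarrow>
        (\<forall>\<epsilon>>0. \<exists>u\<^sub>\<epsilon>\<in>test_functions. \<exists>\<delta>>0.
           H_norm a b p w m (\<lambda>x. u x - u\<^sub>\<epsilon> x) < \<epsilon> \<and>
           (\<forall>k<m. (deriv ^^ k) u\<^sub>\<epsilon> b = v k) \<and>
           (\<forall>x\<in>ball b \<delta> \<inter> {a<..<b}. (deriv ^^ m) u\<^sub>\<epsilon> x = 0)))
   \<and> (\<forall>v\<^sub>a v\<^sub>b. compatible a b p w m u a v\<^sub>a \<longrightarrow> compatible a b p w m u b v\<^sub>b \<longrightarrow>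
        (\<forall>\<epsilon>>0. \<exists>u\<^sub>\<epsilon>\<in>test_functions. \<exists>\<delta>>0.
           H_norm a b p w m (\<lambda>x. u x - u\<^sub>\<epsilon> x) < \<epsilon> \<and>
           (\<forall>k<m. (deriv ^^ k) u\<^sub>\<epsilon> a = v\<^sub>a k \<and> (deriv ^^ k) u\<^sub>\<epsilon> b = v\<^sub>b k) \<and>
           (\<forall>x\<in>(ball a \<delta> \<union> ball b \<delta>) \<inter> {a<..<b}. (deriv ^^ m) u\<^sub>\<epsilon> x = 0)))"
proof -
  interpret stable_interval a b p w
    by unfold_locales (use assms in \<open>auto simp: stable_weight_def\<close>)
  have both: "\<exists>\<psi>\<in>test_functions. \<exists>\<delta>>0. H_norm a b p w m (\<lambda>x. u x - \<psi> x) < \<epsilon> \<and>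
      (\<forall>k<m. (deriv ^^ k) \<psi> a = v k \<and> (deriv ^^ k) \<psi> b = v' k) \<and>
      (\<forall>x\<in>(ball a \<delta> \<union> ball b \<delta>) \<inter> {a<..<b}. (deriv ^^ m) \<psi> x = 0)"
    if va: "compatible a b p w m u a v" and vb: "compatible a b p w m u b v'" and \<epsilon>: "0 < \<epsilon>" for v v' \<epsilon>
  proof -
    define \<eta> where "\<eta> = \<epsilon> / (1 + real m) / 4"
    have \<eta>: "0 < \<eta>"
      using \<epsilon> by (simp add: \<eta>_def)
    define \<rho> where "\<rho> = (b - a) / 2"
    have \<rho>: "0 < \<rho>"
      using ab by (simp add: \<rho>_def)
    obtain D \<phi> where D: "D 0 = u" "approximates m D \<phi>"
      using assms(5) by (auto simp: H_space_def is_derivs_iff)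
    have \<phi>: "\<phi> h \<in> test_functions" for h
      using D(2) by (simp add: approximates_def)
    obtain \<theta>a where \<theta>a: "0 < \<theta>a" and correct_a: "\<forall>\<phi>\<in>test_functions.
      (\<forall>k<m. int k \<le> kbar a b p w m a \<longrightarrow> \<bar>(deriv ^^ k) \<phi> a - v k\<bar> \<le> \<theta>a) \<longrightarrow>
      (\<exists>\<psi>\<in>test_functions. (\<forall>k. \<forall>x\<in>{a..b}. \<rho> \<le> \<bar>x - a\<bar> \<longrightarrow> (deriv ^^ k) \<psi> x = (deriv ^^ k) \<phi> x) \<and>
        (\<forall>k<m. (deriv ^^ k) \<psi> a = v k) \<and> (\<forall>\<^sub>F x in nhds a. x \<in> I \<longrightarrow> (deriv ^^ m) \<psi> x = 0) \<and>
        (\<forall>j\<le>m. N (\<lambda>x. (deriv ^^ j) \<phi> x - (deriv ^^ j) \<psi> x) \<le> \<eta>))"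
      using correction[of a m \<rho> \<eta> v] assms(4) \<rho> \<eta> by blast
    obtain \<theta>b where \<theta>b: "0 < \<theta>b" and correct_b: "\<forall>\<phi>\<in>test_functions.
      (\<forall>k<m. int k \<le> kbar a b p w m b \<longrightarrow> \<bar>(deriv ^^ k) \<phi> b - v' k\<bar> \<le> \<theta>b) \<longrightarrow>
      (\<exists>\<psi>\<in>test_functions. (\<forall>k. \<forall>x\<in>{a..b}. \<rho> \<le> \<bar>x - b\<bar> \<longrightarrow> (deriv ^^ k) \<psi> x = (deriv ^^ k) \<phi> x) \<and>
        (\<forall>k<m. (deriv ^^ k) \<psi> b = v' k) \<and> (\<forall>\<^sub>F x in nhds b. x \<in> I \<longrightarrow> (deriv ^^ m) \<psi> x = 0) \<and>
        (\<forall>j\<le>m. N (\<lambda>x. (deriv ^^ j) \<phi> x - (deriv ^^ j) \<psi> x) \<le> \<eta>))"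
      using correction[of b m \<rho> \<eta> v'] assms(4) \<rho> \<eta> by blast
    have trace: "\<forall>\<^sub>F h in sequentially. \<forall>k\<in>{..<m}. int k \<le> kbar a b p w m c \<longrightarrow> \<bar>(deriv ^^ k) (\<phi> h) c - t k\<bar> < \<theta>"
      if c: "c = a \<or> c = b" and t: "compatible a b p w m u c t" and \<theta>: "0 < \<theta>" for c t \<theta>
    proof (intro eventually_ball_finite ballI)
      fix k assume k: "k \<in> {..<m}"
      show "\<forall>\<^sub>F h in sequentially. int k \<le> kbar a b p w m c \<longrightarrow> \<bar>(deriv ^^ k) (\<phi> h) c - t k\<bar> < \<theta>"
      proof (cases "int k \<le> kbar a b p w m c")
        case True
        then have "(\<lambda>h. (deriv ^^ k) (\<phi> h) c) \<longlonglongrightarrow> t k"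
          using trace_limit_endpoint[OF c _ True D(2)] t k D(1) by (simp add: compatible_def)
        from tendstoD[OF this \<theta>] show ?thesis
          by eventually_elim (simp add: dist_real_def)
      qed simp
    qed simp
    have "\<forall>\<^sub>F h in sequentially. \<forall>j\<in>{..m}. N (\<lambda>x. (deriv ^^ j) (\<phi> h) x - D j x) < \<eta>"
      using D(2) \<eta> by (intro eventually_ball_finite ballI order_tendstoD(2)[of _ 0]) (auto simp: approximates_def)
    from eventually_conj[OF this eventually_conj[OF trace[OF _ va \<theta>a] trace[OF _ vb \<theta>b]]]
    obtain h where h: "\<And>j. j \<le> m \<Longrightarrow> N (\<lambda>x. (deriv ^^ j) (\<phi> h) x - D j x) < \<eta>"
      "\<And>k. k < m \<Longrightarrow> int k \<le> kbar a b p w m a \<Longrightarrow> \<bar>(deriv ^^ k) (\<phi> h) a - v k\<bar> < \<theta>a"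
      "\<And>k. k < m \<Longrightarrow> int k \<le> kbar a b p w m b \<Longrightarrow> \<bar>(deriv ^^ k) (\<phi> h) b - v' k\<bar> < \<theta>b"
      using eventually_happens'[OF sequentially_bot] by fastforce
    obtain \<xi> where \<xi>: "\<xi> \<in> test_functions"
      "\<And>k x. x \<in> {a..b} \<Longrightarrow> \<rho> \<le> \<bar>x - a\<bar> \<Longrightarrow> (deriv ^^ k) \<xi> x = (deriv ^^ k) (\<phi> h) x"
      "\<And>k. k < m \<Longrightarrow> (deriv ^^ k) \<xi> a = v k" "\<forall>\<^sub>F x in nhds a. x \<in> I \<longrightarrow> (deriv ^^ m) \<xi> x = 0"
      "\<And>j. j \<le> m \<Longrightarrow> N (\<lambda>x. (deriv ^^ j) (\<phi> h) x - (deriv ^^ j) \<xi> x) \<le> \<eta>"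
      using correct_a[rule_format, OF \<phi> less_imp_le[OF h(2)]] by blast
    have far: "b \<in> {a..b}" "\<rho> \<le> \<bar>b - a\<bar>" "a \<in> {a..b}" "\<rho> \<le> \<bar>a - b\<bar>"
      using ab by (auto simp: \<rho>_def)
    have close_b: "\<bar>(deriv ^^ k) \<xi> b - v' k\<bar> \<le> \<theta>b" if "k < m" "int k \<le> kbar a b p w m b" for k
      using h(3)[OF that] \<xi>(2)[OF far(1,2)] by simp
    obtain \<psi> where \<psi>: "\<psi> \<in> test_functions"
      "\<And>k x. x \<in> {a..b} \<Longrightarrow> \<rho> \<le> \<bar>x - b\<bar> \<Longrightarrow> (deriv ^^ k) \<psi> x = (deriv ^^ k) \<xi> x"
      "\<And>k. k < m \<Longrightarrow> (deriv ^^ k) \<psi> b = v' k" "\<forall>\<^sub>F x in nhds b. x \<in> I \<longrightarrow> (deriv ^^ m) \<psi> x = 0"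
      "\<And>j. j \<le> m \<Longrightarrow> N (\<lambda>x. (deriv ^^ j) \<xi> x - (deriv ^^ j) \<psi> x) \<le> \<eta>"
      using correct_b[rule_format, OF \<xi>(1) close_b] by blast
    have "\<forall>\<^sub>F x in nhds a. x \<in> ball a \<rho>"
      using \<rho> by (intro eventually_nhds_in_open) auto
    with \<xi>(4) have "\<forall>\<^sub>F x in nhds a. x \<in> I \<longrightarrow> (deriv ^^ m) \<psi> x = 0"
    proof eventually_elim
      case (elim x)
      show ?case
      proof
        assume x: "x \<in> I"
        then have "\<rho> \<le> \<bar>x - b\<bar>"
          using elim(2) by (auto simp: dist_real_def \<rho>_def)
        then have "(deriv ^^ m) \<psi> x = (deriv ^^ m) \<xi> x"
          using x by (intro \<psi>(2)) auto
        then show "(deriv ^^ m) \<psi> x = 0"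
          using elim(1) x by simp
      qed
    qed
    then obtain \<delta>1 where \<delta>1: "0 < \<delta>1" "\<And>x. dist x a < \<delta>1 \<Longrightarrow> x \<in> I \<Longrightarrow> (deriv ^^ m) \<psi> x = 0"
      by (auto simp: eventually_nhds_metric)
    obtain \<delta>2 where \<delta>2: "0 < \<delta>2" "\<And>x. dist x b < \<delta>2 \<Longrightarrow> x \<in> I \<Longrightarrow> (deriv ^^ m) \<psi> x = 0"
      using \<psi>(4) by (auto simp: eventually_nhds_metric)
    have "N (\<lambda>x. D j x - (deriv ^^ j) \<psi> x) \<le> 3 * \<eta>" if j: "j \<le> m" for j
    proof -
      have L: "D j \<in> L" "(deriv ^^ j) (\<phi> h) \<in> L" "(deriv ^^ j) \<xi> \<in> L" "(deriv ^^ j) \<psi> \<in> L"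
        using D(2) j by (auto simp: approximates_def intro: test_L \<phi> \<xi>(1) \<psi>(1))
      show ?thesis
        using N_triangle3[OF L(1,2,4)] N_triangle3[OF L(2,3,4)] h(1)[OF j] \<xi>(5)[OF j] \<psi>(5)[OF j]
          N_diff_commute[of "D j" "(deriv ^^ j) (\<phi> h)"] by linarith
    qed
    then have "H_norm a b p w m (\<lambda>x. D 0 x - (deriv ^^ 0) \<psi> x) \<le> (1 + real m) * (3 * \<eta>)"
      using \<eta> by (intro H_norm_le[OF approximates_diff[OF D(2) approximates_const[OF \<psi>(1)]]]) auto
    also have "\<dots> < \<epsilon>"
    proof -
      have "4 * (x / 4) = x" for x :: real
        by simp
      then have "4 * \<eta> = \<epsilon> / (1 + real m)"
        unfolding \<eta>_def by blast
      then have "(1 + real m) * (4 * \<eta>) = \<epsilon>"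
        by simp
      then show ?thesis
        using mult_strict_left_mono[of "3 * \<eta>" "4 * \<eta>" "1 + real m"] \<eta> by simp
    qed
    finally have "H_norm a b p w m (\<lambda>x. u x - \<psi> x) < \<epsilon>"
      by (simp add: D(1))
    moreover have "(deriv ^^ k) \<psi> a = v k \<and> (deriv ^^ k) \<psi> b = v' k" if "k < m" for k
      using \<psi>(2)[OF far(3,4)] \<psi>(3)[OF that] \<xi>(3)[OF that] by simp
    moreover have "\<forall>x\<in>(ball a (min \<delta>1 \<delta>2) \<union> ball b (min \<delta>1 \<delta>2)) \<inter> I. (deriv ^^ m) \<psi> x = 0"
      using \<delta>1(2) \<delta>2(2) by (auto simp: dist_commute)
    ultimately show ?thesis
      using \<psi>(1) \<delta>1(1) \<delta>2(1) by (intro bexI[of _ \<psi>] exI[of _ "min \<delta>1 \<delta>2"]) auto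
  qed
  \<comment> \<open>The statements for one endpoint follow from the one for both, since the traces of \<open>u\<close>
    are admissible data at the other endpoint.\<close>
  have trivial: "compatible a b p w m u c (\<lambda>k. Tr a b p w m k u c)" for c
    by (simp add: compatible_def)
  show ?thesis
  proof (intro conjI allI impI)
    fix v :: "nat \<Rightarrow> real" and \<epsilon> :: real
    assume v: "compatible a b p w m u a v" and \<epsilon>: "0 < \<epsilon>"
    show "\<exists>\<psi>\<in>test_functions. \<exists>\<delta>>0. H_norm a b p w m (\<lambda>x. u x - \<psi> x) < \<epsilon> \<and>
        (\<forall>k<m. (deriv ^^ k) \<psi> a = v k) \<and> (\<forall>x\<in>ball a \<delta> \<inter> {a<..<b}. (deriv ^^ m) \<psi> x = 0)"
      using both[OF v trivial \<epsilon>] by blast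
  next
    fix v :: "nat \<Rightarrow> real" and \<epsilon> :: real
    assume v: "compatible a b p w m u b v" and \<epsilon>: "0 < \<epsilon>"
    show "\<exists>\<psi>\<in>test_functions. \<exists>\<delta>>0. H_norm a b p w m (\<lambda>x. u x - \<psi> x) < \<epsilon> \<and>
        (\<forall>k<m. (deriv ^^ k) \<psi> b = v k) \<and> (\<forall>x\<in>ball b \<delta> \<inter> {a<..<b}. (deriv ^^ m) \<psi> x = 0)"
      using both[OF trivial v \<epsilon>] by blast
  qed (rule both)
qed

end
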